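(* Let $m\ge2$ be an integer. In the word RAM model with word size $w\ge2\log m$, any array $A[1..m']$ of $m'\le m$ positive integers such that $\sum_{i=1}^{m'}A[i]=O(m\log m)$ can be preprocessed in $O(m)$ time so that range counting queries on $A$ can be answered in $O(1)$ time.
   Context: $\log$ is base 2. The word RAM has $w$-bit words, with standard bitwise and arithmetic operations in $O(1)$ time. Range counting query on an array $A[1..m']$: given $j\in\{0,\dots,m'\}$ and an integer $v\ge0$, return $|\{i\in\{1,\dots,j\}:A[i]\ge v\}|$. The hypothesis on the sum means $\sum_{i=1}^{m'}A[i]\le c_0\,m\log m$ for a fixed constant $c_0$; the constants hidden in the $O(m)$ and $O(1)$ bounds may depend on $c_0$ but not on $m$, $m'$, $A$, or $w$. *)

theory Defs
  imports Complex_Main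
begin

section \<open>A word RAM with \<open>w\<close>-bit words\<close>

text \<open>
  A word is a natural number below \<open>2 ^ w\<close>.  The word size \<open>w\<close> is a parameter of the semantics and
  not of the program syntax, so one program runs at every word size.  A machine has registers (each
  program, being finite, mentions only finitely many of them) and a memory addressed by words, so
  the addressable memory consists of the cells \<open>0, \<dots>, 2 ^ w - 1\<close>.
\<close>

datatype binop = Add | Sub | Mul | Div | Mod | And | Or | Xor | Shl | Shr

text \<open>
  Arithmetic is modulo \<open>2 ^ w\<close>.  Division by zero follows the HOL convention: quotient \<open>0\<close>, remainder
  the dividend.  Shifts by \<open>w\<close> or more positions yield \<open>0\<close>.
\<close>

fun binop_val :: "nat \<Rightarrow> binop \<Rightarrow> nat \<Rightarrow> nat \<Rightarrow> nat" where
  "binop_val w Add a b = (a + b) mod 2 ^ w"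
| "binop_val w Sub a b = (a + 2 ^ w - b) mod 2 ^ w"
| "binop_val w Mul a b = (a * b) mod 2 ^ w"
| "binop_val w Div a b = a div b"
| "binop_val w Mod a b = a mod b"
| "binop_val w And a b = and a b"
| "binop_val w Or a b = or a b"
| "binop_val w Xor a b = xor a b"
| "binop_val w Shl a b = push_bit b a mod 2 ^ w"
| "binop_val w Shr a b = drop_bit b a"

type_synonym reg = nat

text \<open>The destination register comes first; in \<open>Store a r\<close> register \<open>a\<close> holds the address.\<close>

datatype instr =
    Const reg nat
  | Copy reg reg
  | Complement reg reg
  | Binop binop reg reg reg
  | Load reg reg
  | Store reg reg

datatype test = Equal reg reg | Less reg reg

datatype prog =
    Skip
  | Instr instr
  | Seq prog prog
  | Cond test prog prog
  | While test prog

record ram_state =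
  regs :: "reg \<Rightarrow> nat"
  mem :: "nat \<Rightarrow> nat"

definition set_reg :: "reg \<Rightarrow> nat \<Rightarrow> ram_state \<Rightarrow> ram_state" where
  "set_reg r x s = s\<lparr>regs := (regs s)(r := x)\<rparr>"

definition set_mem :: "nat \<Rightarrow> nat \<Rightarrow> ram_state \<Rightarrow> ram_state" where
  "set_mem a x s = s\<lparr>mem := (mem s)(a := x)\<rparr>"

fun instr_val :: "nat \<Rightarrow> instr \<Rightarrow> ram_state \<Rightarrow> ram_state" where
  "instr_val w (Const d n) s = set_reg d (n mod 2 ^ w) s"
| "instr_val w (Copy d r) s = set_reg d (regs s r) s"
| "instr_val w (Complement d r) s = set_reg d (2 ^ w - 1 - regs s r) s"
| "instr_val w (Binop f d r q) s = set_reg d (binop_val w f (regs s r) (regs s q)) s"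
| "instr_val w (Load d a) s = set_reg d (mem s (regs s a)) s"
| "instr_val w (Store a r) s = set_mem (regs s a) (regs s r) s"

fun test_val :: "test \<Rightarrow> ram_state \<Rightarrow> bool" where
  "test_val (Equal r q) s \<longleftrightarrow> regs s r = regs s q"
| "test_val (Less r q) s \<longleftrightarrow> regs s r < regs s q"

text \<open>
  \<open>exec w p s t s'\<close>: at word size \<open>w\<close>, program \<open>p\<close> started in state \<open>s\<close> terminates in state \<open>s'\<close>
  after exactly \<open>t\<close> time units; every instruction and every evaluation of a test costs one unit.
\<close>

inductive exec :: "nat \<Rightarrow> prog \<Rightarrow> ram_state \<Rightarrow> nat \<Rightarrow> ram_state \<Rightarrow> bool" for w :: nat where
  Skip: "exec w Skip s 1 s"
| Instr: "exec w (Instr i) s 1 (instr_val w i s)"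
| Seq: "exec w p s t s' \<Longrightarrow> exec w q s' t' s'' \<Longrightarrow> exec w (Seq p q) s (t + t') s''"
| CondTrue: "test_val b s \<Longrightarrow> exec w p s t s' \<Longrightarrow> exec w (Cond b p q) s (1 + t) s'"
| CondFalse: "\<not> test_val b s \<Longrightarrow> exec w q s t s' \<Longrightarrow> exec w (Cond b p q) s (1 + t) s'"
| WhileFalse: "\<not> test_val b s \<Longrightarrow> exec w (While b p) s 1 s"
| WhileTrue: "test_val b s \<Longrightarrow> exec w p s t s' \<Longrightarrow> exec w (While b p) s' t' s'' \<Longrightarrow>
    exec w (While b p) s (1 + t + t') s''"

lemma exec_deterministic:
  "exec w p s t s' \<Longrightarrow> exec w p s u r \<Longrightarrow> u = t \<and> r = s'"
proof (induction arbitrary: u r rule: exec.induct)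
  case (Skip s)
  then show ?case by (auto elim: exec.cases)
next
  case (Instr i s)
  then show ?case by (auto elim: exec.cases)
next
  case (Seq p s t s' q t' s'')
  from Seq.prems show ?case by cases (use Seq.IH in blast)
next
  case (CondTrue b s p t s' q)
  from CondTrue.prems show ?case by cases (use CondTrue.IH CondTrue.hyps in blast)+
next
  case (CondFalse b s q t s' p)
  from CondFalse.prems show ?case by cases (use CondFalse.IH CondFalse.hyps in blast)+
next
  case (WhileFalse b s p)
  from WhileFalse.prems show ?case by cases (use WhileFalse.hyps in auto)
next
  case (WhileTrue b s p t s' t' s'')
  from WhileTrue.prems show ?case by cases (use WhileTrue.IH WhileTrue.hyps in blast)+
qed

definition word_state :: "nat \<Rightarrow> ram_state \<Rightarrow> bool" where
  "word_state w s \<longleftrightarrow> (\<forall>r. regs s r < 2 ^ w) \<and> (\<forall>a. mem s a < 2 ^ w)"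

lemma word_state_instr_val:
  assumes "word_state w s"
  shows "word_state w (instr_val w i s)"
proof -
  have closed: "binop_val w f a b < 2 ^ w" if "a < 2 ^ w" "b < 2 ^ w" for f a b
  proof -
    from that have tb: "take_bit w a = a" "take_bit w b = b"
      by (simp_all add: take_bit_nat_eq_self_iff)
    have "and a b < 2 ^ w" "or a b < 2 ^ w" "xor a b < 2 ^ w"
      unfolding take_bit_nat_eq_self_iff[symmetric] by (simp_all add: tb)
    moreover have "a div b < 2 ^ w" "a mod b < 2 ^ w" "drop_bit b a < 2 ^ w"
      using that(1) by (auto simp: drop_bit_eq_div intro: le_less_trans[OF div_le_dividend]
          le_less_trans[OF mod_less_eq_dividend])
    ultimately show ?thesis by (cases f) simp_all
  qed
  have "2 ^ w - Suc x < 2 ^ w" for x :: nat by (simp add: diff_less)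
  then show ?thesis using assms closed
    by (cases i) (auto simp: word_state_def set_reg_def set_mem_def)
qed


section \<open>Range counting\<close>

text \<open>Arrays are indexed from 1, and only the values \<open>A 1, \<dots>, A m'\<close> matter.\<close>

definition range_count :: "(nat \<Rightarrow> nat) \<Rightarrow> nat \<Rightarrow> nat \<Rightarrow> nat" where
  "range_count A j v = card {i \<in> {1..j}. v \<le> A i}"

text \<open>
  The input of the preprocessing: \<open>m\<close>, \<open>m'\<close> and \<open>w\<close> in registers 0, 1, 2, and \<open>A i\<close> in memory cell
  \<open>i\<close>.  All other registers and cells hold arbitrary words.  In particular every entry of \<open>A\<close> is a
  word: by \<open>word_state\<close> there is no such state otherwise.
\<close>

definition holds_input :: "nat \<Rightarrow> nat \<Rightarrow> nat \<Rightarrow> (nat \<Rightarrow> nat) \<Rightarrow> ram_state \<Rightarrow> bool" where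
  "holds_input w m m' A s \<longleftrightarrow> word_state w s \<and>
     regs s 0 = m \<and> regs s 1 = m' \<and> regs s 2 = w \<and> (\<forall>i\<in>{1..m'}. mem s i = A i)"

text \<open>
  A query \<open>(j, v)\<close> is passed in registers 0 and 1 and its answer is returned in register 0.
  Each query runs in the state left behind by the previous one, so \<open>Q\<close> may use the memory as
  workspace but must keep the data structure usable for all later queries.
\<close>

primrec answers_queries ::
  "nat \<Rightarrow> (nat \<Rightarrow> nat) \<Rightarrow> prog \<Rightarrow> nat \<Rightarrow> ram_state \<Rightarrow> (nat \<times> nat) list \<Rightarrow> bool" where
  "answers_queries w A Q T s [] \<longleftrightarrow> True"
| "answers_queries w A Q T s (jv # qs) \<longleftrightarrow>
     (\<exists>t s'. exec w Q (set_reg 1 (snd jv) (set_reg 0 (fst jv) s)) t s' \<and> t \<le> T \<and>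
        regs s' 0 = range_count A (fst jv) (snd jv) \<and> answers_queries w A Q T s' qs)"

end

theory Submission
  imports Defs
begin

text \<open>
  Let \<open>b = \<lfloor>log m\<rfloor>\<close> and let \<open>Y = O(m)\<close> be such that the entries sum to at most \<open>Y b\<close>.  For values \<open>a\<close> drawn
  from \<open>C\<close> columns, cut a sequence of length \<open>n\<close> into blocks of \<open>b\<close> entries and store, for every block
  and every column, the count before the block and the \<open>b\<close>-bit mask of the entries of the block that
  reach the column.  A query is then one addition and one lookup in a table of population counts,
  and the table has \<open>(n / b + 1) C\<close> cells.

  This is used for \<open>A\<close> itself with about \<open>2 b\<close> columns, namely all thresholds below \<open>b\<close> and the
  thresholds \<open>b 2\<^sup>i\<close>, and for each \<open>i\<close> with \<open>b 2\<^sup>i < Y\<close> for the subsequence of the entries \<open>\<ge> b 2\<^sup>i\<close>, with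
  one column per threshold in \<open>[b 2\<^sup>i, b 2\<^sup>i\<^sup>+\<^sup>1)\<close>.  A query \<open>(j, v)\<close> first uses the table of \<open>A\<close> to translate
  \<open>j\<close> into a position in the subsequence of the scale of \<open>v\<close>.  As \<open>\<Sum>\<^sub>i b 2\<^sup>i [a \<ge> b 2\<^sup>i] \<le> 2 a\<close>, the tables have \<open>O(Y)\<close>
  cells in total.  At most \<open>b\<close> entries remain beyond the last scale; they form a single block, whose
  mask for \<open>v\<close> is assembled from masks for the quotient and the remainder of \<open>v\<close> by \<open>b\<close>.

  If \<open>m\<close> is below a constant, memory may be too small for all this and a query scans the array.
\<close>

section \<open>Reasoning about programs\<close>

text \<open>One column per value is out of reach for all of \<open>A\<close>: a table costs about
  \<open>n C / b\<close> cells, and values can be as large as \<open>Y b\<close>. Passing to the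
  entries \<open>>= t\<close> at scale \<open>t\<close> helps since an entry pays
  \<open>t / b\<close> cells at each scale that it reaches. The block length \<open>b\<close> is
  small enough for a mask to fit into a word and for a table indexed by all masks to be linear
  (\<open>2 ^ b <= m\<close>), yet large enough to cancel the factor \<open>log m\<close> in the
  bound on the sum. Once \<open>t >= Y\<close>, that bound leaves room for only \<open>b\<close>
  entries; thresholds still range up to about \<open>Y b\<close>, but as two digits in base
  \<open>b\<close> they need only \<open>Y + 2\<close> and \<open>b\<close> columns. Memory:
  \<open>w >= 2 log m\<close> provides at least \<open>m ^ 2\<close> cells, while all tables end
  below \<open>128 * Y\<close> with \<open>Y = D * m\<close>. So \<open>m >= 2 ^ (7 + D)\<close> is
  large enough, because \<open>128 = 2 ^ 7\<close> and \<open>D < 2 ^ D\<close>. The same condition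
  yields \<open>bitlen Y <= 2 * b\<close>, which keeps the table of \<open>A\<close> at
  \<open>O(b)\<close> columns.\<close>

abbreviation seq_prog (infixr ";;" 60) where "p ;; q \<equiv> Seq p q"

primrec block :: "instr list \<Rightarrow> prog" where
  "block [] = Skip"
| "block (i # is) = Instr i ;; block is"

lemma exec_block: "exec w (block is) s (Suc (length is)) (fold (instr_val w) is s)"
proof (induction "is" arbitrary: s)
  case Nil
  show ?case using exec.Skip by simp
next
  case (Cons i "is")
  have "exec w (Instr i ;; block is) s (1 + Suc (length is)) (fold (instr_val w) is (instr_val w i s))"
    by (rule exec.Seq[OF exec.Instr Cons.IH])
  then show ?case by simp
qed

declare block.simps [simp del]

text \<open>A total-correctness triple with a time budget. As \<open>exec\<close> is deterministic,
  one run within the budget bounds the only run.\<close>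

definition runs :: "nat \<Rightarrow> prog \<Rightarrow> ram_state \<Rightarrow> nat \<Rightarrow> (ram_state \<Rightarrow> bool) \<Rightarrow> bool" where
  "runs w p s T R \<longleftrightarrow> (\<exists>t s'. exec w p s t s' \<and> t \<le> T \<and> R s')"

lemma runs_block:
  assumes "R (fold (instr_val w) is s)" "length is < T"
  shows "runs w (block is) s T R"
  unfolding runs_def
  by (intro exI[of _ "Suc (length is)"] exI[of _ "fold (instr_val w) is s"])
    (use assms exec_block[of w "is" s] in auto)

lemma runs_mono:
  assumes "runs w p s T R" "T \<le> T'" "\<And>s'. R s' \<Longrightarrow> R' s'"
  shows "runs w p s T' R'"
  using assms unfolding runs_def by (meson le_trans)

lemma runs_Seq:
  assumes "runs w p s T R" "\<And>s'. R s' \<Longrightarrow> runs w q s' T' R'" "T + T' \<le> U"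
  shows "runs w (p ;; q) s U R'"
proof -
  from assms(1) obtain t s' where 1: "exec w p s t s'" "t \<le> T" "R s'" unfolding runs_def by auto
  from assms(2)[OF 1(3)] obtain t' s'' where 2: "exec w q s' t' s''" "t' \<le> T'" "R' s''"
    unfolding runs_def by auto
  have "exec w (p ;; q) s (t + t') s''" using 1 2 by (auto intro: exec.Seq)
  then show ?thesis unfolding runs_def using 1 2 assms(3) by (intro exI[of _ "t + t'"] exI[of _ s'']) auto
qed

lemma runs_block_Seq:
  assumes "runs w p (fold (instr_val w) is s) T R" "length is + T < U"
  shows "runs w (block is ;; p) s U R"
proof (rule runs_Seq)
  show "runs w (block is) s (Suc (length is)) (\<lambda>s'. s' = fold (instr_val w) is s)"
    by (rule runs_block) auto
  show "runs w p s' T R" if "s' = fold (instr_val w) is s" for s'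
    using assms(1) that by simp
  show "Suc (length is) + T \<le> U" using assms(2) by simp
qed

lemma runs_Cond:
  assumes "test_val b s \<Longrightarrow> runs w p s T R" "\<not> test_val b s \<Longrightarrow> runs w q s T R" "T < U"
  shows "runs w (Cond b p q) s U R"
proof (cases "test_val b s")
  case True
  then obtain t s' where "exec w p s t s'" "t \<le> T" "R s'" using assms unfolding runs_def by auto
  then show ?thesis unfolding runs_def
    using exec.CondTrue[OF True] assms(3) by (intro exI[of _ "1 + t"] exI[of _ s']) auto
next
  case False
  then obtain t s' where "exec w q s t s'" "t \<le> T" "R s'" using assms unfolding runs_def by auto
  then show ?thesis unfolding runs_def
    using exec.CondFalse[OF False] assms(3) by (intro exI[of _ "1 + t"] exI[of _ s']) auto
qed

text \<open>The invariant is indexed by the iteration and the number \<open>n\<close> of iterations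
  is known in advance, so termination comes from backward induction on the index. Each iteration has
  its own budget because the scales differ in cost.\<close>

lemma runs_While:
  assumes init: "I 0 s"
    and step: "\<And>i s. i < n \<Longrightarrow> I i s \<Longrightarrow> test_val b s \<and> runs w p s (T i) (I (Suc i))"
    and exit: "\<And>s. I n s \<Longrightarrow> \<not> test_val b s"
    and time: "1 + (\<Sum>i<n. Suc (T i)) \<le> U"
  shows "runs w (While b p) s U (I n)"
proof -
  have "\<exists>t s'. exec w (While b p) s t s' \<and> t \<le> 1 + (\<Sum>j=i..<n. Suc (T j)) \<and> I n s'"
    if "i \<le> n" "I i s" for i s
    using that
  proof (induction arbitrary: s rule: inc_induct)
    case base
    then have "exec w (While b p) s 1 s" by (intro exec.WhileFalse) (rule exit)
    with base show ?case by auto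
  next
    case (step i)
    then obtain t s' where 1: "test_val b s" "exec w p s t s'" "t \<le> T i" "I (Suc i) s'"
      using assms(2)[of i s] unfolding runs_def by auto
    from step.IH[OF 1(4)] obtain t' s'' where
      2: "exec w (While b p) s' t' s''" "t' \<le> 1 + (\<Sum>j=Suc i..<n. Suc (T j))" "I n s''" by auto
    have "exec w (While b p) s (1 + t + t') s''" by (rule exec.WhileTrue[OF 1(1,2) 2(1)])
    moreover have "1 + t + t' \<le> 1 + (\<Sum>j=i..<n. Suc (T j))"
      using 1 2 step.hyps by (simp add: sum.atLeast_Suc_lessThan)
    ultimately show ?case using 2(3) by blast
  qed
  from this[of 0 s] init time show ?thesis unfolding runs_def
    by (auto simp: atLeast0LessThan intro: order_trans)
qed

lemma runs_While_uniform:
  assumes "I 0 s" "\<And>i s. i < n \<Longrightarrow> I i s \<Longrightarrow> test_val b s \<and> runs w p s T (I (Suc i))"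
    and "\<And>s. I n s \<Longrightarrow> \<not> test_val b s" "1 + n * Suc T \<le> U"
  shows "runs w (While b p) s U (I n)"
  by (rule runs_While[where T = "\<lambda>_. T"]) (use assms in auto)

lemma state_sel [simp]:
  "regs (set_reg r x s) = (regs s)(r := x)"
  "mem (set_reg r x s) = mem s"
  "regs (set_mem a x s) = regs s"
  "mem (set_mem a x s) = (mem s)(a := x)"
  by (simp_all add: set_reg_def set_mem_def)

section \<open>Population counts and bit lengths\<close>

definition popcount :: "nat \<Rightarrow> nat" where
  "popcount x = card {l. bit x l}"

lemma popcount_0 [simp]: "popcount 0 = 0"
  by (simp add: popcount_def)

lemma finite_bits_nat: "finite {l. bit (x::nat) l}"
proof (rule finite_subset)
  show "{l. bit x l} \<subseteq> {..<x}"
  proof clarsimp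
    fix l assume "bit x l"
    then have "x div 2 ^ l \<noteq> 0" unfolding bit_iff_odd by (metis even_zero)
    then have "2 ^ l \<le> x" by (meson div_less linorder_not_le)
    then show "l < x" using less_exp[of l] by linarith
  qed
qed simp

text \<open>Halving shifts the set of bits down by one and drops the lowest. This is the recursion
  by which the table is filled in increasing order.\<close>

lemma popcount_rec: "popcount x = popcount (x div 2) + x mod 2"
proof -
  have "{l. bit x l} = (if odd x then {0} else {}) \<union> Suc ` {l. bit (x div 2) l}"
  proof (rule set_eqI)
    fix l show "l \<in> {l. bit x l} \<longleftrightarrow> l \<in> (if odd x then {0} else {}) \<union> Suc ` {l. bit (x div 2) l}"
      by (cases l) (auto simp: bit_Suc bit_0)
  qed
  moreover have "card ((if odd x then {0} else {}) \<union> Suc ` {l. bit (x div 2) l})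
      = card (if odd x then {0::nat} else {}) + card (Suc ` {l. bit (x div 2) l})"
    by (rule card_Un_disjoint) (auto simp: finite_bits_nat)
  ultimately show ?thesis unfolding popcount_def
    by (simp add: card_image odd_iff_mod_2_eq_one)
qed

text \<open>Masks are specified bit by bit; this makes a mask of a block a valid index into the
  table of population counts.\<close>

lemma bits_bounded_nat:
  assumes "\<And>l. bit (x::nat) l \<Longrightarrow> l < b"
  shows "x < 2 ^ b"
proof -
  have "take_bit b x = x" by (rule bit_eqI) (use assms in \<open>auto simp: bit_take_bit_iff\<close>)
  then show ?thesis by (simp add: take_bit_nat_eq_self_iff)
qed

text \<open>The number of binary digits: for \<open>x > 0\<close>, one more than
  \<open>log x\<close> rounded down.\<close>

fun bitlen :: "nat \<Rightarrow> nat" where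
  "bitlen x = (if x = 0 then 0 else Suc (bitlen (x div 2)))"

declare bitlen.simps [simp del]

lemma bitlen_0 [simp]: "bitlen 0 = 0"
  by (simp add: bitlen.simps)

lemma bitlen_le_iff: "bitlen x \<le> k \<longleftrightarrow> x < 2 ^ k"
proof (induction k arbitrary: x)
  case 0
  show ?case by (subst bitlen.simps) simp
next
  case (Suc k)
  have "bitlen x \<le> Suc k \<longleftrightarrow> bitlen (x div 2) \<le> k"
    by (subst bitlen.simps) simp
  also have "\<dots> \<longleftrightarrow> x < 2 ^ Suc k"
    unfolding Suc by (simp add: less_mult_imp_div_less div_less_iff_less_mult mult.commute)
  finally show ?case .
qed

section \<open>Rank tables\<close>

text \<open>
  Cell \<open>e\<close> belongs to block \<open>e div C\<close> and column \<open>e mod C\<close> and occupies two words, mask and count.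
  Columns are numbered downwards, so that reaching a threshold becomes \<open>\<le>\<close> and both passes that
  fill the table run through the cells in increasing order.
\<close>

definition rank_table :: "(nat \<Rightarrow> nat) \<Rightarrow> nat \<Rightarrow> nat \<Rightarrow> nat \<Rightarrow> nat list \<Rightarrow> bool" where
  "rank_table \<mu> base b C ys \<longleftrightarrow> (\<forall>e < (length ys div b + 1) * C.
     (\<forall>l. bit (\<mu> (base + 2 * e)) l \<longleftrightarrow>
        l < b \<and> e div C * b + l < length ys \<and> ys ! (e div C * b + l) \<le> e mod C) \<and>
     \<mu> (base + 2 * e + 1) = length (filter (\<lambda>y. y \<le> e mod C) (take (e div C * b) ys)))"

section \<open>Filling a rank table\<close>

text \<open>
  Registers below 20 are global: 0 and 1 hold the input or the query, 3 the constant 1, 4 is 1 iff the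
  tables exist, 5 is \<open>b\<close>, 6 is \<open>Y\<close>, 7, 8 and 9 are the base addresses of the tables of population
  counts, bit lengths and level tables, 10 and 11 the base address and number of columns of the table
  of the whole array, 12 the current threshold and 13 the current level, 14 and 15 the base addresses
  of the tables for quotients and remainders by \<open>b\<close>, 16 the length of the current sequence (stored from cell 1 on), 17 the first
  free cell, 18 the number of columns of the table to be built.  Registers from 20 on are scratch, and
  the column of a value is computed in register 24 with scratch registers from 30 on.
\<close>

definition clear_loop :: prog where
  "clear_loop = While (Less 22 21) (block [Store 22 23, Binop Add 22 22 3])"

text \<open>Needed because free memory initially holds arbitrary words, while the next pass only ORs
  bits into the masks and the counts of the first block must be 0.\<close>

lemma clear_loop:
  assumes "regs s 3 = 1" "regs s 23 = 0" "regs s 22 = f" "regs s 21 = g" "f \<le> g" "g < 2 ^ w"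
  shows "runs w clear_loop s (1 + (g - f) * 4)
     (\<lambda>s'. (\<forall>r. r \<noteq> 22 \<longrightarrow> regs s' r = regs s r) \<and>
       (\<forall>a. mem s' a = (if f \<le> a \<and> a < g then 0 else mem s a)))"
proof -
  let ?I = "\<lambda>i (s' :: ram_state). regs s' 22 = f + i \<and> (\<forall>r. r \<noteq> 22 \<longrightarrow> regs s' r = regs s r) \<and>
       (\<forall>a. mem s' a = (if f \<le> a \<and> a < f + i then 0 else mem s a))"
  have "runs w clear_loop s (1 + (g - f) * 4) (?I (g - f))"
    unfolding clear_loop_def
  proof (rule runs_While_uniform[where T = 3 and I = ?I and n = "g - f"])
    show "?I 0 s" using assms by simp
    show "test_val (Less 22 21) s' \<and>
        runs w (block [Store 22 23, Binop Add 22 22 3]) s' 3 (?I (Suc i))"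
      if "i < g - f" "?I i s'" for i s'
      by (intro conjI runs_block) (use that assms in auto)
    show "\<not> test_val (Less 22 21) s'" if "?I (g - f) s'" for s'
      using that assms by simp
  qed simp
  then show ?thesis
    by (rule runs_mono) (use assms in auto)
qed

definition scatter_loop :: "prog \<Rightarrow> prog" where
  "scatter_loop col = While (Less 22 16)
     (block [Binop Add 24 22 3, Load 24 24] ;; col ;;
      block [Binop Div 25 22 5, Binop Mul 25 25 18, Binop Add 25 25 24, Binop Add 25 25 25,
        Binop Add 25 25 17, Binop Mod 26 22 5, Binop Shl 26 3 26, Load 27 25, Binop Or 27 27 26,
        Store 25 27, Binop Add 22 22 3])"

lemma block_index:
  assumes "l < (b::nat)"
  shows "B * b + l = i \<longleftrightarrow> B = i div b \<and> l = i mod b"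
  using assms by auto

lemma cell_bound:
  assumes "i < n" "y < (C::nat)"
  shows "i div b * C + y < (n div b + 1) * C"
proof -
  have "i div b * C + y < (i div b + 1) * C" using assms by simp
  also have "\<dots> \<le> (n div b + 1) * C" using assms by (intro mult_right_mono) (auto simp: div_le_mono)
  finally show ?thesis .
qed

text \<open>Each entry sets one bit, in the cell of its own block and its own column. The program
  \<open>col\<close> is a parameter so that all column numberings share this proof; its contract
  covers every state that agrees with \<open>s\<close> on the global registers and below
  \<open>fr\<close>, since the loop changes scratch registers and cells from \<open>fr\<close>
  on.\<close>

lemma scatter_loop:
  assumes regs: "regs s 3 = 1" "regs s 5 = b" "regs s 16 = length xs" "regs s 17 = fr" "regs s 18 = C"
      "regs s 22 = 0"
    and b: "0 < b" "b < w"
    and room: "fr + 2 * ((length xs div b + 2) * C) < 2 ^ w" "length xs < fr"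
    and input: "\<And>i. i < length xs \<Longrightarrow> mem s (Suc i) = xs ! i"
    and clear: "\<And>a. fr \<le> a \<Longrightarrow> a < fr + 2 * ((length xs div b + 2) * C) \<Longrightarrow> mem s a = 0"
    and col: "\<And>s' i. i < length xs \<Longrightarrow> (\<forall>r<20. regs s' r = regs s r) \<Longrightarrow>
      (\<forall>a<fr. mem s' a = mem s a) \<Longrightarrow> regs s' 24 = xs ! i \<Longrightarrow>
      runs w col s' Tc (\<lambda>s''. regs s'' 24 = f (xs ! i) \<and> mem s'' = mem s' \<and>
         (\<forall>r<30. r \<noteq> 24 \<longrightarrow> regs s'' r = regs s' r))"
    and f: "\<And>i. i < length xs \<Longrightarrow> f (xs ! i) < C"
  shows "runs w (scatter_loop col) s (1 + length xs * (Tc + 16))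
     (\<lambda>s'. (\<forall>r<24. r \<noteq> 22 \<longrightarrow> regs s' r = regs s r) \<and>
       (\<forall>a. a < fr \<or> fr + 2 * ((length xs div b + 2) * C) \<le> a \<longrightarrow> mem s' a = mem s a) \<and>
       (\<forall>e<(length xs div b + 2) * C. mem s' (fr + 2 * e + 1) = 0) \<and>
       (\<forall>e<(length xs div b + 1) * C. \<forall>l. bit (mem s' (fr + 2 * e)) l \<longleftrightarrow>
          l < b \<and> e div C * b + l < length xs \<and> f (xs ! (e div C * b + l)) = e mod C))"
proof -
  define n where "n = length xs"
  define E where "E = (n div b + 1) * C"
  define G where "G = (n div b + 2) * C"
  have EG: "G = E + C" by (simp add: E_def G_def)
  let ?I = "\<lambda>i (s' :: ram_state). regs s' 22 = i \<and> (\<forall>r<24. r \<noteq> 22 \<longrightarrow> regs s' r = regs s r) \<and>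
       (\<forall>a. a < fr \<or> fr + 2 * G \<le> a \<longrightarrow> mem s' a = mem s a) \<and>
       (\<forall>e<G. mem s' (fr + 2 * e + 1) = 0) \<and>
       (\<forall>e<E. \<forall>l. bit (mem s' (fr + 2 * e)) l \<longleftrightarrow>
          l < b \<and> e div C * b + l < i \<and> f (xs ! (e div C * b + l)) = e mod C)"
  have room': "fr + 2 * G < 2 ^ w" "n < fr" using room by (auto simp: G_def n_def)
  let ?B = "[Binop Div 25 22 5, Binop Mul 25 25 18, Binop Add 25 25 24, Binop Add 25 25 25,
        Binop Add 25 25 17, Binop Mod 26 22 5, Binop Shl 26 3 26, Load 27 25, Binop Or 27 27 26,
        Store 25 27, Binop Add 22 22 3]"
  have "runs w (scatter_loop col) s (1 + length xs * (Tc + 16)) (?I n)"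
    unfolding scatter_loop_def
  proof (rule runs_While_uniform[where T = "Tc + 15" and I = ?I and n = n])
    show "?I 0 s" using regs clear by (auto simp: G_def E_def n_def)
    show "\<not> test_val (Less 22 16) s'" if "?I n s'" for s'
      using that regs by (simp add: n_def)
    fix i s' assume i: "i < n" and I: "?I i s'"
    define e0 where "e0 = i div b * C + f (xs ! i)"
    have fi: "f (xs ! i) < C" using f i by (simp add: n_def)
    have e0: "e0 < E" unfolding e0_def E_def by (rule cell_bound[OF i fi])
    have e0_div: "e0 div C = i div b" "e0 mod C = f (xs ! i)" using fi by (auto simp: e0_def)
    have mod_lt: "i mod b < b" using b by simp
    have pow: "(2::nat) ^ (i mod b) < 2 ^ w"
      using less_trans[OF mod_lt b(2)] by simp
    have test: "test_val (Less 22 16) s'" using I i regs by (simp add: n_def)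
    have bd: "i div b * C + f (xs ! i) < 2 ^ w" "2 * e0 < 2 ^ w" "fr + 2 * e0 < 2 ^ w"
      using e0 EG room' e0_def by auto
    have bd1: "i div b * C < 2 ^ w" using bd(1) by linarith
    have bd2: "i div b * C + f (xs ! i) + (i div b * C + f (xs ! i)) < 2 ^ w"
       "i div b * C + f (xs ! i) + (i div b * C + f (xs ! i)) + fr = fr + 2 * e0"
      using bd(2) unfolding e0_def by auto
    have i_bd: "Suc i < 2 ^ w" using i room' by linarith
    define s1 where "s1 = fold (instr_val w) [Binop Add 24 22 3, Load 24 24] s'"
    have s1: "regs s1 24 = xs ! i" "mem s1 = mem s'" "\<And>r. r \<noteq> 24 \<Longrightarrow> regs s1 r = regs s' r"
      using I i room' regs input i_bd by (auto simp: n_def s1_def)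
    have "runs w col s1 Tc (\<lambda>s''. regs s'' 24 = f (xs ! i) \<and> mem s'' = mem s1 \<and>
         (\<forall>r<30. r \<noteq> 24 \<longrightarrow> regs s'' r = regs s1 r))"
      by (rule col) (use i I s1 in \<open>auto simp: n_def\<close>)
    then have run: "runs w col s1 Tc (\<lambda>s''. regs s'' 24 = f (xs ! i) \<and> mem s'' = mem s' \<and>
         (\<forall>r<30. r \<noteq> 24 \<longrightarrow> regs s'' r = regs s' r))"
      by (rule runs_mono) (use s1 in auto)
    have fin: "?I (Suc i) (fold (instr_val w) ?B s'')"
      if s'': "regs s'' 24 = f (xs ! i)" "mem s'' = mem s'" "\<forall>r<30. r \<noteq> 24 \<longrightarrow> regs s'' r = regs s' r" for s''
    proof -
      define s2 where "s2 = fold (instr_val w) ?B s''"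
      have R: "regs s'' 22 = i" "regs s'' 5 = b" "regs s'' 18 = C" "regs s'' 17 = fr" "regs s'' 3 = 1"
        using s'' I regs by auto
      have m2: "mem s2 = (mem s')(fr + 2 * e0 := or (mem s' (fr + 2 * e0)) (2 ^ (i mod b)))"
        using R s''(1,2) bd bd1 bd2(1) pow by (simp add: push_bit_eq_mult bd2(2) s2_def)
      have r22: "regs s2 22 = Suc i" using R i_bd by (simp add: s2_def)
      have rr: "regs s2 r = regs s' r" if "r < 24" "r \<noteq> 22" for r
        using that s''(3) by (simp add: s2_def)
      have bits: "bit (mem s2 (fr + 2 * e)) l \<longleftrightarrow>
          l < b \<and> e div C * b + l < Suc i \<and> f (xs ! (e div C * b + l)) = e mod C" if "e < E" for e l
      proof -
        \<comment> \<open>Only bit \<open>i mod b\<close> of cell \<open>e0\<close> changes, and by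
          \<open>block_index\<close> this combination of block and offset belongs to entry
          \<open>i\<close> alone.\<close>
        have "e = e0 \<longleftrightarrow> e div C = i div b \<and> e mod C = f (xs ! i)"
          using e0_div by (metis div_mult_mod_eq)
        moreover have "l < b \<Longrightarrow> e div C * b + l = i \<longleftrightarrow> e div C = i div b \<and> l = i mod b"
          by (rule block_index)
        moreover have "bit (mem s' (fr + 2 * e)) l \<longleftrightarrow>
          l < b \<and> e div C * b + l < i \<and> f (xs ! (e div C * b + l)) = e mod C"
          using I that by blast
        ultimately show ?thesis unfolding m2 using mod_lt
          by (auto simp: bit_or_iff bit_exp_iff less_Suc_eq)
      qed
      have odd: "mem s2 (fr + 2 * e + 1) = 0" if "e < G" for e
      proof -
        \<comment> \<open>Masks and counts have offsets of different parity from
          \<open>fr\<close>.\<close>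
        have "fr + 2 * e + 1 \<noteq> fr + 2 * e0" by presburger
        then show ?thesis unfolding m2 using I that by simp
      qed
      have out: "mem s2 a = mem s a" if "a < fr \<or> fr + 2 * G \<le> a" for a
      proof -
        have "a \<noteq> fr + 2 * e0" using that e0 EG by auto
        moreover have "mem s' a = mem s a" using I that by blast
        ultimately show ?thesis unfolding m2 by simp
      qed
      show ?thesis unfolding s2_def[symmetric] using r22 rr bits odd out I by auto
    qed
    show "test_val (Less 22 16) s' \<and> runs w (block [Binop Add 24 22 3, Load 24 24] ;; col ;;
      block ?B) s' (Tc + 15) (?I (Suc i))"
    proof (intro conjI test runs_block_Seq[where T = "Tc + 12"] runs_Seq[OF run[unfolded s1_def], where T' = 12])
      fix s'' :: ram_state
      assume *: "regs s'' 24 = f (xs ! i) \<and> mem s'' = mem s' \<and>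
         (\<forall>r<30. r \<noteq> 24 \<longrightarrow> regs s'' r = regs s' r)"
      have "?I (Suc i) (fold (instr_val w) ?B s'')" by (rule fin) (use * in auto)
      then show "runs w (block ?B) s'' 12 (?I (Suc i))"
        by (rule runs_block[where R = "?I (Suc i)"]) simp
    qed simp_all
  qed (simp add: n_def)
  then show ?thesis
    by (rule runs_mono) (simp_all add: G_def E_def n_def)
qed

definition sum_loop :: prog where
  "sum_loop = While (Less 22 20)
     (block [Binop Add 25 22 22, Binop Add 25 25 17, Load 27 25, Binop Mod 26 22 18] ;;
      Cond (Equal 26 23) (block [])
        (block [Binop Sub 24 25 3, Binop Sub 24 24 3, Load 28 24, Binop Or 27 27 28, Store 25 27]) ;;
      block [Binop Add 25 25 3, Load 28 25, Binop Add 26 7 27, Load 26 26, Binop Add 28 28 26,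
        Binop Add 25 25 18, Binop Add 25 25 18, Store 25 28, Binop Add 22 22 3])"

text \<open>The hits inside one further block are the set bits of its mask, so counts advance from
  block to block by a population count.\<close>

lemma take_block:
  "length (filter P (take ((B + 1) * b) ys)) =
   length (filter P (take (B * b) ys)) + card {l. l < b \<and> B * b + l < length ys \<and> P (ys ! (B * b + l))}"
proof -
  have "take ((B + 1) * b) ys = take (B * b) ys @ take b (drop (B * b) ys)"
    by (simp only: take_add[symmetric] add_mult_distrib mult_1)
  moreover have "length (filter P (take b (drop (B * b) ys))) =
      card {l. l < b \<and> B * b + l < length ys \<and> P (ys ! (B * b + l))}"
    unfolding length_filter_conv_card by (rule arg_cong[where f = card]) (auto simp: less_diff_conv add.commute)
  ultimately show ?thesis by simp
qed

text \<open>ORing the finished mask of the preceding column into each cell turns "in this column"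
  into "in this column or an earlier one". The count plus the population count of that mask is then
  written \<open>C\<close> cells ahead, to the same column of the next block. The last block writes
  into a row beyond the table, whence \<open>length ys div b + 2\<close> in the space
  requirement.\<close>

lemma sum_loop:
  assumes regs: "regs s 3 = 1" "regs s 17 = fr" "regs s 18 = C" "regs s 20 = (length ys div b + 1) * C"
      "regs s 22 = 0" "regs s 23 = 0"
    and b: "0 < b" and C: "0 < C"
    and room: "fr + 2 * ((length ys div b + 2) * C) < 2 ^ w" "length ys < fr"
    and pc: "\<And>x. x < 2 ^ b \<Longrightarrow> mem s (regs s 7 + x) = popcount x" "regs s 7 + 2 ^ b \<le> fr"
    and zero: "\<And>e. e < C \<Longrightarrow> mem s (fr + 2 * e + 1) = 0"
    and bits: "\<And>e l. e < (length ys div b + 1) * C \<Longrightarrow> bit (mem s (fr + 2 * e)) l \<longleftrightarrow>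
          l < b \<and> e div C * b + l < length ys \<and> ys ! (e div C * b + l) = e mod C"
  shows "runs w sum_loop s (1 + (length ys div b + 1) * C * 24)
     (\<lambda>s'. (\<forall>r<22. regs s' r = regs s r) \<and>
       (\<forall>a. a < fr \<or> fr + 2 * ((length ys div b + 2) * C) \<le> a \<longrightarrow> mem s' a = mem s a) \<and>
       rank_table (mem s') fr b C ys)"
proof -
  define n where "n = length ys"
  define E where "E = (n div b + 1) * C"
  define G where "G = (n div b + 2) * C"
  have EG: "G = E + C" by (simp add: E_def G_def)
  define K where "K = (\<lambda>e. length (filter (\<lambda>y. y \<le> e mod C) (take (e div C * b) ys)))"
  define M where "M = (\<lambda>e l. l < b \<and> e div C * b + l < n \<and> ys ! (e div C * b + l) \<le> e mod C)"
  \<comment> \<open>Counts run one row ahead: they are final below \<open>i + C\<close>, masks are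
    final below \<open>i\<close> and still as scattered from \<open>i\<close> on. For
    \<open>i = 0\<close> the first row of counts is correct because nothing precedes block
    0.\<close>
  let ?I = "\<lambda>i (s' :: ram_state). regs s' 22 = i \<and> (\<forall>r<24. r \<noteq> 22 \<longrightarrow> regs s' r = regs s r) \<and>
       (\<forall>a. a < fr \<or> fr + 2 * G \<le> a \<longrightarrow> mem s' a = mem s a) \<and>
       (\<forall>e<i + C. mem s' (fr + 2 * e + 1) = K e) \<and>
       (\<forall>e<i. \<forall>l. bit (mem s' (fr + 2 * e)) l \<longleftrightarrow> M e l) \<and>
       (\<forall>e. i \<le> e \<longrightarrow> mem s' (fr + 2 * e) = mem s (fr + 2 * e))"
  have room': "fr + 2 * G < 2 ^ w" "n < fr" using room by (auto simp: G_def n_def)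
  let ?B' = "[Binop Sub 24 25 3, Binop Sub 24 24 3, Load 28 24, Binop Or 27 27 28, Store 25 27]"
  let ?B = "[Binop Add 25 25 3, Load 28 25, Binop Add 26 7 27, Load 26 26, Binop Add 28 28 26,
        Binop Add 25 25 18, Binop Add 25 25 18, Store 25 28, Binop Add 22 22 3]"
  have "runs w sum_loop s (1 + (length ys div b + 1) * C * 24) (?I E)"
    unfolding sum_loop_def
  proof (rule runs_While_uniform[where T = 23 and I = ?I and n = E])
    show "?I 0 s" using regs zero by (auto simp: K_def)
    show "\<not> test_val (Less 22 20) s'" if "?I E s'" for s'
      using that regs by (simp add: E_def n_def)
    show "1 + E * Suc 23 \<le> 1 + (length ys div b + 1) * C * 24" by (simp add: E_def n_def)
    fix i s' assume i: "i < E" and I: "?I i s'"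
    have test: "test_val (Less 22 20) s'" using I i regs by (simp add: E_def n_def)
    have bd: "i + i < 2 ^ w" "i + i + fr < 2 ^ w" "fr + 2 * i + 1 < 2 ^ w" "fr + 2 * (i + C) + 1 < 2 ^ w"
       "Suc i < 2 ^ w"
      using i EG C room' by auto
    have adr: "i + i + fr = fr + 2 * i" by simp
    have R: "regs s' 22 = i" "regs s' 17 = fr" "regs s' 18 = C" "regs s' 3 = 1" "regs s' 23 = 0"
      "regs s' 7 = regs s 7"
      using I regs by auto
    define s1 where "s1 = fold (instr_val w) [Binop Add 25 22 22, Binop Add 25 25 17, Load 27 25, Binop Mod 26 22 18] s'"
    have s1: "regs s1 25 = fr + 2 * i" "regs s1 27 = mem s (fr + 2 * i)" "regs s1 26 = i mod C"
      "mem s1 = mem s'" "\<And>r. r < 24 \<Longrightarrow> regs s1 r = regs s' r"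
      using R bd I by (simp_all add: adr s1_def)
    define m2 where "m2 = (\<lambda>x. (mem s')(fr + 2 * i := x))"
    let ?R = "\<lambda>s'' :: ram_state. regs s'' 25 = fr + 2 * i \<and> (\<forall>l. bit (regs s'' 27) l \<longleftrightarrow> M i l) \<and>
        mem s'' = m2 (regs s'' 27) \<and> (\<forall>r<24. regs s'' r = regs s' r)"
    have old: "bit (mem s (fr + 2 * i)) l \<longleftrightarrow>
        l < b \<and> i div C * b + l < n \<and> ys ! (i div C * b + l) = i mod C" for l
      using bits i by (simp add: E_def n_def)
    have cond: "runs w (Cond (Equal 26 23) (block [])
        (block ?B')) s1 8 ?R"
    proof (rule runs_Cond[where T = 6])
      assume "test_val (Equal 26 23) s1"
      then have z: "i mod C = 0" using s1 R by simp
      have "m2 (mem s (fr + 2 * i)) = mem s'" unfolding m2_def using I by auto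
      then show "runs w (block []) s1 6 ?R"
        by (intro runs_block) (use z s1 old in \<open>auto simp: M_def\<close>)
    next
      assume "\<not> test_val (Equal 26 23) s1"
      then have z: "i mod C \<noteq> 0" using s1 R by simp
      then have i0: "0 < i" by (cases i) auto
      \<comment> \<open>With a nonzero column index the preceding cell lies in the same
        block.\<close>
      have dm: "(i - 1) div C = i div C" "(i - 1) mod C = i mod C - 1"
        using z i0 by (metis Suc_pred' div_Suc mod_Suc nat.simps(3) diff_Suc_1)+
      have prev: "bit (mem s' (fr + 2 * (i - 1))) l \<longleftrightarrow>
        l < b \<and> i div C * b + l < n \<and> ys ! (i div C * b + l) \<le> i mod C - 1" for l
      proof -
        have "i - 1 < i" using i0 by simp
        then have "bit (mem s' (fr + 2 * (i - 1))) l \<longleftrightarrow> M (i - 1) l" using I by blast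
        then show ?thesis unfolding M_def dm .
      qed
      have a1: "(fr + 2 * i + 2 ^ w - 1) mod 2 ^ w = fr + 2 * i - 1"
        using i0 bd(2) by (subst mod_if) (auto simp: le_mod_geq)
      have a2: "(fr + 2 * i - 1 + 2 ^ w - 1) mod 2 ^ w = fr + 2 * (i - 1)"
        using i0 bd(2) by (subst mod_if) (auto simp: le_mod_geq)
      define s2 where "s2 = fold (instr_val w) ?B' s1"
      have s2: "regs s2 27 = or (mem s (fr + 2 * i)) (mem s' (fr + 2 * (i - 1)))"
        "mem s2 = (mem s1)(regs s1 25 := regs s2 27)" "regs s2 25 = regs s1 25"
        "\<And>r. r < 24 \<Longrightarrow> regs s2 r = regs s1 r"
        using a1 a2 s1(1,2,4) s1(5)[of 3] R(4) by (simp_all add: s2_def del: One_nat_def)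
      have "bit (regs s2 27) l \<longleftrightarrow> M i l" for l
        unfolding s2(1) bit_or_iff old prev M_def using z by auto
      then show "runs w (block ?B')
          s1 6 ?R"
        unfolding s2_def using s1 s2 by (intro runs_block) (auto simp: m2_def s2_def[symmetric])
    qed simp
    have fin: "?I (Suc i) (fold (instr_val w) ?B s'')"
      if s'': "?R s''" for s''
    proof -
      let ?x = "regs s'' 27"
      define s3 where "s3 = fold (instr_val w) ?B s''"
      have R2: "regs s'' 22 = i" "regs s'' 17 = fr" "regs s'' 18 = C" "regs s'' 3 = 1" "regs s'' 7 = regs s 7"
        "regs s'' 25 = fr + 2 * i"
        using s'' R by auto
      have x: "?x < 2 ^ b" by (rule bits_bounded_nat) (use s'' in \<open>auto simp: M_def\<close>)
      have pcx: "mem s'' (regs s 7 + ?x) = popcount ?x" and pcb: "regs s 7 + ?x < 2 ^ w"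
      proof -
        have lt: "regs s 7 + ?x < fr" using x pc(2) by simp
        then show "regs s 7 + ?x < 2 ^ w" using room' by simp
        show "mem s'' (regs s 7 + ?x) = popcount ?x"
          using s'' lt I pc(1)[OF x] by (simp add: m2_def)
      qed
      have kk: "mem s'' (fr + 2 * i + 1) = K i"
      proof -
        have "fr + 2 * i + 1 \<noteq> fr + 2 * i" by simp
        then show ?thesis using s'' I C by (simp add: m2_def)
      qed
      have K_step: "K i + popcount ?x = K (i + C)"
      proof -
        have "popcount ?x = card {l. M i l}" using s'' by (simp add: popcount_def)
        then show ?thesis unfolding K_def M_def n_def
          using C take_block[of "\<lambda>y. y \<le> i mod C" "i div C" b ys] by simp
      qed
      have K_le: "K (i + C) < 2 ^ w"
      proof -
        have "K (i + C) \<le> n" unfolding K_def n_def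
          by (rule order_trans[OF length_filter_le]) simp
        then show ?thesis using room' by simp
      qed
      have ad: "Suc (fr + 2 * i) < 2 ^ w" "Suc (fr + 2 * i + C) < 2 ^ w" "Suc (fr + 2 * i + C + C) < 2 ^ w"
        using bd by auto
      have m3: "mem s3 = (m2 ?x)(fr + 2 * (i + C) + 1 := K (i + C))"
        using R2 ad pcx pcb kk K_step K_le conjunct1[OF conjunct2[OF conjunct2[OF s'']]]
        by (simp add: s3_def) (simp add: ac_simps distrib_left)
      have r3: "regs s3 22 = Suc i" "\<And>r. r < 24 \<Longrightarrow> r \<noteq> 22 \<Longrightarrow> regs s3 r = regs s' r"
        using R2(1,4) bd(5) conjunct2[OF conjunct2[OF conjunct2[OF s'']]] by (simp_all add: s3_def)
      have k3: "mem s3 (fr + 2 * e + 1) = K e" if "e < Suc i + C" for e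
      proof (cases "e = i + C")
        case False
        moreover have "fr + 2 * e + 1 \<noteq> fr + 2 * i" by presburger
        ultimately show ?thesis unfolding m3 m2_def using I that by simp
      qed (simp add: m3)
      have e3: "mem s3 (fr + 2 * e) = m2 ?x (fr + 2 * e)" for e
      proof -
        have "fr + 2 * e \<noteq> fr + 2 * (i + C) + 1" by presburger
        then show ?thesis unfolding m3 by simp
      qed
      have out: "mem s3 a = mem s a" if "a < fr \<or> fr + 2 * G \<le> a" for a
      proof -
        have "a \<noteq> fr + 2 * i" "a \<noteq> fr + 2 * (i + C) + 1" using that i EG by auto
        moreover have "mem s' a = mem s a" using I that by blast
        ultimately show ?thesis unfolding m3 m2_def by simp
      qed
      have lo: "bit (mem s3 (fr + 2 * e)) l \<longleftrightarrow> M e l" if "e < Suc i" for e l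
        unfolding e3 m2_def using that s'' I by (cases "e = i") auto
      have hi: "mem s3 (fr + 2 * e) = mem s (fr + 2 * e)" if "Suc i \<le> e" for e
        unfolding e3 m2_def using that I by auto
      show ?thesis unfolding s3_def[symmetric] using r3 k3 out lo hi I by auto
    qed
    show "test_val (Less 22 20) s' \<and> runs w (block [Binop Add 25 22 22, Binop Add 25 25 17, Load 27 25, Binop Mod 26 22 18] ;;
      Cond (Equal 26 23) (block [])
        (block ?B') ;;
      block ?B) s' 23 (?I (Suc i))"
    proof (intro conjI test runs_block_Seq[where T = 18] runs_Seq[OF cond[unfolded s1_def], where T' = 10])
      fix s'' assume "?R s''"
      show "runs w (block ?B) s'' 10 (?I (Suc i))"
        by (rule runs_block[where R = "?I (Suc i)", OF fin[OF \<open>?R s''\<close>]]) simp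
    qed simp_all
  qed
  then show ?thesis
    by (rule runs_mono) (auto simp: G_def E_def n_def M_def K_def rank_table_def)
qed

definition build :: "prog \<Rightarrow> prog" where
  "build col =
     block [Binop Div 20 16 5, Binop Add 20 20 3, Binop Mul 20 20 18, Binop Add 21 20 18,
       Binop Add 21 21 21, Binop Add 21 21 17, Copy 22 17, Const 23 0] ;;
     clear_loop ;; block [Const 22 0] ;; scatter_loop col ;; block [Const 22 0] ;; sum_loop ;;
     block [Copy 17 21]"

text \<open>Register 17 moves past the new table and everything below \<open>fr\<close> is kept, so
  successive calls stack their tables without damaging earlier ones.\<close>

lemma build:
  assumes regs: "regs s 3 = 1" "regs s 5 = b" "regs s 16 = length xs" "regs s 17 = fr" "regs s 18 = C"
    and b: "0 < b" "b < w" and C: "0 < C"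
    and room: "fr + 2 * ((length xs div b + 2) * C) < 2 ^ w" "length xs < fr"
    and input: "\<And>i. i < length xs \<Longrightarrow> mem s (Suc i) = xs ! i"
    and pc: "\<And>x. x < 2 ^ b \<Longrightarrow> mem s (regs s 7 + x) = popcount x" "regs s 7 + 2 ^ b \<le> fr"
    and col: "\<And>s' i. i < length xs \<Longrightarrow> (\<forall>r<20. regs s' r = regs s r) \<Longrightarrow>
      (\<forall>a<fr. mem s' a = mem s a) \<Longrightarrow> regs s' 24 = xs ! i \<Longrightarrow>
      runs w col s' Tc (\<lambda>s''. regs s'' 24 = f (xs ! i) \<and> mem s'' = mem s' \<and>
         (\<forall>r<30. r \<noteq> 24 \<longrightarrow> regs s'' r = regs s' r))"
    and f: "\<And>i. i < length xs \<Longrightarrow> f (xs ! i) < C"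
  shows "runs w (build col) s (30 + length xs * (Tc + 16) + 32 * ((length xs div b + 2) * C))
     (\<lambda>s'. regs s' 17 = fr + 2 * ((length xs div b + 2) * C) \<and>
       (\<forall>r<20. r \<noteq> 17 \<longrightarrow> regs s' r = regs s r) \<and>
       (\<forall>a. a < fr \<or> fr + 2 * ((length xs div b + 2) * C) \<le> a \<longrightarrow> mem s' a = mem s a) \<and>
       rank_table (mem s') fr b C (map f xs))"
proof -
  define n where "n = length xs"
  define E where "E = (n div b + 1) * C"
  define G where "G = (n div b + 2) * C"
  define T2 where "T2 = 1 + n * (Tc + 16)"
  define s1 where "s1 = fold (instr_val w) [Binop Div 20 16 5, Binop Add 20 20 3, Binop Mul 20 20 18,
       Binop Add 21 20 18, Binop Add 21 21 21, Binop Add 21 21 17, Copy 22 17, Const 23 0] s"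
  have EG: "G = E + C" by (simp add: E_def G_def)
  \<comment> \<open>As \<open>C > 0\<close>, the number of blocks is at most the number of cells;
    this rules out overflow in the first address computations.\<close>
  have nE: "Suc (n div b) \<le> E" using mult_le_mono2[of 1 C "n div b + 1"] C by (simp add: E_def)
  have E': "Suc (n div b) * C = E" by (simp add: E_def)
  have bd: "fr + 2 * G < 2 ^ w" "n < fr" using room by (auto simp: G_def n_def)
  have bd': "Suc (n div b) < 2 ^ w" "E < 2 ^ w" "E + C < 2 ^ w" "2 * (E + C) < 2 ^ w" "2 * (E + C) + fr < 2 ^ w"
    using bd nE EG by auto
  have s1: "regs s1 20 = E" "regs s1 21 = fr + 2 * G" "regs s1 22 = fr" "regs s1 23 = 0" "mem s1 = mem s"
    "\<And>r. r < 20 \<Longrightarrow> regs s1 r = regs s r"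
    using regs bd' by (simp_all add: s1_def E' n_def[symmetric] EG mult_2[symmetric] del: mult_Suc)
  define R2 where "R2 = (\<lambda>s2 :: ram_state. (\<forall>r. r \<noteq> 22 \<longrightarrow> regs s2 r = regs s1 r) \<and>
       (\<forall>a. mem s2 a = (if fr \<le> a \<and> a < fr + 2 * G then 0 else mem s a)))"
  define R3 where "R3 = (\<lambda>s3 :: ram_state. (\<forall>r<24. r \<noteq> 22 \<longrightarrow> regs s3 r = regs s1 r) \<and>
       (\<forall>a. a < fr \<or> fr + 2 * G \<le> a \<longrightarrow> mem s3 a = mem s a) \<and>
       (\<forall>e<G. mem s3 (fr + 2 * e + 1) = 0) \<and>
       (\<forall>e<E. \<forall>l. bit (mem s3 (fr + 2 * e)) l \<longleftrightarrow>
          l < b \<and> e div C * b + l < n \<and> f (xs ! (e div C * b + l)) = e mod C))"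
  define R4 where "R4 = (\<lambda>s4 :: ram_state. (\<forall>r<22. regs s4 r = regs s1 r) \<and>
       (\<forall>a. a < fr \<or> fr + 2 * G \<le> a \<longrightarrow> mem s4 a = mem s a) \<and>
       rank_table (mem s4) fr b C (map f xs))"
  have 2: "runs w clear_loop s1 (1 + 8 * G) R2"
    by (rule runs_mono[OF clear_loop[where f = fr and g = "fr + 2 * G"]])
      (use s1 regs bd in \<open>auto simp: R2_def\<close>)
  have 3: "runs w (scatter_loop col) (set_reg 22 0 s2) T2 R3" if "R2 s2" for s2
    unfolding T2_def n_def
  proof (rule runs_mono[OF scatter_loop[where b = b and xs = xs and fr = fr and C = C and Tc = Tc and f = f]])
    let ?s = "set_reg 22 0 s2"
    have old: "mem s2 a = mem s a" if "a < fr" for a using \<open>R2 s2\<close> that by (simp add: R2_def)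
    have r: "regs ?s r = regs s r" if "r < 20" for r using \<open>R2 s2\<close> that s1(6) by (simp add: R2_def)
    show "regs ?s 3 = 1" "regs ?s 5 = b" "regs ?s 16 = length xs" "regs ?s 17 = fr" "regs ?s 18 = C"
      using r[of 3] r[of 5] r[of 16] r[of 17] r[of 18] regs by simp_all
    show "mem ?s (Suc i) = xs ! i" if "i < length xs" for i
      using old input that room by simp
    show "mem ?s a = 0" if "fr \<le> a" "a < fr + 2 * ((length xs div b + 2) * C)" for a
      using \<open>R2 s2\<close> that by (simp add: R2_def G_def n_def)
    show "runs w col s' Tc (\<lambda>s''. regs s'' 24 = f (xs ! i) \<and> mem s'' = mem s' \<and>
         (\<forall>r<30. r \<noteq> 24 \<longrightarrow> regs s'' r = regs s' r))"
      if "i < length xs" "\<forall>r<20. regs s' r = regs ?s r" "\<forall>a<fr. mem s' a = mem ?s a" "regs s' 24 = xs ! i"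
      for s' i using that old r by (intro col) auto
    show "R3 s'" if "(\<forall>r<24. r \<noteq> 22 \<longrightarrow> regs s' r = regs ?s r) \<and>
       (\<forall>a. a < fr \<or> fr + 2 * ((length xs div b + 2) * C) \<le> a \<longrightarrow> mem s' a = mem ?s a) \<and>
       (\<forall>e<(length xs div b + 2) * C. mem s' (fr + 2 * e + 1) = 0) \<and>
       (\<forall>e<(length xs div b + 1) * C. \<forall>l. bit (mem s' (fr + 2 * e)) l \<longleftrightarrow>
          l < b \<and> e div C * b + l < length xs \<and> f (xs ! (e div C * b + l)) = e mod C)" for s'
      using that \<open>R2 s2\<close> unfolding R3_def R2_def n_def G_def E_def by auto
  qed (use b room f in simp_all)
  have 4: "runs w sum_loop (set_reg 22 0 s3) (1 + 24 * E) R4" if "R3 s3" for s3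
  proof (rule runs_mono[OF sum_loop[where b = b and ys = "map f xs" and fr = fr and C = C]])
    let ?s = "set_reg 22 0 s3"
    have r: "regs ?s r = regs s r" if "r < 20" for r using \<open>R3 s3\<close> that s1(6) by (simp add: R3_def)
    show "regs ?s 3 = 1" "regs ?s 17 = fr" "regs ?s 18 = C"
      using r[of 3] r[of 17] r[of 18] regs by simp_all
    show "regs ?s 20 = (length (map f xs) div b + 1) * C" "regs ?s 23 = 0"
      using \<open>R3 s3\<close> s1 by (simp_all add: R3_def E_def n_def)
    have old: "mem s3 a = mem s a" if "a < fr" for a using \<open>R3 s3\<close> that by (simp add: R3_def)
    show "mem ?s (regs ?s 7 + x) = popcount x" if "x < 2 ^ b" for x
      using pc(1)[OF that] pc(2) that r[of 7] by (subst r) (simp_all add: old)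
    show "regs ?s 7 + 2 ^ b \<le> fr" using pc(2) by (subst r) simp_all
    show "mem ?s (fr + 2 * e + 1) = 0" if "e < C" for e
      using \<open>R3 s3\<close> that EG by (simp add: R3_def)
    show "bit (mem ?s (fr + 2 * e)) l \<longleftrightarrow>
          l < b \<and> e div C * b + l < length (map f xs) \<and> map f xs ! (e div C * b + l) = e mod C"
      if "e < (length (map f xs) div b + 1) * C" for e l
      using \<open>R3 s3\<close> that by (auto simp: R3_def E_def n_def)
    show "1 + (length (map f xs) div b + 1) * C * 24 \<le> 1 + 24 * E"
      by (simp add: E_def n_def)
    show "R4 s'" if "(\<forall>r<22. regs s' r = regs ?s r) \<and>
       (\<forall>a. a < fr \<or> fr + 2 * ((length (map f xs) div b + 2) * C) \<le> a \<longrightarrow> mem s' a = mem ?s a) \<and>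
       rank_table (mem s') fr b C (map f xs)" for s'
      using that \<open>R3 s3\<close> unfolding R4_def R3_def G_def n_def by auto
  qed (use b C room in simp_all)
  have 5: "runs w (block [Copy 17 21]) s4 2 (\<lambda>s'. regs s' 17 = fr + 2 * G \<and>
       (\<forall>r<20. r \<noteq> 17 \<longrightarrow> regs s' r = regs s r) \<and>
       (\<forall>a. a < fr \<or> fr + 2 * G \<le> a \<longrightarrow> mem s' a = mem s a) \<and>
       rank_table (mem s') fr b C (map f xs))" if "R4 s4" for s4
    by (rule runs_block) (use that s1 in \<open>auto simp: R4_def\<close>)
  have fold1: "fold (instr_val w) [Const 22 0] t = set_reg 22 0 t" for t by simp
  have "runs w (build col) s (30 + n * (Tc + 16) + 32 * G) (\<lambda>s'. regs s' 17 = fr + 2 * G \<and>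
       (\<forall>r<20. r \<noteq> 17 \<longrightarrow> regs s' r = regs s r) \<and>
       (\<forall>a. a < fr \<or> fr + 2 * G \<le> a \<longrightarrow> mem s' a = mem s a) \<and>
       rank_table (mem s') fr b C (map f xs))"
    unfolding build_def
    by (rule runs_block_Seq, fold s1_def, rule runs_Seq[OF 2], rule runs_block_Seq, unfold fold1,
        erule runs_Seq[OF 3], rule runs_block_Seq, unfold fold1, erule runs_Seq[OF 4], erule 5,
        rule order_refl, rule lessI, rule order_refl, rule lessI, rule order_refl)
      (simp add: T2_def EG)
  then show ?thesis unfolding G_def n_def .
qed

section \<open>Counting in a prefix with one table cell\<close>

definition rank_query :: prog where
  "rank_query = block [Binop Div 25 22 5, Binop Mul 25 25 21, Binop Add 25 25 23, Binop Add 25 25 25,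
     Binop Add 25 25 20, Load 26 25, Binop Add 25 25 3, Load 27 25, Binop Mod 28 22 5, Binop Shl 28 3 28,
     Binop Sub 28 28 3, Binop And 26 26 28, Binop Add 26 26 7, Load 26 26, Binop Add 24 27 26]"

text \<open>The stored count covers the whole blocks before position \<open>p\<close>; the remaining
  \<open>p mod b\<close> entries are the low bits of the mask. The case \<open>p = length ys\<close>
  may fall into an empty block, which the \<open>+ 1\<close> in the number of blocks
  provides.\<close>

lemma rank_query:
  assumes table: "rank_table (mem s) base b C ys"
    and regs: "regs s 3 = 1" "regs s 5 = b" "regs s 20 = base" "regs s 21 = C" "regs s 22 = p" "regs s 23 = q"
    and b: "0 < b" "b < w" and p: "p \<le> length ys" and q: "q < C"
    and room: "base + 2 * ((length ys div b + 1) * C) < 2 ^ w" "length ys < 2 ^ w"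
    and pc: "\<And>x. x < 2 ^ b \<Longrightarrow> mem s (regs s 7 + x) = popcount x" "regs s 7 + 2 ^ b \<le> 2 ^ w"
  shows "runs w rank_query s 16 (\<lambda>s'. regs s' 24 = length (filter (\<lambda>y. y \<le> q) (take p ys)) \<and>
     mem s' = mem s \<and> (\<forall>r<24. regs s' r = regs s r))"
  unfolding rank_query_def
proof (rule runs_block)
  define e where "e = p div b * C + q"
  define d where "d = p mod b"
  define x where "x = and (mem s (base + 2 * e)) (2 ^ d - 1)"
  have e: "e < (length ys div b + 1) * C" "e div C = p div b" "e mod C = q"
  proof -
    have "e < (p div b + 1) * C" using q by (simp add: e_def)
    also have "\<dots> \<le> (length ys div b + 1) * C" using p by (intro mult_right_mono) (auto simp: div_le_mono)
    finally show "e < (length ys div b + 1) * C" .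
  qed (use q in \<open>auto simp: e_def\<close>)
  have d: "d < b" using b by (simp add: d_def)
  have cell: "\<forall>l. bit (mem s (base + 2 * e)) l \<longleftrightarrow>
        l < b \<and> e div C * b + l < length ys \<and> ys ! (e div C * b + l) \<le> e mod C"
     "mem s (base + 2 * e + 1) = length (filter (\<lambda>y. y \<le> e mod C) (take (e div C * b) ys))"
    using table e(1) unfolding rank_table_def by blast+
  have bit_x: "bit x l \<longleftrightarrow> l < d \<and> ys ! (p div b * b + l) \<le> q" for l
  proof -
    have "p div b * b + d = p" by (simp add: d_def)
    then have "l < d \<Longrightarrow> p div b * b + l < length ys" using p by linarith
    moreover have "bit (mem s (base + 2 * e)) l \<longleftrightarrow>
      l < b \<and> p div b * b + l < length ys \<and> ys ! (p div b * b + l) \<le> q"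
      using cell unfolding e(2,3) by blast
    moreover have "x = take_bit d (mem s (base + 2 * e))"
      unfolding x_def take_bit_eq_mask mask_eq_exp_minus_1 ..
    then have "bit x l \<longleftrightarrow> bit (mem s (base + 2 * e)) l \<and> l < d"
      by (auto simp: bit_take_bit_iff)
    ultimately show ?thesis using d by auto
  qed
  have x: "x < 2 ^ b" by (rule bits_bounded_nat) (use bit_x d in auto)
  have cnt: "mem s (base + 2 * e + 1) = length (filter (\<lambda>y. y \<le> q) (take (p div b * b) ys))"
    using cell unfolding e(2,3) by blast
  have total: "mem s (base + 2 * e + 1) + popcount x = length (filter (\<lambda>y. y \<le> q) (take p ys))"
  proof -
    have "p = p div b * b + d" by (simp add: d_def)
    then have "take p ys = take (p div b * b) ys @ take d (drop (p div b * b) ys)"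
      by (metis take_add)
    moreover have "length (filter (\<lambda>y. y \<le> q) (take d (drop (p div b * b) ys))) = popcount x"
    proof -
      have "p div b * b + d \<le> length ys" using p by (simp add: d_def)
      then show ?thesis unfolding length_filter_conv_card popcount_def bit_x
        by (intro arg_cong[where f = card]) (auto simp: less_diff_conv add.commute)
    qed
    ultimately show ?thesis unfolding cnt by simp
  qed
  have total_bd: "mem s (base + 2 * e + 1) + popcount x < 2 ^ w"
    unfolding total using room(2) p
    by (intro le_less_trans[OF length_filter_le]) simp
  have pow: "(2::nat) ^ d < 2 ^ w" using d b by simp
  have bd: "base + 2 * e + 1 < 2 ^ w" using e(1) room(1) by linarith
  have bd1: "p div b * C < 2 ^ w" "p div b * C + q < 2 ^ w" "e < 2 ^ w" "e + e < 2 ^ w" "e + e + base < 2 ^ w"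
    "Suc (e + e + base) < 2 ^ w"
    using bd e_def by linarith+
  have bd2: "x + regs s 7 < 2 ^ w" using x pc(2) by linarith
  have sub: "(2 ^ d + 2 ^ w - Suc 0) mod 2 ^ w = (2 ^ d - Suc 0 :: nat)"
  proof -
    have "2 ^ d + 2 ^ w - Suc 0 = (2 ^ d - Suc 0) + (2 ^ w :: nat)" by (simp add: Suc_leI)
    moreover have "2 ^ d - Suc 0 < 2 ^ w" using pow by linarith
    ultimately show ?thesis by (metis mod_add_self2 mod_less)
  qed
  have pcx: "mem s (x + regs s 7) = popcount x" using pc(1)[OF x] by (simp add: add.commute)
  \<comment> \<open>The straight-line code is evaluated in pieces: address of the cell, its two
    words, truncated mask, final lookup. Each piece uses its own facts about absence of
    overflow.\<close>
  define s' where "s' = fold (instr_val w) [Binop Div 25 22 5, Binop Mul 25 25 21, Binop Add 25 25 23] s"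
  have s': "regs s' 25 = e" "mem s' = mem s" "\<And>r. r \<noteq> 25 \<Longrightarrow> regs s' r = regs s r"
    using regs bd1 by (simp_all add: s'_def e_def)
  define s2 where "s2 = fold (instr_val w) [Binop Add 25 25 25,
     Binop Add 25 25 20, Load 26 25, Binop Add 25 25 3, Load 27 25] s'"
  have adr: "e + e + base = base + 2 * e" by simp
  have s2: "regs s2 26 = mem s (base + 2 * e)" "regs s2 27 = mem s (base + 2 * e + 1)" "mem s2 = mem s"
     "\<And>r. r < 25 \<Longrightarrow> regs s2 r = regs s r"
    using regs s' bd1 bd by (simp_all add: s2_def adr)
  define s3 where "s3 = fold (instr_val w) [Binop Mod 28 22 5, Binop Shl 28 3 28,
     Binop Sub 28 28 3, Binop And 26 26 28] s2"
  have s3: "regs s3 26 = x" "regs s3 27 = mem s (base + 2 * e + 1)" "mem s3 = mem s"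
     "\<And>r. r < 25 \<Longrightarrow> regs s3 r = regs s r"
    using s2 regs pow sub by (simp_all add: s3_def x_def d_def push_bit_eq_mult)
  have "fold (instr_val w) [Binop Add 26 26 7, Load 26 26, Binop Add 24 27 26] s3 =
    fold (instr_val w) [Binop Div 25 22 5, Binop Mul 25 25 21, Binop Add 25 25 23, Binop Add 25 25 25,
     Binop Add 25 25 20, Load 26 25, Binop Add 25 25 3, Load 27 25, Binop Mod 28 22 5, Binop Shl 28 3 28,
     Binop Sub 28 28 3, Binop And 26 26 28, Binop Add 26 26 7, Load 26 26, Binop Add 24 27 26] s"
    (is "?t = ?t'")
    unfolding s3_def s2_def s'_def by (simp del: instr_val.simps)
  moreover have "regs ?t 24 = length (filter (\<lambda>y. y \<le> q) (take p ys)) \<and>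
     mem ?t = mem s \<and> (\<forall>r<24. regs ?t r = regs s r)"
    using s3 bd2 pcx total_bd by (simp add: total[symmetric])
  ultimately show "regs ?t' 24 = length (filter (\<lambda>y. y \<le> q) (take p ys)) \<and>
     mem ?t' = mem s \<and> (\<forall>r<24. regs ?t' r = regs s r)" by metis
qed simp

section \<open>Queries\<close>

definition col0 :: "nat \<Rightarrow> nat \<Rightarrow> nat \<Rightarrow> nat" where
  "col0 b C a = (if a < b then C - (a + 1) else C - (b + bitlen (a div b)))"

text \<open>Truncated subtraction puts all entries from \<open>2 * t - 1\<close> on into column 0;
  no threshold below \<open>2 * t\<close> separates them.\<close>

definition colt :: "nat \<Rightarrow> nat \<Rightarrow> nat" where
  "colt t a = 2 * t - (a + 1)"

text \<open>Counting down from \<open>Y + 1\<close> rather than \<open>Y\<close> leaves column 0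
  empty for quotients up to \<open>Y\<close>. So every threshold column has a predecessor, which
  expresses "quotient strictly greater".\<close>

definition colh :: "nat \<Rightarrow> nat \<Rightarrow> nat \<Rightarrow> nat" where
  "colh b Y a = Y + 1 - a div b"

definition coll :: "nat \<Rightarrow> nat \<Rightarrow> nat" where
  "coll b a = b - (a mod b + 1)"

lemma div_ge_iff: "0 < (b::nat) \<Longrightarrow> x \<le> a div b \<longleftrightarrow> b * x \<le> a"
  by (simp add: less_eq_div_iff_mult_less_eq mult.commute)

lemma bitlen_gt_iff: "k < bitlen x \<longleftrightarrow> 2 ^ k \<le> x"
  using bitlen_le_iff[of x k] by auto

lemma bitlen_mono: "x \<le> y \<Longrightarrow> bitlen x \<le> bitlen y"
  using bitlen_le_iff[of y "bitlen y"] by (auto simp: bitlen_le_iff)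

lemma bitlen_bounds:
  assumes "0 < bitlen x"
  shows "2 ^ (bitlen x - 1) \<le> x" "x < 2 ^ bitlen x"
  using assms bitlen_gt_iff[of "bitlen x - 1" x] bitlen_le_iff[of x "bitlen x"] by auto

text \<open>Entries of at least \<open>b\<close> lie in columns before those of all values below
  \<open>b\<close>, hence reach every small threshold.\<close>

lemma col0_le_iff_small:
  assumes "v < b" "C = b + bitlen Y + 1" "a div b \<le> Y"
  shows "col0 b C a \<le> C - (v + 1) \<longleftrightarrow> v \<le> a"
proof (cases "a < b")
  case False
  then have "0 < a div b" using assms(1) by (simp add: div_greater_zero_iff)
  then have "0 < bitlen (a div b)" by (simp add: bitlen_gt_iff Suc_leI)
  moreover have "bitlen (a div b) \<le> bitlen Y" using assms(3) by (rule bitlen_mono)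
  ultimately show ?thesis using False assms(1,2) unfolding col0_def by auto
qed (use assms in \<open>auto simp: col0_def\<close>)

text \<open>For an entry \<open>a\<close>, \<open>bitlen (a div b)\<close> is the number of
  thresholds of the form \<open>b * 2 ^ i\<close> that it reaches. The final \<open>+ 1\<close> in
  \<open>C\<close> admits \<open>k = bitlen Y + 1\<close>, the proven bound for the first threshold
  beyond the tabulated scales.\<close>

lemma col0_le_iff_large:
  assumes "0 < b" "0 < k" "k \<le> bitlen Y + 1" "C = b + bitlen Y + 1" "a div b \<le> Y"
  shows "col0 b C a \<le> C - (b + k) \<longleftrightarrow> b * 2 ^ (k - 1) \<le> a"
proof -
  have le: "bitlen (a div b) \<le> bitlen Y" using assms(5) by (rule bitlen_mono)
  have "b * 2 ^ (k - 1) \<le> a \<longleftrightarrow> k \<le> bitlen (a div b)"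
    using assms bitlen_gt_iff[of "k - 1" "a div b"] by (auto simp: div_ge_iff)
  moreover have "k \<le> bitlen (a div b) \<Longrightarrow> \<not> a < b" using assms by (intro notI) simp
  ultimately show ?thesis using assms le unfolding col0_def by auto
qed

lemma colt_le_iff: "v < 2 * t \<Longrightarrow> colt t a \<le> 2 * t - (v + 1) \<longleftrightarrow> v \<le> a"
  unfolding colt_def by auto

lemma digits_le_iff:
  assumes "0 < (b::nat)"
  shows "v \<le> a \<longleftrightarrow> v div b < a div b \<or> v div b \<le> a div b \<and> v mod b \<le> a mod b"
proof -
  consider "v div b < a div b" | "v div b = a div b" | "a div b < v div b" by linarith
  then show ?thesis
  proof cases
    case 1
    then have "v < a" by (metis div_le_mono leD not_le_imp_less)
    with 1 show ?thesis by simp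
  next
    case 2
    then show ?thesis by (metis add_le_cancel_left div_mult_mod_eq less_irrefl order_refl)
  next
    case 3
    then have "a < v" by (metis div_le_mono leD not_le_imp_less)
    with 3 show ?thesis by simp
  qed
qed

text \<open>
  By \<open>digits_le_iff\<close> the mask for \<open>v\<close> is \<open>H' or (H and L)\<close>, where \<open>H\<close>, \<open>H'\<close> and \<open>L\<close> mark the entries whose
  quotient by \<open>b\<close> is at least \<open>v div b\<close>, whose quotient exceeds \<open>v div b\<close>, and whose remainder is at
  least \<open>v mod b\<close>.
\<close>

definition final_query :: prog where
  "final_query = block [Binop Div 25 1 5, Binop Add 26 6 3, Binop Sub 25 26 25, Binop Add 25 25 25,
     Binop Add 25 25 14, Load 26 25, Binop Sub 25 25 3, Binop Sub 25 25 3, Load 27 25,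
     Binop Mod 25 1 5, Binop Add 25 25 3, Binop Sub 25 5 25, Binop Add 25 25 25, Binop Add 25 25 15,
     Load 25 25, Binop And 26 26 25, Binop Or 26 26 27, Binop Shl 28 3 22, Binop Sub 28 28 3,
     Binop And 26 26 28, Binop Add 26 26 7, Load 24 26]"

lemma sub_word: "y \<le> x \<Longrightarrow> x < 2 ^ w \<Longrightarrow> (x + 2 ^ w - y) mod 2 ^ w = (x - y :: nat)"
  by (metis Nat.add_diff_assoc2 less_imp_diff_less mod_add_self2 mod_less)

text \<open>At most \<open>b\<close> entries all lie in block 0, so the mask in cell
  \<open>q\<close> alone describes column \<open>q\<close> for the entire sequence.\<close>

lemma rank_table_first_block:
  assumes "rank_table \<mu> base b C ys" "q < C" "length ys \<le> b" "l < length ys"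
  shows "bit (\<mu> (base + 2 * q)) l \<longleftrightarrow> ys ! l \<le> q"
proof -
  have "q < (length ys div b + 1) * C" using assms(2) by simp
  then have "\<forall>l. bit (\<mu> (base + 2 * q)) l \<longleftrightarrow>
        l < b \<and> q div C * b + l < length ys \<and> ys ! (q div C * b + l) \<le> q mod C"
    using assms(1) unfolding rank_table_def by blast
  then show ?thesis using assms by auto
qed

text \<open>There is no whole block before \<open>p\<close>, so no count is added. As
  \<open>p = b\<close> is possible, the mask is cut at \<open>p\<close> itself and not at
  \<open>p mod b\<close>; \<open>b < w\<close> keeps \<open>2 ^ p\<close> a word.\<close>

lemma final_query:
  assumes t1: "rank_table (mem s) hbase b (Y + 2) (map (colh b Y) ys)"
    and t2: "rank_table (mem s) lbase b b (map (coll b) ys)"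
    and regs: "regs s 1 = v" "regs s 3 = 1" "regs s 5 = b" "regs s 6 = Y" "regs s 14 = hbase"
      "regs s 15 = lbase" "regs s 22 = p"
    and b: "0 < b" "b < w" and p: "p \<le> length ys" and ys: "length ys \<le> b"
    and v: "v div b \<le> Y" and digits: "\<And>a. a \<in> set ys \<Longrightarrow> a div b \<le> Y"
    and room: "hbase + 2 * (Y + 2) < 2 ^ w" "lbase + 2 * b < 2 ^ w"
    and pc: "\<And>x. x < 2 ^ b \<Longrightarrow> mem s (regs s 7 + x) = popcount x" "regs s 7 + 2 ^ b \<le> 2 ^ w"
  shows "runs w final_query s 23 (\<lambda>s'. regs s' 24 = length (filter (\<lambda>a. v \<le> a) (take p ys)) \<and>
     mem s' = mem s \<and> (\<forall>r<24. regs s' r = regs s r))"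
  unfolding final_query_def
proof (rule runs_block)
  define q where "q = Y + 1 - v div b"
  define q' where "q' = b - (v mod b + 1)"
  define H where "H = mem s (hbase + 2 * q)"
  \<comment> \<open>The predecessor column of \<open>q\<close> exists because
    \<open>v div b \<le> Y\<close> gives \<open>q > 0\<close>.\<close>
  define H' where "H' = mem s (hbase + 2 * (q - 1))"
  define L where "L = mem s (lbase + 2 * q')"
  define x where "x = and (or (and H L) H') (2 ^ p - 1)"
  have q: "0 < q" "q < Y + 2" "q' < b" using v b by (auto simp: q_def q'_def)
  have vm: "v mod b < b" using b by simp
  have bit_x: "bit x l \<longleftrightarrow> l < p \<and> v \<le> ys ! l" for l
  proof -
    have "x = take_bit p (or (and H L) H')"
      unfolding x_def take_bit_eq_mask mask_eq_exp_minus_1 ..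
    then have "bit x l \<longleftrightarrow> l < p \<and> (bit H l \<and> bit L l \<or> bit H' l)"
      by (auto simp: bit_take_bit_iff bit_or_iff bit_and_iff)
    moreover have "bit H l \<and> bit L l \<or> bit H' l \<longleftrightarrow> v \<le> ys ! l" if "l < p"
    proof -
      have l: "l < length ys" using that p by simp
      have hy: "ys ! l div b \<le> Y" using digits l by simp
      have "bit H l \<longleftrightarrow> colh b Y (ys ! l) \<le> q" unfolding H_def
        using rank_table_first_block[OF t1 q(2), of l] ys l by simp
      also have "\<dots> \<longleftrightarrow> v div b \<le> ys ! l div b" using hy v unfolding colh_def q_def by auto
      finally have 1: "bit H l \<longleftrightarrow> v div b \<le> ys ! l div b" .
      have "bit H' l \<longleftrightarrow> colh b Y (ys ! l) \<le> q - 1" unfolding H'_def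
        using rank_table_first_block[OF t1, of "q - 1" l] q ys l by simp
      also have "\<dots> \<longleftrightarrow> v div b < ys ! l div b" using hy v unfolding colh_def q_def by auto
      finally have 2: "bit H' l \<longleftrightarrow> v div b < ys ! l div b" .
      have "ys ! l mod b < b" using b by simp
      then have q'': "coll b (ys ! l) \<le> q' \<longleftrightarrow> v mod b \<le> ys ! l mod b"
        using vm unfolding coll_def q'_def by linarith
      have "bit L l \<longleftrightarrow> coll b (ys ! l) \<le> q'" unfolding L_def
        using rank_table_first_block[OF t2 q(3), of l] ys l by simp
      then show ?thesis using 1 2 q'' digits_le_iff[OF b(1), of v "ys ! l"] by blast
    qed
    ultimately show ?thesis by blast
  qed
  have pb: "p \<le> b" using p ys by simp
  have x: "x < 2 ^ b" by (rule bits_bounded_nat) (use bit_x pb in auto)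
  have result: "popcount x = length (filter (\<lambda>a. v \<le> a) (take p ys))"
    unfolding length_filter_conv_card popcount_def bit_x
    using p by (intro arg_cong[where f = card]) auto
  have pcx: "mem s (x + regs s 7) = popcount x" using pc(1)[OF x] by (simp add: add.commute)
  have bdx: "x + regs s 7 < 2 ^ w" using x pc(2) by linarith
  have "hbase + 2 * q + 2 \<le> hbase + 2 * (Y + 2)" "lbase + 2 * q' < lbase + 2 * b" using q by auto
  then have bd: "Y + 1 < 2 ^ w" "q + q < 2 ^ w" "q + q + hbase < 2 ^ w"
    "q' + q' < 2 ^ w" "q' + q' + lbase < 2 ^ w" "b < 2 ^ w"
    using room by auto
  have bdm: "v mod b + 1 < 2 ^ w" using vm bd(6) by linarith
  have pow: "(2::nat) ^ p < 2 ^ w" using pb b by simp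
  have powsub: "2 ^ p - 1 < (2::nat) ^ w" using pow by linarith
  define s1 where "s1 = fold (instr_val w) [Binop Div 25 1 5, Binop Add 26 6 3, Binop Sub 25 26 25, Binop Add 25 25 25,
     Binop Add 25 25 14, Load 26 25] s"
  have adr: "q + q + hbase = hbase + 2 * q" "q' + q' + lbase = lbase + 2 * q'" by auto
  have h: "(Suc Y + 2 ^ w - v div b) mod 2 ^ w = q" unfolding q_def
    using sub_word[of "v div b" "Y + 1" w] v bd(1) by simp
  have s1: "regs s1 26 = H" "regs s1 25 = hbase + 2 * q" "mem s1 = mem s" "\<And>r. r < 25 \<Longrightarrow> regs s1 r = regs s r"
    using regs bd(1-3) h by (simp_all add: s1_def H_def adr)
  define s2 where "s2 = fold (instr_val w) [Binop Sub 25 25 3, Binop Sub 25 25 3, Load 27 25] s1"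
  have h1: "(hbase + 2 * q + 2 ^ w - 1) mod 2 ^ w = hbase + 2 * q - 1"
    "(hbase + 2 * q - 1 + 2 ^ w - 1) mod 2 ^ w = hbase + 2 * (q - 1)"
    using sub_word[of 1 "hbase + 2 * q" w] sub_word[of 1 "hbase + 2 * q - 1" w] bd q
    by (simp_all add: adr algebra_simps)
  have s2: "regs s2 27 = H'" "regs s2 26 = H" "mem s2 = mem s" "\<And>r. r < 25 \<Longrightarrow> regs s2 r = regs s r"
    using s1 s1(4)[of 3] regs(2) h1 by (simp_all add: s2_def H'_def del: One_nat_def)
  define s3 where "s3 = fold (instr_val w) [Binop Mod 25 1 5, Binop Add 25 25 3, Binop Sub 25 5 25,
     Binop Add 25 25 25, Binop Add 25 25 15, Load 25 25] s2"
  have h2: "(b + 2 ^ w - (v mod b + 1)) mod 2 ^ w = q'" unfolding q'_def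
    using sub_word[of "v mod b + 1" b w] vm bd by simp
  have s3: "regs s3 25 = L" "regs s3 27 = H'" "regs s3 26 = H" "mem s3 = mem s" "\<And>r. r < 25 \<Longrightarrow> regs s3 r = regs s r"
    using s2 regs bd(4-6) bdm h2 by (simp_all add: s3_def L_def adr)
  define s4 where "s4 = fold (instr_val w) [Binop And 26 26 25, Binop Or 26 26 27, Binop Shl 28 3 22,
     Binop Sub 28 28 3, Binop And 26 26 28] s3"
  have h3: "(2 ^ p + 2 ^ w - Suc 0) mod 2 ^ w = (2 ^ p - Suc 0 :: nat)"
    using sub_word[of 1 "2 ^ p" w] pow by simp
  have s4: "regs s4 26 = x" "mem s4 = mem s" "\<And>r. r < 24 \<Longrightarrow> regs s4 r = regs s r"
    using s3 regs pow h3 by (simp_all add: s4_def x_def push_bit_eq_mult)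
  have "fold (instr_val w) [Binop Add 26 26 7, Load 24 26] s4 =
    fold (instr_val w) [Binop Div 25 1 5, Binop Add 26 6 3, Binop Sub 25 26 25, Binop Add 25 25 25,
     Binop Add 25 25 14, Load 26 25, Binop Sub 25 25 3, Binop Sub 25 25 3, Load 27 25,
     Binop Mod 25 1 5, Binop Add 25 25 3, Binop Sub 25 5 25, Binop Add 25 25 25, Binop Add 25 25 15,
     Load 25 25, Binop And 26 26 25, Binop Or 26 26 27, Binop Shl 28 3 22, Binop Sub 28 28 3,
     Binop And 26 26 28, Binop Add 26 26 7, Load 24 26] s" (is "?t = ?t'")
    unfolding s4_def s3_def s2_def s1_def by (simp del: instr_val.simps)
  moreover have "regs ?t 24 = length (filter (\<lambda>a. v \<le> a) (take p ys)) \<and>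
     mem ?t = mem s \<and> (\<forall>r<24. regs ?t r = regs s r)"
    using s4 bdx pcx by (simp add: result)
  ultimately show "regs ?t' 24 = length (filter (\<lambda>a. v \<le> a) (take p ys)) \<and>
     mem ?t' = mem s \<and> (\<forall>r<24. regs ?t' r = regs s r)" by metis
qed simp

section \<open>Invariants of the finished data structure\<close>

definition tables_ready :: "nat \<Rightarrow> nat \<Rightarrow> nat \<Rightarrow> ram_state \<Rightarrow> bool" where
  "tables_ready w b Y s \<longleftrightarrow> 0 < b \<and> b < w \<and> regs s 3 = 1 \<and> regs s 5 = b \<and> regs s 6 = Y \<and>
     (\<forall>x<2 ^ b. mem s (regs s 7 + x) = popcount x) \<and> regs s 7 + 2 ^ b \<le> 2 ^ w \<and>
     (\<forall>x\<le>Y. mem s (regs s 8 + x) = bitlen x) \<and> regs s 8 + Y < 2 ^ w"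

text \<open>Scales are numbered from 1 here, so that the scale of a threshold \<open>v\<close> is
  \<open>bitlen (v div b)\<close> and can be looked up.\<close>

definition level_ready :: "nat \<Rightarrow> nat \<Rightarrow> nat list \<Rightarrow> ram_state \<Rightarrow> nat \<Rightarrow> bool" where
  "level_ready w b xs s k \<longleftrightarrow> (let t = b * 2 ^ (k - 1); ys = filter (\<lambda>a. t \<le> a) xs in
     rank_table (mem s) (mem s (regs s 9 + k)) b t (map (colt t) ys) \<and>
     mem s (regs s 9 + k) + 2 * ((length ys div b + 1) * t) < 2 ^ w \<and> 2 * t < 2 ^ w)"

definition ready :: "nat \<Rightarrow> nat \<Rightarrow> nat \<Rightarrow> nat list \<Rightarrow> ram_state \<Rightarrow> bool" where
  "ready w b Y xs s \<longleftrightarrow> tables_ready w b Y s \<and> regs s 4 = 1 \<and>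
     length xs < 2 ^ w \<and> (\<forall>a\<in>set xs. a div b \<le> Y) \<and>
     regs s 11 = b + bitlen Y + 1 \<and> regs s 11 < 2 ^ w \<and>
     rank_table (mem s) (regs s 10) b (regs s 11) (map (col0 b (regs s 11)) xs) \<and>
     regs s 10 + 2 * ((length xs div b + 1) * regs s 11) < 2 ^ w \<and>
     0 < regs s 13 \<and> regs s 13 \<le> bitlen Y + 1 \<and> regs s 12 = b * 2 ^ (regs s 13 - 1) \<and>
     regs s 9 + regs s 13 < 2 ^ w \<and> (\<forall>k. 0 < k \<longrightarrow> k < regs s 13 \<longrightarrow> level_ready w b xs s k) \<and>
     (let ys = filter (\<lambda>a. regs s 12 \<le> a) xs in length ys \<le> b \<and>
        rank_table (mem s) (regs s 14) b (Y + 2) (map (colh b Y) ys) \<and>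
        rank_table (mem s) (regs s 15) b b (map (coll b) ys)) \<and>
     regs s 14 + 2 * (Y + 2) < 2 ^ w \<and> regs s 15 + 2 * b < 2 ^ w"

lemma tables_ready_cong:
  assumes "tables_ready w b Y s" "mem s' = mem s" "\<And>r. 2 < r \<Longrightarrow> r < 19 \<Longrightarrow> regs s' r = regs s r"
  shows "tables_ready w b Y s'"
  using assms unfolding tables_ready_def by simp

text \<open>Queries write no memory and, apart from register 0, only registers from 19 on; passing
  the next query changes only registers 0 and 1. So the structure survives any sequence of
  queries.\<close>

lemma ready_cong:
  assumes "ready w b Y xs s" "mem s' = mem s" "\<And>r. 2 < r \<Longrightarrow> r < 19 \<Longrightarrow> regs s' r = regs s r"
  shows "ready w b Y xs s'"
proof -
  have r: "regs s' 4 = regs s 4" "regs s' 9 = regs s 9" "regs s' 10 = regs s 10" "regs s' 11 = regs s 11"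
    "regs s' 12 = regs s 12" "regs s' 13 = regs s 13" "regs s' 14 = regs s 14" "regs s' 15 = regs s 15"
    using assms(3) by simp_all
  have "tables_ready w b Y s'" by (rule tables_ready_cong[of w b Y s])
    (use assms in \<open>auto simp: ready_def\<close>)
  then show ?thesis using assms(1) unfolding ready_def level_ready_def r assms(2) by blast
qed

definition large_query :: prog where
  "large_query = block [Binop Div 25 1 5] ;;
     Cond (Less 6 25) (block [Const 0 0])
      (Cond (Less 1 5)
        (block [Copy 20 10, Copy 21 11, Copy 22 0, Binop Add 23 1 3, Binop Sub 23 11 23] ;;
         rank_query ;; block [Copy 0 24])
        (Cond (Less 1 12)
          (block [Binop Add 25 25 8, Load 19 25, Copy 20 10, Copy 21 11, Copy 22 0, Binop Add 23 5 19,
             Binop Sub 23 11 23] ;;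
           rank_query ;;
           block [Copy 22 24, Binop Add 25 9 19, Load 20 25, Binop Sub 25 19 3, Binop Shl 21 5 25,
             Binop Add 23 21 21, Binop Add 25 1 3, Binop Sub 23 23 25] ;;
           rank_query ;; block [Copy 0 24])
          (block [Copy 20 10, Copy 21 11, Copy 22 0, Binop Add 23 5 13, Binop Sub 23 11 23] ;;
           rank_query ;; block [Copy 22 24] ;; final_query ;; block [Copy 0 24])))"

text \<open>Translates a position in the array into a position in a subsequence: the number of
  selected entries among the first \<open>j\<close> is the length of the matching prefix.\<close>

lemma take_filter: "take (length (filter P (take j xs))) (filter P xs) = filter P (take j xs)"
proof -
  have "filter P xs = filter P (take j xs) @ filter P (drop j xs)"
    by (metis append_take_drop_id filter_append)
  then show ?thesis by simp
qed

lemma filter_filter_ge: "t \<le> v \<Longrightarrow> filter (\<lambda>a. v \<le> a) (filter (\<lambda>a. t \<le> a) xs) = filter (\<lambda>a. v \<le> (a::nat)) xs"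
  by (induction xs) auto

text \<open>Serves both purposes of the table of \<open>A\<close>: answering thresholds below
  \<open>b\<close> directly, and translating \<open>j\<close> for the scale of a larger one.\<close>

lemma level0_query:
  assumes rdy: "ready w b Y xs s" and p: "p \<le> length xs" and q: "q < regs s 11"
    and s1: "mem s1 = mem s" "\<And>r. 2 < r \<Longrightarrow> r < 19 \<Longrightarrow> regs s1 r = regs s r"
      "regs s1 20 = regs s 10" "regs s1 21 = regs s 11" "regs s1 22 = p" "regs s1 23 = q"
    and thr: "\<And>a. a \<in> set xs \<Longrightarrow> col0 b (regs s 11) a \<le> q \<longleftrightarrow> v \<le> a"
  shows "runs w rank_query s1 16 (\<lambda>s'. regs s' 24 = length (filter (\<lambda>a. v \<le> a) (take p xs)) \<and>
     mem s' = mem s1 \<and> (\<forall>r<24. regs s' r = regs s1 r))"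
proof -
  let ?f = "col0 b (regs s 11)"
  have "length (filter (\<lambda>y. y \<le> q) (take p (map ?f xs))) = length (filter (\<lambda>a. v \<le> a) (take p xs))"
  proof -
    have "filter (\<lambda>a. ?f a \<le> q) (take p xs) = filter (\<lambda>a. v \<le> a) (take p xs)"
      by (rule filter_cong) (use thr in \<open>auto dest: in_set_takeD\<close>)
    then show ?thesis by (simp add: take_map filter_map o_def)
  qed
  moreover have "runs w rank_query s1 16 (\<lambda>s'. regs s' 24 = length (filter (\<lambda>y. y \<le> q) (take p (map ?f xs))) \<and>
     mem s' = mem s1 \<and> (\<forall>r<24. regs s' r = regs s1 r))"
    by (rule rank_query[where base = "regs s 10" and C = "regs s 11" and b = b])
      (use rdy p q s1 in \<open>auto simp: ready_def tables_ready_def\<close>)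
  ultimately show ?thesis by simp
qed

lemma large_query:
  assumes rdy: "ready w b Y xs s" and j: "regs s 0 = j" "j \<le> length xs" and v: "regs s 1 = v" "v < 2 ^ w"
  shows "runs w large_query s 70 (\<lambda>s'. regs s' 0 = length (filter (\<lambda>a. v \<le> a) (take j xs)) \<and> ready w b Y xs s')"
proof -
  define C where "C = regs s 11"
  have b: "0 < b" "b < w" and rb: "regs s 3 = 1" "regs s 5 = b" "regs s 6 = Y"
    and C: "C = b + bitlen Y + 1" "C < 2 ^ w" and len: "length xs < 2 ^ w"
    and digits: "\<And>a. a \<in> set xs \<Longrightarrow> a div b \<le> Y"
    and pc: "\<And>x. x < 2 ^ b \<Longrightarrow> mem s (regs s 7 + x) = popcount x" "regs s 7 + 2 ^ b \<le> 2 ^ w"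
    and bl: "\<And>x. x \<le> Y \<Longrightarrow> mem s (regs s 8 + x) = bitlen x" "regs s 8 + Y < 2 ^ w"
    using rdy unfolding ready_def tables_ready_def C_def by auto
  define K where "K = regs s 13"
  define t where "t = b * 2 ^ (K - 1)"
  have K: "0 < K" "K \<le> bitlen Y + 1" "regs s 12 = t" "regs s 9 + K < 2 ^ w"
    using rdy unfolding ready_def K_def t_def by auto
  have level: "level_ready w b xs s k" if "0 < k" "k < K" for k
    using rdy that unfolding ready_def K_def by simp
  let ?R = "\<lambda>s'. regs s' 0 = length (filter (\<lambda>a. v \<le> a) (take j xs)) \<and> ready w b Y xs s'"
  define s0 where "s0 = set_reg 25 (v div b) s"
  have s0: "mem s0 = mem s" "regs s0 25 = v div b" "\<And>r. r \<noteq> 25 \<Longrightarrow> regs s0 r = regs s r"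
    by (simp_all add: s0_def)
  have finish: "runs w (block [Copy 0 24]) s' 2 ?R"
    if "regs s' 24 = length (filter (\<lambda>a. v \<le> a) (take j xs))" "mem s' = mem s"
      "\<And>r. 2 < r \<Longrightarrow> r < 19 \<Longrightarrow> regs s' r = regs s r" for s'
    by (rule runs_block) (use that in \<open>auto intro: ready_cong[OF rdy]\<close>)
  \<comment> \<open>Besides giving the answer 0, this test protects the later lookups, which need
    \<open>v div b \<le> Y\<close>.\<close>
  have huge: "runs w (block [Const 0 0]) s0 2 ?R" if "Y < v div b"
  proof (rule runs_block)
    have "filter (\<lambda>a. v \<le> a) (take j xs) = []"
    proof (clarsimp simp: filter_empty_conv)
      fix a assume "a \<in> set (take j xs)" "v \<le> a"
      then have "v div b \<le> Y" using digits[of a] div_le_mono[of v a b] by (auto dest: in_set_takeD)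
      then show False using that by simp
    qed
    then show "?R (fold (instr_val w) [Const 0 0] s0)"
      by (auto intro!: ready_cong[OF rdy] simp: s0)
  qed simp
  have small: "runs w (block [Copy 20 10, Copy 21 11, Copy 22 0, Binop Add 23 1 3, Binop Sub 23 11 23] ;;
         rank_query ;; block [Copy 0 24]) s0 30 ?R" if "v < b"
  proof (rule runs_block_Seq[OF runs_Seq])
    define s1 where "s1 = fold (instr_val w) [Copy 20 10, Copy 21 11, Copy 22 0, Binop Add 23 1 3,
      Binop Sub 23 11 23] s0"
    have *: "Suc v < 2 ^ w" "(C + 2 ^ w - Suc v) mod 2 ^ w = C - Suc v"
      using that C sub_word[of "Suc v" C w] by auto
    have s1: "mem s1 = mem s" "\<And>r. r < 19 \<Longrightarrow> regs s1 r = regs s r"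
      "regs s1 20 = regs s 10" "regs s1 21 = regs s 11" "regs s1 22 = j" "regs s1 23 = C - (v + 1)"
      using rb * s0 j v by (simp_all add: s1_def C_def)
    show "runs w rank_query s1 16 (\<lambda>s'. regs s' 24 = length (filter (\<lambda>a. v \<le> a) (take j xs)) \<and>
     mem s' = mem s1 \<and> (\<forall>r<24. regs s' r = regs s1 r))"
    proof (rule level0_query[OF rdy j(2)])
      show "col0 b (regs s 11) a \<le> C - (v + 1) \<longleftrightarrow> v \<le> a" if "a \<in> set xs" for a
        using col0_le_iff_small[OF \<open>v < b\<close> C(1) digits[OF that]] by (simp add: C_def)
    qed (use s1 C b in \<open>auto simp: C_def\<close>)
    show "runs w (block [Copy 0 24]) s' 2 ?R" if "regs s' 24 = length (filter (\<lambda>a. v \<le> a) (take j xs)) \<and>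
     mem s' = mem s1 \<and> (\<forall>r<24. regs s' r = regs s1 r)" for s'
      by (rule finish) (use that s1 in auto)
  qed auto
  have medium: "runs w (block [Binop Add 25 25 8, Load 19 25, Copy 20 10, Copy 21 11, Copy 22 0, Binop Add 23 5 19,
             Binop Sub 23 11 23] ;;
           rank_query ;;
           block [Copy 22 24, Binop Add 25 9 19, Load 20 25, Binop Sub 25 19 3, Binop Shl 21 5 25,
             Binop Add 23 21 21, Binop Add 25 1 3, Binop Sub 23 23 25] ;;
           rank_query ;; block [Copy 0 24]) s0 60 ?R" if vb: "\<not> v < b" "v < t" and vY: "v div b \<le> Y"
  proof -
    \<comment> \<open>This is the \<open>k\<close> with
      \<open>b * 2 ^ (k - 1) \<le> v < b * 2 ^ k\<close>, so \<open>u\<close> is the lower end of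
      the scale of \<open>v\<close>.\<close>
    define k where "k = bitlen (v div b)"
    define u where "u = b * 2 ^ (k - 1)"
    define ys where "ys = filter (\<lambda>a. u \<le> a) xs"
    have vpos: "0 < v div b" using vb b by (simp add: div_greater_zero_iff)
    then have k0: "0 < k" by (simp add: k_def bitlen_gt_iff Suc_leI)
    have kY: "k \<le> bitlen Y" unfolding k_def using vY by (rule bitlen_mono)
    have uv: "u \<le> v" "v < 2 * u"
    proof -
      have "2 ^ (k - 1) \<le> v div b" "v div b < 2 ^ k"
        using bitlen_bounds k0 unfolding k_def by auto
      then show "u \<le> v" unfolding u_def using b by (simp add: div_ge_iff)
      have "b * 2 ^ k = 2 * u" unfolding u_def using k0 by (cases k) auto
      moreover have "\<not> b * 2 ^ k \<le> v" using \<open>v div b < 2 ^ k\<close> b by (simp add: div_ge_iff[symmetric])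
      ultimately show "v < 2 * u" by simp
    qed
    \<comment> \<open>A \<open>k\<close> of at least \<open>K\<close> would give
      \<open>t \<le> u \<le> v\<close>, so the scale of \<open>v\<close> does have a table.\<close>
    have kK: "k < K"
    proof (rule ccontr)
      assume "\<not> k < K"
      then have "t \<le> u" unfolding t_def u_def by (intro mult_le_mono2 power_increasing) auto
      then show False using uv vb by simp
    qed
    note lev = level[OF k0 kK, unfolded level_ready_def Let_def, folded u_def, folded ys_def]
    define s1 where "s1 = fold (instr_val w) [Binop Add 25 25 8, Load 19 25, Copy 20 10, Copy 21 11,
      Copy 22 0, Binop Add 23 5 19, Binop Sub 23 11 23] s0"
    have *: "v div b + regs s 8 < 2 ^ w" "mem s (v div b + regs s 8) = k" "b + k < 2 ^ w"
      "(C + 2 ^ w - (b + k)) mod 2 ^ w = C - (b + k)"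
      using bl(1)[OF vY] bl(2) vY C kY sub_word[of "b + k" C w] by (auto simp: k_def add.commute)
    have s1: "mem s1 = mem s" "\<And>r. r < 19 \<Longrightarrow> regs s1 r = regs s r" "regs s1 19 = k"
      "regs s1 20 = regs s 10" "regs s1 21 = regs s 11" "regs s1 22 = j" "regs s1 23 = C - (b + k)"
      using rb * s0 j v by (simp_all add: s1_def C_def)
    define p where "p = length (filter (\<lambda>a. u \<le> a) (take j xs))"
    have q1: "runs w rank_query s1 16 (\<lambda>s'. regs s' 24 = p \<and> mem s' = mem s1 \<and> (\<forall>r<24. regs s' r = regs s1 r))"
      unfolding p_def
    proof (rule level0_query[OF rdy j(2)])
      show "col0 b (regs s 11) a \<le> C - (b + k) \<longleftrightarrow> u \<le> a" if "a \<in> set xs" for a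
        using col0_le_iff_large[OF b(1) k0 _ C(1) digits[OF that]] kY by (simp add: C_def u_def)
    qed (use s1 C b in \<open>auto simp: C_def\<close>)
    have q2: "runs w (block [Copy 22 24, Binop Add 25 9 19, Load 20 25, Binop Sub 25 19 3, Binop Shl 21 5 25,
             Binop Add 23 21 21, Binop Add 25 1 3, Binop Sub 23 23 25] ;;
           rank_query ;; block [Copy 0 24]) s' 30 ?R"
      if "regs s' 24 = p \<and> mem s' = mem s1 \<and> (\<forall>r<24. regs s' r = regs s1 r)" for s'
    proof (rule runs_block_Seq[OF runs_Seq])
      define s2 where "s2 = fold (instr_val w) [Copy 22 24, Binop Add 25 9 19, Load 20 25, Binop Sub 25 19 3,
        Binop Shl 21 5 25, Binop Add 23 21 21, Binop Add 25 1 3, Binop Sub 23 23 25] s'"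
      have s': "regs s' 24 = p" "mem s' = mem s" "regs s' 19 = k" "\<And>r. r < 19 \<Longrightarrow> regs s' r = regs s r"
        using that s1 by auto
      have u2: "2 * u < 2 ^ w" using lev by simp
      have **: "regs s 9 + k < 2 ^ w" "(k + 2 ^ w - Suc 0) mod 2 ^ w = k - 1"
        "b * 2 ^ (k - Suc 0) = u" "u < 2 ^ w" "u + u < 2 ^ w" "Suc v < 2 ^ w"
        "(u + u + 2 ^ w - Suc v) mod 2 ^ w = u + u - Suc v"
        using K(4) kK sub_word[of 1 k w] k0 u2 uv sub_word[of "Suc v" "u + u" w] *(3) by (auto simp: u_def)
      have s2: "regs s2 20 = mem s (regs s 9 + k)" "regs s2 21 = u" "regs s2 22 = p" "regs s2 23 = 2 * u - (v + 1)"
        "mem s2 = mem s" "\<And>r. r < 19 \<Longrightarrow> regs s2 r = regs s r"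
        using s' ** rb v(1) by (simp_all add: s2_def push_bit_eq_mult mult_2)
      have pys: "p \<le> length ys" unfolding p_def ys_def
        by (metis take_filter length_take min.cobounded2 min.absorb_iff2 nat_le_linear min.commute)
      have res: "length (filter (\<lambda>y. y \<le> 2 * u - (v + 1)) (take p (map (colt u) ys))) =
        length (filter (\<lambda>a. v \<le> a) (take j xs))"
      proof -
        have "take p ys = filter (\<lambda>a. u \<le> a) (take j xs)" unfolding p_def ys_def by (rule take_filter)
        then show ?thesis
          by (simp add: take_map filter_map o_def colt_le_iff[OF uv(2), simplified] filter_filter_ge[OF uv(1)]
              del: filter_filter)
      qed
      show "runs w rank_query s2 16 (\<lambda>s'. regs s' 24 = length (filter (\<lambda>a. v \<le> a) (take j xs)) \<and>
         mem s' = mem s2 \<and> (\<forall>r<24. regs s' r = regs s2 r))"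
        unfolding res[symmetric]
      proof (rule rank_query)
        show "rank_table (mem s2) (mem s (regs s 9 + k)) b u (map (colt u) ys)" using lev s2 by simp
        show "mem s (regs s 9 + k) + 2 * ((length (map (colt u) ys) div b + 1) * u) < 2 ^ w" using lev by simp
        show "length (map (colt u) ys) < 2 ^ w" unfolding ys_def using len
          by (simp add: le_less_trans[OF length_filter_le])
      qed (use s2 b rb pys uv pc in auto)
      show "runs w (block [Copy 0 24]) s' 2 ?R" if "regs s' 24 = length (filter (\<lambda>a. v \<le> a) (take j xs)) \<and>
         mem s' = mem s2 \<and> (\<forall>r<24. regs s' r = regs s2 r)" for s'
        by (rule finish) (use that s2 in auto)
    qed auto
    show ?thesis by (rule runs_block_Seq[OF runs_Seq[OF q1[unfolded s1_def] q2[unfolded s1_def]]]) auto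
  qed
  have large: "runs w (block [Copy 20 10, Copy 21 11, Copy 22 0, Binop Add 23 5 13, Binop Sub 23 11 23] ;;
           rank_query ;; block [Copy 22 24] ;; final_query ;; block [Copy 0 24]) s0 60 ?R"
    if vt: "\<not> v < t" and vY: "v div b \<le> Y"
  proof -
    define ys where "ys = filter (\<lambda>a. t \<le> a) xs"
    have fin: "length ys \<le> b" "rank_table (mem s) (regs s 14) b (Y + 2) (map (colh b Y) ys)"
       "rank_table (mem s) (regs s 15) b b (map (coll b) ys)"
       "regs s 14 + 2 * (Y + 2) < 2 ^ w" "regs s 15 + 2 * b < 2 ^ w"
      using rdy K(3) unfolding ready_def ys_def Let_def by auto
    define s1 where "s1 = fold (instr_val w) [Copy 20 10, Copy 21 11, Copy 22 0, Binop Add 23 5 13,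
      Binop Sub 23 11 23] s0"
    have *: "b + K < 2 ^ w" "(C + 2 ^ w - (b + K)) mod 2 ^ w = C - (b + K)"
      using C K(2) sub_word[of "b + K" C w] by auto
    have s1: "mem s1 = mem s" "\<And>r. r < 19 \<Longrightarrow> regs s1 r = regs s r"
      "regs s1 20 = regs s 10" "regs s1 21 = regs s 11" "regs s1 22 = j" "regs s1 23 = C - (b + K)"
      using rb * s0 j by (simp_all add: s1_def C_def K_def)
    define p where "p = length (filter (\<lambda>a. t \<le> a) (take j xs))"
    have q1: "runs w rank_query s1 16 (\<lambda>s'. regs s' 24 = p \<and> mem s' = mem s1 \<and> (\<forall>r<24. regs s' r = regs s1 r))"
      unfolding p_def
    proof (rule level0_query[OF rdy j(2)])
      show "col0 b (regs s 11) a \<le> C - (b + K) \<longleftrightarrow> t \<le> a" if "a \<in> set xs" for a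
        using col0_le_iff_large[OF b(1) K(1,2) C(1) digits[OF that]] by (simp add: C_def t_def)
    qed (use s1 C b in \<open>auto simp: C_def\<close>)
    have q2: "runs w (block [Copy 22 24] ;; final_query ;; block [Copy 0 24]) s' 30 ?R"
      if "regs s' 24 = p \<and> mem s' = mem s1 \<and> (\<forall>r<24. regs s' r = regs s1 r)" for s'
    proof (rule runs_block_Seq[OF runs_Seq])
      define s2 where "s2 = fold (instr_val w) [Copy 22 24] s'"
      have s2: "regs s2 22 = p" "mem s2 = mem s" "\<And>r. r < 19 \<Longrightarrow> regs s2 r = regs s r"
        using that s1 by (auto simp: s2_def)
      have "take p ys = filter (\<lambda>a. t \<le> a) (take j xs)" unfolding p_def ys_def by (rule take_filter)
      then have res: "filter (\<lambda>a. v \<le> a) (take p ys) = filter (\<lambda>a. v \<le> a) (take j xs)"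
        using filter_filter_ge[of t v] vt by (simp del: filter_filter)
      have pys: "p \<le> length ys" unfolding p_def ys_def
        by (metis take_filter length_take min.cobounded2 min.absorb_iff2 nat_le_linear min.commute)
      show "runs w final_query s2 23 (\<lambda>s'. regs s' 24 = length (filter (\<lambda>a. v \<le> a) (take j xs)) \<and>
         mem s' = mem s2 \<and> (\<forall>r<24. regs s' r = regs s2 r))"
        unfolding res[symmetric]
        by (rule final_query[where hbase = "regs s 14" and lbase = "regs s 15" and b = b and Y = Y])
          (use s2 fin b rb v pys pc vY digits in \<open>auto simp: ys_def\<close>)
      show "runs w (block [Copy 0 24]) s' 2 ?R" if "regs s' 24 = length (filter (\<lambda>a. v \<le> a) (take j xs)) \<and>
         mem s' = mem s2 \<and> (\<forall>r<24. regs s' r = regs s2 r)" for s'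
        by (rule finish) (use that s2 in auto)
    qed auto
    show ?thesis by (rule runs_block_Seq[OF runs_Seq[OF q1[unfolded s1_def] q2[unfolded s1_def]]]) auto
  qed
  have s0_eq: "fold (instr_val w) [Binop Div 25 1 5] s = s0" using rb v by (simp add: s0_def)
  have t0: "test_val (Less 6 25) s0 \<longleftrightarrow> Y < v div b" "test_val (Less 1 5) s0 \<longleftrightarrow> v < b"
    "test_val (Less 1 12) s0 \<longleftrightarrow> v < t"
    using s0 rb v K(3) by auto
  show ?thesis unfolding large_query_def
  proof (rule runs_block_Seq[where T = 65], unfold s0_eq, rule runs_Cond[where T = 64], unfold t0)
    show "runs w (block [Const 0 0]) s0 64 ?R" if "Y < v div b"
      by (rule runs_mono[OF huge[OF that]]) auto
    show "runs w (Cond (Less 1 5)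
        (block [Copy 20 10, Copy 21 11, Copy 22 0, Binop Add 23 1 3, Binop Sub 23 11 23] ;;
         rank_query ;; block [Copy 0 24])
        (Cond (Less 1 12)
          (block [Binop Add 25 25 8, Load 19 25, Copy 20 10, Copy 21 11, Copy 22 0, Binop Add 23 5 19,
             Binop Sub 23 11 23] ;;
           rank_query ;;
           block [Copy 22 24, Binop Add 25 9 19, Load 20 25, Binop Sub 25 19 3, Binop Shl 21 5 25,
             Binop Add 23 21 21, Binop Add 25 1 3, Binop Sub 23 23 25] ;;
           rank_query ;; block [Copy 0 24])
          (block [Copy 20 10, Copy 21 11, Copy 22 0, Binop Add 23 5 13, Binop Sub 23 11 23] ;;
           rank_query ;; block [Copy 22 24] ;; final_query ;; block [Copy 0 24]))) s0 64 ?R"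
      if "\<not> Y < v div b"
    proof (rule runs_Cond[where T = 63], unfold t0)
      show "runs w (block [Copy 20 10, Copy 21 11, Copy 22 0, Binop Add 23 1 3, Binop Sub 23 11 23] ;;
         rank_query ;; block [Copy 0 24]) s0 63 ?R" if "v < b"
        by (rule runs_mono[OF small[OF that]]) auto
    qed (rule runs_Cond[where T = 60], unfold t0, use that medium large in auto)
  qed auto
qed

section \<open>Preprocessing\<close>

lemma popcount_le: "popcount x \<le> x"
proof (induction x rule: less_induct)
  case (less x)
  show ?case
  proof (cases "x = 0")
    case False
    then have "popcount (x div 2) \<le> x div 2" by (intro less) simp
    then show ?thesis by (subst popcount_rec) linarith
  qed simp
qed

lemma bitlen_le: "bitlen x \<le> x"
  by (simp add: bitlen_le_iff)

section \<open>Passing to subsequences and filling the word tables\<close>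

definition filter_prog :: prog where
  "filter_prog = block [Const 22 0, Const 23 0] ;;
     While (Less 22 16)
       (block [Binop Add 24 22 3, Load 24 24, Binop Add 22 22 3] ;;
        Cond (Less 24 12) (block []) (block [Binop Add 23 23 3, Store 23 24])) ;;
     block [Copy 16 23]"

text \<open>Compaction in place is safe because the number of kept entries never exceeds the number
  already read. It destroys the array, which is needed only until the table of \<open>A\<close> is
  built.\<close>

lemma filter_prog:
  assumes regs: "regs s 3 = 1" "regs s 12 = t" "regs s 16 = length xs" and room: "length xs < 2 ^ w"
    and input: "\<And>i. i < length xs \<Longrightarrow> mem s (Suc i) = xs ! i"
  shows "runs w filter_prog s (10 + 11 * length xs) (\<lambda>s'. let ys = filter (\<lambda>a. t \<le> a) xs in
     (\<forall>r<20. r \<noteq> 16 \<longrightarrow> regs s' r = regs s r) \<and> regs s' 16 = length ys \<and>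
     (\<forall>i<length ys. mem s' (Suc i) = ys ! i) \<and> (\<forall>a>length xs. mem s' a = mem s a))"
proof -
  define n where "n = length xs"
  define Y where "Y = (\<lambda>i. filter (\<lambda>a. t \<le> a) (take i xs))"
  define s0 where "s0 = fold (instr_val w) [Const 22 0, Const 23 0] s"
  have s0: "regs s0 22 = 0" "regs s0 23 = 0" "mem s0 = mem s" "\<And>r. r < 20 \<Longrightarrow> regs s0 r = regs s r"
    by (simp_all add: s0_def)
  let ?I = "\<lambda>i (s' :: ram_state). regs s' 22 = i \<and> regs s' 23 = length (Y i) \<and>
      (\<forall>r<20. regs s' r = regs s r) \<and> (\<forall>j<length (Y i). mem s' (Suc j) = Y i ! j) \<and>
      (\<forall>j. i \<le> j \<longrightarrow> j < n \<longrightarrow> mem s' (Suc j) = xs ! j) \<and> (\<forall>a>n. mem s' a = mem s a)"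
  let ?body = "block [Binop Add 24 22 3, Load 24 24, Binop Add 22 22 3] ;;
        Cond (Less 24 12) (block []) (block [Binop Add 23 23 3, Store 23 24])"
  have loop: "runs w (While (Less 22 16) ?body) s0 (1 + n * 11) (?I n)"
  proof (rule runs_While_uniform[where T = 10 and I = ?I and n = n])
    show "?I 0 s0" using s0 input by (simp add: Y_def n_def)
    show "\<not> test_val (Less 22 16) s'" if "?I n s'" for s'
      using that regs by (simp add: n_def)
    fix i and s' :: ram_state assume i: "i < n" and I: "?I i s'"
    have test: "test_val (Less 22 16) s'" using I i regs by (simp add: n_def)
    have i_bd: "Suc i < 2 ^ w" using i room by (simp add: n_def)
    have len: "length (Y i) \<le> i" unfolding Y_def by (rule order_trans[OF length_filter_le]) simp
    have Suc: "Y (Suc i) = Y i @ (if t \<le> xs ! i then [xs ! i] else [])"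
      using i by (simp add: Y_def n_def take_Suc_conv_app_nth)
    define s1 where "s1 = fold (instr_val w) [Binop Add 24 22 3, Load 24 24, Binop Add 22 22 3] s'"
    have s1: "regs s1 24 = xs ! i" "regs s1 22 = Suc i" "regs s1 23 = length (Y i)" "mem s1 = mem s'"
      "\<And>r. r < 20 \<Longrightarrow> regs s1 r = regs s r"
      using I i i_bd regs by (auto simp: s1_def)
    have "runs w (Cond (Less 24 12) (block []) (block [Binop Add 23 23 3, Store 23 24])) s1 5 (?I (Suc i))"
    proof (rule runs_Cond[where T = 3])
      assume "test_val (Less 24 12) s1"
      then have "Y (Suc i) = Y i" using s1 regs Suc by simp
      then show "runs w (block []) s1 3 (?I (Suc i))"
        by (intro runs_block) (use s1 I in auto)
    next
      assume "\<not> test_val (Less 24 12) s1"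
      then have Y: "Y (Suc i) = Y i @ [xs ! i]" using s1 regs Suc by simp
      have bd: "Suc (length (Y i)) < 2 ^ w" using len i_bd by linarith
      define s2 where "s2 = fold (instr_val w) [Binop Add 23 23 3, Store 23 24] s1"
      have s2: "regs s2 22 = Suc i" "regs s2 23 = Suc (length (Y i))"
        "mem s2 = (mem s')(Suc (length (Y i)) := xs ! i)" "\<And>r. r < 20 \<Longrightarrow> regs s2 r = regs s r"
        using s1 bd regs by (simp_all add: s2_def)
      have "mem s2 (Suc j) = Y (Suc i) ! j" if "j < length (Y (Suc i))" for j
        using that I unfolding s2 Y by (auto simp: nth_append less_Suc_eq)
      moreover have "mem s2 (Suc j) = xs ! j" if "Suc i \<le> j" "j < n" for j
        using that I len unfolding s2 by auto
      moreover have "mem s2 a = mem s a" if "n < a" for a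
        using that I len i unfolding s2 by auto
      ultimately have "?I (Suc i) s2" using s2 Y by auto
      then show "runs w (block [Binop Add 23 23 3, Store 23 24]) s1 3 (?I (Suc i))"
        unfolding s2_def by (rule runs_block[where R = "?I (Suc i)"]) simp
    qed simp
    then show "test_val (Less 22 16) s' \<and> runs w ?body s' 10 (?I (Suc i))"
      unfolding s1_def using test by (intro conjI runs_block_Seq[where T = 5]) auto
  qed (simp add: n_def)
  have Yn: "Y n = filter (\<lambda>a. t \<le> a) xs" by (simp add: Y_def n_def)
  have "runs w (block [Copy 16 23]) s' 2 (\<lambda>s'. let ys = filter (\<lambda>a. t \<le> a) xs in
     (\<forall>r<20. r \<noteq> 16 \<longrightarrow> regs s' r = regs s r) \<and> regs s' 16 = length ys \<and>
     (\<forall>i<length ys. mem s' (Suc i) = ys ! i) \<and> (\<forall>a>length xs. mem s' a = mem s a))" if "?I n s'" for s'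
    by (rule runs_block) (use that Yn in \<open>auto simp: Let_def n_def\<close>)
  then show ?thesis unfolding filter_prog_def
    by (intro runs_block_Seq[OF runs_Seq[OF loop[unfolded s0_def]]]) (auto simp: n_def)
qed

definition tables_prog :: prog where
  "tables_prog = block [Const 22 0, Store 7 22, Store 8 22, Const 22 1, Binop Add 23 6 3] ;;
     While (Less 22 23)
       (block [Binop Shr 24 22 3, Binop And 26 22 3, Binop Add 25 7 24, Load 25 25, Binop Add 25 25 26,
          Binop Add 27 7 22, Store 27 25, Binop Add 25 8 24, Load 25 25, Binop Add 25 25 3,
          Binop Add 27 8 22, Store 27 25, Binop Add 22 22 3])"

text \<open>In both tables entry \<open>x\<close> follows from entry \<open>x div 2\<close>: add the
  low bit, respectively 1. The assumption \<open>u + Y < v\<close> keeps the tables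
  disjoint.\<close>

lemma tables_prog:
  assumes regs: "regs s 3 = 1" "regs s 6 = Y" "regs s 7 = u" "regs s 8 = v"
    and room: "u + Y < v" "v + Y + 1 < 2 ^ w"
  shows "runs w tables_prog s (10 + 15 * Y) (\<lambda>s'. (\<forall>r<20. regs s' r = regs s r) \<and>
     (\<forall>x\<le>Y. mem s' (u + x) = popcount x) \<and> (\<forall>x\<le>Y. mem s' (v + x) = bitlen x) \<and>
     (\<forall>a. a < u \<longrightarrow> mem s' a = mem s a))"
proof -
  define s0 where "s0 = fold (instr_val w) [Const 22 0, Store 7 22, Store 8 22, Const 22 1, Binop Add 23 6 3] s"
  have "0 < w" using room by (cases w) auto
  then have w: "0 < w" "Suc Y < 2 ^ w" using room by linarith+
  have s0: "regs s0 22 = 1" "regs s0 23 = Suc Y" "mem s0 = (mem s)(u := 0, v := 0)"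
    "\<And>r. r < 20 \<Longrightarrow> regs s0 r = regs s r"
    using regs w by (simp_all add: s0_def)
  let ?I = "\<lambda>i (s' :: ram_state). regs s' 22 = Suc i \<and> regs s' 23 = Suc Y \<and> (\<forall>r<20. regs s' r = regs s r) \<and>
     (\<forall>x\<le>i. mem s' (u + x) = popcount x) \<and> (\<forall>x\<le>i. mem s' (v + x) = bitlen x) \<and>
     (\<forall>a. a < u \<longrightarrow> mem s' a = mem s a)"
  let ?B = "[Binop Shr 24 22 3, Binop And 26 22 3, Binop Add 25 7 24, Load 25 25, Binop Add 25 25 26,
          Binop Add 27 7 22, Store 27 25, Binop Add 25 8 24, Load 25 25, Binop Add 25 25 3,
          Binop Add 27 8 22, Store 27 25, Binop Add 22 22 3]"
  have loop: "runs w (While (Less 22 23) (block ?B)) s0 (1 + Y * 15) (?I Y)"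
  proof (rule runs_While_uniform[where T = 14 and I = ?I and n = Y])
    show "?I 0 s0" using s0 room by simp
    show "\<not> test_val (Less 22 23) s'" if "?I Y s'" for s' using that by simp
    fix i and s' :: ram_state assume i: "i < Y" and I: "?I i s'"
    define x where "x = Suc i"
    define s1 where "s1 = fold (instr_val w) ?B s'"
    have r: "regs s' 3 = 1" "regs s' 7 = u" "regs s' 8 = v" "regs s' 22 = x" using I regs by (auto simp: x_def)
    have h: "x div 2 \<le> i" by (auto simp: x_def)
    have pcx: "popcount (x div 2) + x mod 2 = popcount x" using popcount_rec[of x] by simp
    have blx: "Suc (bitlen (x div 2)) = bitlen x" by (subst (2) bitlen.simps) (simp add: x_def)
    have bd: "u + x div 2 < 2 ^ w" "u + x < 2 ^ w" "v + x div 2 < 2 ^ w" "v + x < 2 ^ w" "Suc x < 2 ^ w"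
        "popcount x < 2 ^ w" "bitlen x < 2 ^ w"
      using room i h popcount_le[of x] bitlen_le[of x] by (auto simp: x_def)
    have m: "mem s' (u + x div 2) = popcount (x div 2)" "mem s' (v + x div 2) = bitlen (x div 2)"
      using I h by blast+
    have ne: "u + x \<noteq> v + x div 2" using room i by (simp add: x_def)
    have "drop_bit (Suc 0) x = x div 2" "and x (Suc 0) = x mod 2"
      using and_one_eq[of x] by (simp_all add: drop_bit_eq_div)
    then have s1: "mem s1 = (mem s')(u + x := popcount x, v + x := bitlen x)" "regs s1 22 = Suc x"
      "regs s1 23 = regs s' 23" "\<And>r. r < 20 \<Longrightarrow> regs s1 r = regs s' r"
      using r bd m ne pcx blx by (simp_all add: s1_def)
    have "mem s1 (u + y) = popcount y" if "y \<le> x" for y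
      using that I room i unfolding s1 x_def by (auto simp: le_Suc_eq)
    moreover have "mem s1 (v + y) = bitlen y" if "y \<le> x" for y
      using that I room i unfolding s1 x_def by (auto simp: le_Suc_eq)
    moreover have "mem s1 a = mem s a" if "a < u" for a
      using that I room unfolding s1 by auto
    ultimately have "?I (Suc i) s1" using s1 I by (auto simp: x_def)
    then show "test_val (Less 22 23) s' \<and> runs w (block ?B) s' 14 (?I (Suc i))"
      unfolding s1_def using I i by (intro conjI runs_block[where R = "?I (Suc i)"]) auto
  qed simp
  show ?thesis unfolding tables_prog_def
    by (rule runs_block_Seq[OF runs_mono[OF loop[unfolded s0_def]]]) (rule order_refl, auto)
qed

section \<open>Machine code for the column numberings\<close>

definition col0_prog :: prog where
  "col0_prog = Cond (Less 24 5) (block [Binop Add 24 24 3, Binop Sub 24 11 24])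
     (block [Binop Div 30 24 5, Binop Add 30 30 8, Load 30 30, Binop Add 30 30 5, Binop Sub 24 11 30])"

lemma col0_prog:
  assumes "tables_ready w b Y s" "regs s 11 = C" "C = b + bitlen Y + 1" "C < 2 ^ w"
    "regs s 24 = a" "a div b \<le> Y"
  shows "runs w col0_prog s 10 (\<lambda>s'. regs s' 24 = col0 b C a \<and> mem s' = mem s \<and>
     (\<forall>r<30. r \<noteq> 24 \<longrightarrow> regs s' r = regs s r))"
  unfolding col0_prog_def
proof (rule runs_Cond[where T = 6])
  have r: "regs s 3 = 1" "regs s 5 = b" and
    bl: "mem s (regs s 8 + a div b) = bitlen (a div b)" "regs s 8 + Y < 2 ^ w"
    using assms unfolding tables_ready_def by auto
  {
    assume "test_val (Less 24 5) s"
    then have ab: "a < b" using r assms by simp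
    then have "Suc a < 2 ^ w" "(C + 2 ^ w - Suc a) mod 2 ^ w = C - Suc a"
      using assms sub_word[of "Suc a" C w] by auto
    then show "runs w (block [Binop Add 24 24 3, Binop Sub 24 11 24]) s 6 (\<lambda>s'. regs s' 24 = col0 b C a \<and>
      mem s' = mem s \<and> (\<forall>r<30. r \<noteq> 24 \<longrightarrow> regs s' r = regs s r))"
      using r assms(2,5) ab by (intro runs_block) (simp_all add: col0_def)
  }
  {
    assume "\<not> test_val (Less 24 5) s"
    then have ab: "\<not> a < b" using r assms by simp
    have le: "bitlen (a div b) \<le> bitlen Y" using assms(6) by (rule bitlen_mono)
    then have "bitlen (a div b) + b < 2 ^ w" "(C + 2 ^ w - (bitlen (a div b) + b)) mod 2 ^ w = C - (b + bitlen (a div b))"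
      using assms(3,4) sub_word[of "bitlen (a div b) + b" C w] by (auto simp: add.commute)
    moreover have "a div b + regs s 8 < 2 ^ w" using bl assms(6) by linarith
    ultimately show "runs w (block [Binop Div 30 24 5, Binop Add 30 30 8, Load 30 30, Binop Add 30 30 5, Binop Sub 24 11 30])
      s 6 (\<lambda>s'. regs s' 24 = col0 b C a \<and> mem s' = mem s \<and> (\<forall>r<30. r \<noteq> 24 \<longrightarrow> regs s' r = regs s r))"
      using r assms(2,5) ab bl(1) by (intro runs_block) (simp_all add: col0_def add.commute[of "a div b"])
  }
qed simp

definition colt_prog :: prog where
  "colt_prog = block [Binop Add 30 12 12] ;;
     Cond (Less 24 30) (block [Binop Add 24 24 3, Binop Sub 24 30 24]) (block [Const 24 0])"

text \<open>\<open>Sub\<close> wraps around where subtraction on \<open>nat\<close> truncates, so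
  the test supplies the value 0 explicitly. The other numberings never subtract below 0.\<close>

lemma colt_prog:
  assumes "regs s 3 = 1" "regs s 12 = t" "2 * t < 2 ^ w" "regs s 24 = a"
  shows "runs w colt_prog s 10 (\<lambda>s'. regs s' 24 = colt t a \<and> mem s' = mem s \<and>
     (\<forall>r<30. r \<noteq> 24 \<longrightarrow> regs s' r = regs s r))"
  unfolding colt_prog_def
proof (rule runs_block_Seq, rule runs_Cond[where T = 3])
  define s0 where "s0 = fold (instr_val w) [Binop Add 30 12 12] s"
  have s0: "regs s0 30 = 2 * t" "mem s0 = mem s" "\<And>r. r < 30 \<Longrightarrow> regs s0 r = regs s r"
    using assms by (simp_all add: s0_def mult_2)
  {
    assume "test_val (Less 24 30) (fold (instr_val w) [Binop Add 30 12 12] s)"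
    then have "test_val (Less 24 30) s0" unfolding s0_def .
    then have at: "a < 2 * t" using s0 assms(4) by simp
    then have "Suc a < 2 ^ w" "(2 * t + 2 ^ w - Suc a) mod 2 ^ w = 2 * t - Suc a"
      using assms sub_word[of "Suc a" "2 * t" w] by auto
    then show "runs w (block [Binop Add 24 24 3, Binop Sub 24 30 24]) (fold (instr_val w) [Binop Add 30 12 12] s) 3
       (\<lambda>s'. regs s' 24 = colt t a \<and> mem s' = mem s \<and> (\<forall>r<30. r \<noteq> 24 \<longrightarrow> regs s' r = regs s r))"
      unfolding s0_def[symmetric] using s0 assms(1,4) by (intro runs_block) (simp_all add: colt_def)
  }
  {
    assume "\<not> test_val (Less 24 30) (fold (instr_val w) [Binop Add 30 12 12] s)"
    then have "\<not> test_val (Less 24 30) s0" unfolding s0_def .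
    then have "\<not> a < 2 * t" using s0 assms(4) by simp
    then show "runs w (block [Const 24 0]) (fold (instr_val w) [Binop Add 30 12 12] s) 3
       (\<lambda>s'. regs s' 24 = colt t a \<and> mem s' = mem s \<and> (\<forall>r<30. r \<noteq> 24 \<longrightarrow> regs s' r = regs s r))"
      unfolding s0_def[symmetric] using s0 by (intro runs_block) (simp_all add: colt_def)
  }
qed auto

definition colh_prog :: prog where
  "colh_prog = block [Binop Div 24 24 5, Binop Add 30 6 3, Binop Sub 24 30 24]"

lemma colh_prog:
  assumes "regs s 3 = 1" "regs s 5 = b" "regs s 6 = Y" "Y + 1 < 2 ^ w" "regs s 24 = a" "a div b \<le> Y"
  shows "runs w colh_prog s 10 (\<lambda>s'. regs s' 24 = colh b Y a \<and> mem s' = mem s \<and>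
     (\<forall>r<30. r \<noteq> 24 \<longrightarrow> regs s' r = regs s r))"
  unfolding colh_prog_def
  by (rule runs_block) (use assms sub_word[of "a div b" "Y + 1" w] in \<open>auto simp: colh_def\<close>)

definition coll_prog :: prog where
  "coll_prog = block [Binop Mod 24 24 5, Binop Add 24 24 3, Binop Sub 24 5 24]"

lemma coll_prog:
  assumes "regs s 3 = 1" "regs s 5 = b" "0 < b" "b < 2 ^ w" "regs s 24 = a"
  shows "runs w coll_prog s 10 (\<lambda>s'. regs s' 24 = coll b a \<and> mem s' = mem s \<and>
     (\<forall>r<30. r \<noteq> 24 \<longrightarrow> regs s' r = regs s r))"
proof -
  have "a mod b < b" using assms by simp
  then have "Suc (a mod b) < 2 ^ w" "(b + 2 ^ w - Suc (a mod b)) mod 2 ^ w = b - Suc (a mod b)"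
    using assms sub_word[of "Suc (a mod b)" b w] by linarith+
  then show ?thesis unfolding coll_prog_def
    using assms by (intro runs_block) (simp_all add: coll_def)
qed

section \<open>Building the tables of all scales\<close>

definition tails :: "nat \<Rightarrow> nat list \<Rightarrow> nat \<Rightarrow> nat list" where
  "tails b xs i = (case i of 0 \<Rightarrow> xs | Suc k \<Rightarrow> filter (\<lambda>a. b * 2 ^ k \<le> a) xs)"

lemma tails_0 [simp]: "tails b xs 0 = xs"
  and tails_Suc [simp]: "tails b xs (Suc k) = filter (\<lambda>a. b * 2 ^ k \<le> a) xs"
  by (simp_all add: tails_def)

text \<open>Thresholds increase, so filtering the previous subsequence gives the same as filtering
  the whole array; its cost is charged to the shorter sequence.\<close>

lemma filter_tails: "filter (\<lambda>a. b * 2 ^ i \<le> a) (tails b xs i) = tails b xs (Suc i)"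
proof (cases i)
  case (Suc k)
  have "b * 2 ^ k \<le> b * 2 ^ i" using Suc by simp
  from filter_filter_ge[OF this, of xs] show ?thesis using Suc by (simp del: filter_filter)
qed simp

text \<open>Measured in cells of two words. The two additional rows are the trailing, possibly empty
  block and the row of counts written past the end.\<close>

definition level_size :: "nat \<Rightarrow> nat list \<Rightarrow> nat \<Rightarrow> nat" where
  "level_size b xs i = (length (tails b xs (Suc i)) div b + 2) * (b * 2 ^ i)"

definition level_start :: "nat \<Rightarrow> nat \<Rightarrow> nat list \<Rightarrow> nat \<Rightarrow> nat" where
  "level_start f b xs i = f + 2 * (\<Sum>k<i. level_size b xs k)"

lemma level_start_Suc [simp]: "level_start f b xs (Suc i) = level_start f b xs i + 2 * level_size b xs i"
  by (simp add: level_start_def)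

lemma level_start_0 [simp]: "level_start f b xs 0 = f"
  by (simp add: level_start_def)

lemma level_start_mono: "i \<le> j \<Longrightarrow> level_start f b xs i \<le> level_start f b xs j"
  by (induction rule: dec_induct) auto

lemma rank_table_cong:
  assumes "rank_table \<mu> base b C ys"
    and "\<And>a. base \<le> a \<Longrightarrow> a < base + 2 * ((length ys div b + 1) * C) \<Longrightarrow> \<mu>' a = \<mu> a"
  shows "rank_table \<mu>' base b C ys"
proof -
  have "\<mu>' (base + 2 * e) = \<mu> (base + 2 * e)" "\<mu>' (base + 2 * e + 1) = \<mu> (base + 2 * e + 1)"
    if "e < (length ys div b + 1) * C" for e
    by (rule assms(2); use that in linarith)+
  with assms(1) show ?thesis unfolding rank_table_def by presburger
qed

text \<open>
  At the start of iteration \<open>i\<close> the current sequence is still the one of the previous scale; the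
  iteration first drops the entries below \<open>b 2\<^sup>i\<close>, in place.
\<close>

definition levels_prog :: prog where
  "levels_prog = While (Less 12 6)
     (filter_prog ;; block [Binop Add 20 9 13, Store 20 17, Copy 18 12] ;; build colt_prog ;;
      block [Binop Add 12 12 12, Binop Add 13 13 3])"

definition level_time :: "nat \<Rightarrow> nat list \<Rightarrow> nat \<Rightarrow> nat" where
  "level_time b xs i = 50 + 11 * length (tails b xs i) + 26 * length (tails b xs (Suc i)) + 32 * level_size b xs i"

definition level_table :: "(nat \<Rightarrow> nat) \<Rightarrow> nat \<Rightarrow> nat list \<Rightarrow> nat \<Rightarrow> nat \<Rightarrow> bool" where
  "level_table \<mu> b xs base i \<longleftrightarrow>
     rank_table \<mu> base b (b * 2 ^ i) (map (colt (b * 2 ^ i)) (tails b xs (Suc i)))"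

lemma level_table_cong:
  assumes "level_table \<mu> b xs base k" "\<And>a. base \<le> a \<Longrightarrow> a < base + 2 * level_size b xs k \<Longrightarrow> \<mu>' a = \<mu> a"
  shows "level_table \<mu>' b xs base k"
  unfolding level_table_def
proof (rule rank_table_cong[OF assms(1)[unfolded level_table_def]])
  fix a assume a: "base \<le> a"
    "a < base + 2 * ((length (map (colt (b * 2 ^ k)) (tails b xs (Suc k))) div b + 1) * (b * 2 ^ k))"
  have "(length (map (colt (b * 2 ^ k)) (tails b xs (Suc k))) div b + 1) * (b * 2 ^ k) \<le> level_size b xs k"
    unfolding level_size_def length_map by (rule mult_right_mono) auto
  with a show "\<mu>' a = \<mu> a" by (intro assms(2)) linarith+
qed

text \<open>Memory is framed only above \<open>length xs\<close>, since filtering overwrites the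
  array, and except for the addresses recorded so far in \<open>lb + 1..lb + i\<close>. The frame
  below \<open>f\<close> protects the word tables and the table of \<open>A\<close>.\<close>

definition level_inv :: "nat \<Rightarrow> nat list \<Rightarrow> nat \<Rightarrow> nat \<Rightarrow> ram_state \<Rightarrow> nat \<Rightarrow> ram_state \<Rightarrow> bool" where
  "level_inv b xs lb f s i s' \<longleftrightarrow>
     regs s' 12 = b * 2 ^ i \<and> regs s' 13 = Suc i \<and> regs s' 16 = length (tails b xs i) \<and>
     regs s' 17 = level_start f b xs i \<and>
     (\<forall>r<20. r \<notin> {12, 13, 16, 17, 18} \<longrightarrow> regs s' r = regs s r) \<and>
     (\<forall>j<length (tails b xs i). mem s' (Suc j) = tails b xs i ! j) \<and>
     (\<forall>a. length xs < a \<longrightarrow> a < f \<longrightarrow> a \<notin> {lb + 1..lb + i} \<longrightarrow> mem s' a = mem s a) \<and>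
     (\<forall>k<i. mem s' (lb + Suc k) = level_start f b xs k \<and> level_table (mem s') b xs (level_start f b xs k) k)"

text \<open>The first assumptions say that \<open>n\<close> is the number of iterations of a loop
  that doubles the threshold until it reaches \<open>Y\<close>. The running time stays a sum here;
  \<open>level_time_sum\<close> makes it linear.\<close>

lemma levels_prog:
  assumes n: "\<And>i. i < n \<Longrightarrow> b * 2 ^ i < Y" "Y \<le> b * 2 ^ n"
    and regs: "regs s 3 = 1" "regs s 5 = b" "regs s 6 = Y" "regs s 9 = lb" "regs s 12 = b" "regs s 13 = 1"
      "regs s 16 = length xs" "regs s 17 = f"
    and b: "0 < b" "b < w"
    and room: "level_start f b xs n < 2 ^ w" "2 * Y < 2 ^ w" "length xs < lb" "lb + n < f" "lb + n + 1 < 2 ^ w"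
    and input: "\<And>i. i < length xs \<Longrightarrow> mem s (Suc i) = xs ! i"
    and pc: "\<And>x. x < 2 ^ b \<Longrightarrow> mem s (regs s 7 + x) = popcount x" "regs s 7 + 2 ^ b \<le> lb" "length xs < regs s 7"
  shows "runs w levels_prog s (1 + (\<Sum>i<n. Suc (level_time b xs i))) (level_inv b xs lb f s n)"
  unfolding levels_prog_def
proof (rule runs_While[where I = "level_inv b xs lb f s" and n = n and T = "level_time b xs"])
  show "level_inv b xs lb f s 0 s" using regs input by (simp add: level_inv_def)
  show "\<not> test_val (Less 12 6) s'" if "level_inv b xs lb f s n s'" for s'
    using that n(2) regs by (simp add: level_inv_def)
  fix i and s' :: ram_state assume i: "i < n" and I: "level_inv b xs lb f s i s'"
  define t where "t = b * 2 ^ i"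
  define ys where "ys = tails b xs (Suc i)"
  define fr where "fr = level_start f b xs i"
  have tY: "t < Y" using n(1)[OF i] by (simp add: t_def)
  have t0: "0 < t" using b by (simp add: t_def)
  have len: "length (tails b xs i) \<le> length xs" by (cases i) (auto simp: tails_def)
  have len': "length ys \<le> length xs" by (simp add: ys_def)
  have fr: "f \<le> fr" using level_start_mono[of 0 i f b xs] by (simp add: fr_def)
  have fr': "fr + 2 * level_size b xs i < 2 ^ w"
    using level_start_mono[of "Suc i" n f b xs] i room(1) by (simp add: fr_def)
  have size: "level_size b xs i = (length ys div b + 2) * t" by (simp add: level_size_def ys_def t_def)
  have r: "regs s' 12 = t" "regs s' 13 = Suc i" "regs s' 16 = length (tails b xs i)" "regs s' 17 = fr"
    and r': "\<And>r. r < 20 \<Longrightarrow> r \<notin> {12, 13, 16, 17, 18} \<Longrightarrow> regs s' r = regs s r"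
    and m: "\<And>j. j < length (tails b xs i) \<Longrightarrow> mem s' (Suc j) = tails b xs i ! j"
      "\<And>a. length xs < a \<Longrightarrow> a < f \<Longrightarrow> a \<notin> {lb + 1..lb + i} \<Longrightarrow> mem s' a = mem s a"
      "\<And>k. k < i \<Longrightarrow> mem s' (lb + Suc k) = level_start f b xs k"
      "\<And>k. k < i \<Longrightarrow> level_table (mem s') b xs (level_start f b xs k) k"
    using I unfolding level_inv_def t_def fr_def by blast+
  have test: "test_val (Less 12 6) s'" using r r'[of 6] regs tY by simp
  define R1 where "R1 = (\<lambda>s1 :: ram_state. (\<forall>r<20. r \<noteq> 16 \<longrightarrow> regs s1 r = regs s' r) \<and> regs s1 16 = length ys \<and>
     (\<forall>j<length ys. mem s1 (Suc j) = ys ! j) \<and> (\<forall>a>length xs. mem s1 a = mem s' a))"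
  have 1: "runs w filter_prog s' (10 + 11 * length (tails b xs i)) R1"
  proof (rule runs_mono[OF filter_prog[where t = t and xs = "tails b xs i"]])
    show "length (tails b xs i) < 2 ^ w" using len room by linarith
    show "R1 s1" if "let ys = filter (\<lambda>a. t \<le> a) (tails b xs i) in
     (\<forall>r<20. r \<noteq> 16 \<longrightarrow> regs s1 r = regs s' r) \<and> regs s1 16 = length ys \<and>
     (\<forall>i<length ys. mem s1 (Suc i) = ys ! i) \<and> (\<forall>a>length (tails b xs i). mem s1 a = mem s' a)" for s1
      using that len unfolding t_def filter_tails ys_def[symmetric] Let_def R1_def by auto
  qed (use r r'[of 3] regs m in auto)
  define st2 where "st2 = fold (instr_val w) [Binop Add 20 9 13, Store 20 17, Copy 18 12]"
  define R3 where "R3 = (\<lambda>s3 :: ram_state. regs s3 17 = level_start f b xs (Suc i) \<and>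
     (\<forall>r<17. r \<noteq> 16 \<longrightarrow> regs s3 r = regs s' r) \<and> regs s3 19 = regs s' 19 \<and>
     regs s3 16 = length ys \<and>
     (\<forall>j<length ys. mem s3 (Suc j) = ys ! j) \<and>
     (\<forall>a. length xs < a \<longrightarrow> a < fr \<longrightarrow> a \<noteq> lb + Suc i \<longrightarrow> mem s3 a = mem s' a) \<and>
     mem s3 (lb + Suc i) = fr \<and> level_table (mem s3) b xs fr i)"
  have 3: "runs w (build colt_prog) (st2 s1) (30 + length ys * 26 + 32 * level_size b xs i) R3"
    if R1: "R1 s1" for s1
  proof -
    have s1: "\<And>r. r < 20 \<Longrightarrow> r \<noteq> 16 \<Longrightarrow> regs s1 r = regs s' r" "regs s1 16 = length ys"
      "\<And>j. j < length ys \<Longrightarrow> mem s1 (Suc j) = ys ! j" "\<And>a. length xs < a \<Longrightarrow> mem s1 a = mem s' a"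
      using R1 unfolding R1_def by auto
    define s2 where "s2 = st2 s1"
    have bd: "lb + Suc i < 2 ^ w" using room(5) i by linarith
    have s2: "mem s2 = (mem s1)(lb + Suc i := fr)" "regs s2 18 = t"
      "\<And>r. r < 18 \<Longrightarrow> regs s2 r = regs s1 r" "regs s2 19 = regs s' 19"
      using s1(1)[of 9] s1(1)[of 13] s1(1)[of 12] s1(1)[of 17] s1(1)[of 19] r r'[of 9] regs bd
      by (simp_all add: s2_def st2_def)
    have rr: "regs s2 r = regs s r" if "r < 12" for r
      using s2(3)[of r] s1(1)[of r] r'[of r] that by auto
    have rr12: "regs s2 12 = t" "regs s2 17 = fr" using s2(3) s1(1) r by simp_all
    have lbi: "lb + Suc i < fr" using fr room(4) i by linarith
    show ?thesis unfolding s2_def[symmetric]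
    proof (rule runs_mono[OF build[where b = b and xs = ys and fr = fr and C = t and Tc = 10 and f = "colt t"]])
      show "regs s2 3 = 1" "regs s2 5 = b" "regs s2 16 = length ys" "regs s2 17 = fr" "regs s2 18 = t"
        using rr[of 3] rr[of 5] s2(2,3) s1(2) rr12 regs by simp_all
      show "fr + 2 * ((length ys div b + 2) * t) < 2 ^ w" using fr' size by simp
      show "length ys < fr" using len' room fr by linarith
      show "mem s2 (Suc j) = ys ! j" if "j < length ys" for j
        using that len' room s1(3) unfolding s2 by simp
      show "regs s2 7 + 2 ^ b \<le> fr" using rr[of 7] pc(2) fr room(4) by simp
      show "mem s2 (regs s2 7 + x) = popcount x" if "x < 2 ^ b" for x
      proof -
        have *: "regs s 7 + x < lb" "length xs < regs s 7 + x" using that pc(2,3) by linarith+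
        then have "mem s2 (regs s 7 + x) = mem s (regs s 7 + x)"
          unfolding s2 using s1(4)[of "regs s 7 + x"] m(2)[of "regs s 7 + x"] room(4) by auto
        then show ?thesis using rr[of 7] pc(1)[OF that] by simp
      qed
      show "runs w colt_prog st 10 (\<lambda>s''. regs s'' 24 = colt t (ys ! j) \<and> mem s'' = mem st \<and>
         (\<forall>r<30. r \<noteq> 24 \<longrightarrow> regs s'' r = regs st r))"
        if "j < length ys" "\<forall>r<20. regs st r = regs s2 r" "\<forall>a<fr. mem st a = mem s2 a" "regs st 24 = ys ! j" for st j
        by (rule colt_prog) (use that rr[of 3] rr12 regs tY room(2) in auto)
      \<comment> \<open>Entries of this scale are at least \<open>t\<close>, so the \<open>t\<close>
        columns for thresholds from \<open>t\<close> to \<open>2 * t - 1\<close> suffice.\<close>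
      show "colt t (ys ! j) < t" if "j < length ys" for j
      proof -
        have "ys ! j \<in> set ys" using that by simp
        then have "t \<le> ys ! j" unfolding ys_def t_def by simp
        then show ?thesis using t0 unfolding colt_def by linarith
      qed
      show "30 + length ys * (10 + 16) + 32 * ((length ys div b + 2) * t)
          \<le> 30 + length ys * 26 + 32 * level_size b xs i" by (simp add: size)
      show "R3 s3" if s3: "regs s3 17 = fr + 2 * ((length ys div b + 2) * t) \<and>
       (\<forall>r<20. r \<noteq> 17 \<longrightarrow> regs s3 r = regs s2 r) \<and>
       (\<forall>a. a < fr \<or> fr + 2 * ((length ys div b + 2) * t) \<le> a \<longrightarrow> mem s3 a = mem s2 a) \<and>
       rank_table (mem s3) fr b t (map (colt t) ys)" for s3
        unfolding R3_def
      proof (intro conjI allI impI)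
        show "regs s3 17 = level_start f b xs (Suc i)" using s3 by (simp add: fr_def size[unfolded fr_def])
        show "regs s3 r = regs s' r" if "r < 17" "r \<noteq> 16" for r using that s3 s2(3) s1(1) by simp
        show "regs s3 19 = regs s' 19" using s3 s2(4) by simp
        show "regs s3 16 = length ys" using s3 s2(3) s1(2) by simp
        show "mem s3 (Suc j) = ys ! j" if "j < length ys" for j
          using that s3 len' room(3) fr room(4) s1(3) unfolding s2 by simp
        show "mem s3 a = mem s' a" if "length xs < a" "a < fr" "a \<noteq> lb + Suc i" for a
          using that s3 s1(4) unfolding s2 by simp
        show "mem s3 (lb + Suc i) = fr" using s3 lbi unfolding s2 by simp
        show "level_table (mem s3) b xs fr i" using s3 by (simp add: level_table_def ys_def[symmetric] t_def[symmetric] del: tails_Suc)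
      qed
    qed (use b t0 in auto)
  qed
  have 4: "runs w (block [Binop Add 12 12 12, Binop Add 13 13 3]) s3 3 (level_inv b xs lb f s (Suc i))"
    if R3: "R3 s3" for s3
  proof (rule runs_block)
    define s4 where "s4 = fold (instr_val w) [Binop Add 12 12 12, Binop Add 13 13 3] s3"
    have s3: "regs s3 17 = level_start f b xs (Suc i)" "\<And>r. r < 17 \<Longrightarrow> r \<noteq> 16 \<Longrightarrow> regs s3 r = regs s' r"
      "regs s3 19 = regs s' 19"
      "regs s3 16 = length ys" "\<And>j. j < length ys \<Longrightarrow> mem s3 (Suc j) = ys ! j"
      "\<And>a. length xs < a \<Longrightarrow> a < fr \<Longrightarrow> a \<noteq> lb + Suc i \<Longrightarrow> mem s3 a = mem s' a"
      "mem s3 (lb + Suc i) = fr" "level_table (mem s3) b xs fr i"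
      using R3 unfolding R3_def by auto
    have bd: "t + t < 2 ^ w" "Suc (Suc i) < 2 ^ w" using tY room i by linarith+
    have s4: "regs s4 12 = t + t" "regs s4 13 = Suc (Suc i)" "mem s4 = mem s3"
      "\<And>r. r < 20 \<Longrightarrow> r \<noteq> 12 \<Longrightarrow> r \<noteq> 13 \<Longrightarrow> regs s4 r = regs s3 r"
      using bd s3(2)[of 12] s3(2)[of 13] s3(2)[of 3] r r'[of 3] regs by (simp_all add: s4_def)
    have tab: "mem s4 (lb + Suc k) = level_start f b xs k \<and> level_table (mem s4) b xs (level_start f b xs k) k"
      if "k < Suc i" for k
    proof (cases "k = i")
      case True
      then show ?thesis using s3 s4 by (simp add: fr_def)
    next
      case False
      then have k: "k < i" using that by simp
      have "lb + Suc k < fr" using k i fr room(4) by linarith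
      then have e: "mem s3 (lb + Suc k) = mem s' (lb + Suc k)" using s3(6)[of "lb + Suc k"] k room(3) by simp
      have "level_table (mem s3) b xs (level_start f b xs k) k"
      proof (rule level_table_cong[OF m(4)[OF k]])
        fix a assume a: "level_start f b xs k \<le> a" "a < level_start f b xs k + 2 * level_size b xs k"
        have "a < level_start f b xs (Suc k)" using a(2) by simp
        also have "\<dots> \<le> fr" unfolding fr_def using k by (intro level_start_mono) simp
        finally have "a < fr" .
        moreover have "f \<le> a" using a(1) level_start_mono[of 0 k f b xs] by simp
        ultimately show "mem s3 a = mem s' a" using s3(6)[of a] room(3,4) i by simp
      qed
      then show ?thesis using m(3)[OF k] e s4 by simp
    qed
    have keep: "mem s4 a = mem s a" if "length xs < a" "a < f" "a \<notin> {lb + 1..lb + Suc i}" for a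
      using that m(2)[of a] s3(6)[of a] s4 fr by auto
    have rr: "regs s4 r = regs s r" if "r < 20" "r \<notin> {12, 13, 16, 17, 18}" for r
    proof (cases "r = 19")
      case True
      then show ?thesis using s4(4)[of 19] s3(3) r'[of 19] by simp
    next
      case False
      then have "r < 17" using that by auto
      then show ?thesis using that s4(4)[of r] s3(2)[of r] r'[of r] by auto
    qed
    show "level_inv b xs lb f s (Suc i) (fold (instr_val w) [Binop Add 12 12 12, Binop Add 13 13 3] s3)"
      unfolding s4_def[symmetric] level_inv_def
    proof (intro conjI)
      show "regs s4 12 = b * 2 ^ Suc i" using s4 by (simp add: t_def)
      show "regs s4 16 = length (tails b xs (Suc i))" using s4 s3 by (simp add: ys_def)
      show "regs s4 17 = level_start f b xs (Suc i)" using s4 s3 by (simp del: level_start_Suc)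
      show "\<forall>j<length (tails b xs (Suc i)). mem s4 (Suc j) = tails b xs (Suc i) ! j"
        using s3(5) s4(3) unfolding ys_def by simp
    qed (use s4 rr keep tab in blast)+
  qed simp
  have "runs w (filter_prog ;; block [Binop Add 20 9 13, Store 20 17, Copy 18 12] ;; build colt_prog ;;
      block [Binop Add 12 12 12, Binop Add 13 13 3]) s' (level_time b xs i) (level_inv b xs lb f s (Suc i))"
    by (rule runs_Seq[OF 1], rule runs_block_Seq, fold st2_def, erule runs_Seq[OF 3], erule 4, rule order_refl, rule lessI)
      (simp add: level_time_def ys_def)
  with test show "test_val (Less 12 6) s' \<and> runs w (filter_prog ;; block [Binop Add 20 9 13, Store 20 17, Copy 18 12] ;;
      build colt_prog ;; block [Binop Add 12 12 12, Binop Add 13 13 3]) s' (level_time b xs i) (level_inv b xs lb f s (Suc i))" ..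
qed simp

section \<open>Linear bounds on the size and time of all scales\<close>

lemma sum_double_powers_le: "(\<Sum>k<i. b * 2 ^ k) \<le> (b * 2 ^ i :: nat)"
  by (induction i) auto

text \<open>The nonzero terms double up to a last one that is at most \<open>a\<close>, so their sum
  is at most twice this term.\<close>

lemma sum_powers_le:
  "(\<Sum>k<i. if b * 2 ^ k \<le> a then b * 2 ^ k else 0) \<le> 2 * (a::nat)"
proof (induction i)
  case (Suc i)
  show ?case
  proof (cases "b * 2 ^ i \<le> a")
    case True
    have "(\<Sum>k<Suc i. if b * 2 ^ k \<le> a then b * 2 ^ k else 0) \<le> (\<Sum>k<Suc i. b * 2 ^ k)"
      by (rule sum_mono) simp
    also have "\<dots> \<le> b * 2 ^ Suc i" by (rule sum_double_powers_le)
    also have "\<dots> \<le> 2 * a" using True by simp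
    finally show ?thesis .
  qed (use Suc in simp)
qed simp

text \<open>Summation is exchanged: each entry pays \<open>b * 2 ^ k\<close> for every scale that it
  reaches, at most twice its own value by \<open>sum_powers_le\<close>.\<close>

lemma sum_tails_le: "(\<Sum>k<i. length (tails b xs (Suc k)) * (b * 2 ^ k)) \<le> 2 * sum_list xs"
proof (induction xs)
  case (Cons a xs)
  have "(\<Sum>k<i. length (tails b (a # xs) (Suc k)) * (b * 2 ^ k)) =
    (\<Sum>k<i. length (tails b xs (Suc k)) * (b * 2 ^ k)) + (\<Sum>k<i. if b * 2 ^ k \<le> a then b * 2 ^ k else 0)"
    by (simp add: sum.distrib[symmetric] algebra_simps if_distrib cong: if_cong)
       (intro sum.cong, auto)
  then show ?case using Cons sum_powers_le[of b a i] by simp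
qed simp

text \<open>Dividing \<open>sum_tails_le\<close> by \<open>b\<close> turns \<open>2 Y b\<close> into
  \<open>2 * Y\<close>. The two additional rows per scale cost \<open>2 * b * 2 ^ i\<close> cells,
  in total at most \<open>4 * Y\<close> since the last scale is below \<open>Y\<close>.\<close>

lemma level_sums:
  assumes b: "0 < b" and S: "sum_list xs \<le> Y * b" and n: "0 < n \<Longrightarrow> b * 2 ^ n \<le> 2 * Y"
  shows "(\<Sum>i<n. length (tails b xs (Suc i))) \<le> 2 * Y" "(\<Sum>i<n. level_size b xs i) \<le> 6 * Y"
proof -
  have "b * (\<Sum>i<n. length (tails b xs (Suc i)) * 2 ^ i) = (\<Sum>i<n. length (tails b xs (Suc i)) * (b * 2 ^ i))"
    by (simp add: sum_distrib_left ac_simps)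
  also have "\<dots> \<le> 2 * sum_list xs" by (rule sum_tails_le)
  also have "\<dots> \<le> b * (2 * Y)" using S by (simp add: mult.commute)
  finally have A: "(\<Sum>i<n. length (tails b xs (Suc i)) * 2 ^ i) \<le> 2 * Y" using b by simp
  show "(\<Sum>i<n. length (tails b xs (Suc i))) \<le> 2 * Y"
    by (rule order_trans[OF sum_mono A]) simp
  \<comment> \<open>The division by the block length cancels the factor \<open>b\<close> in the
    number of columns.\<close>
  have "level_size b xs i \<le> length (tails b xs (Suc i)) * 2 ^ i + 2 * (b * 2 ^ i)" for i
  proof -
    have "length (tails b xs (Suc i)) div b * b * 2 ^ i \<le> length (tails b xs (Suc i)) * 2 ^ i"
      by (intro mult_right_mono) auto
    then show ?thesis unfolding level_size_def by (simp add: add_mult_distrib mult.assoc)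
  qed
  then have "(\<Sum>i<n. level_size b xs i) \<le> (\<Sum>i<n. length (tails b xs (Suc i)) * 2 ^ i + 2 * (b * 2 ^ i))"
    by (intro sum_mono)
  also have "\<dots> = (\<Sum>i<n. length (tails b xs (Suc i)) * 2 ^ i) + 2 * (\<Sum>i<n. b * 2 ^ i)"
    by (simp add: sum.distrib sum_distrib_left)
  finally have B: "(\<Sum>i<n. level_size b xs i) \<le> 2 * Y + 2 * (\<Sum>i<n. b * 2 ^ i)" using A by linarith
  show "(\<Sum>i<n. level_size b xs i) \<le> 6 * Y"
  proof (cases "n = 0")
    case False
    then show ?thesis using B n sum_double_powers_le[of b n] by linarith
  qed simp
qed

text \<open>The constant rounds up \<open>51 + 11 * (1 + 2) + 26 * 2 + 32 * 6\<close>; the sequences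
  filtered are the array once and then those of the scales.\<close>

lemma level_time_sum:
  assumes "0 < b" "sum_list xs \<le> Y * b" "0 < n \<Longrightarrow> b * 2 ^ n \<le> 2 * Y" "n \<le> Y" "length xs \<le> Y"
  shows "(\<Sum>i<n. Suc (level_time b xs i)) \<le> 330 * Y"
proof -
  have "(\<Sum>i<n. Suc (level_time b xs i)) = 51 * n + 11 * (\<Sum>i<n. length (tails b xs i))
     + 26 * (\<Sum>i<n. length (tails b xs (Suc i))) + 32 * (\<Sum>i<n. level_size b xs i)"
    unfolding level_time_def by (simp add: sum.distrib sum_distrib_left del: tails_Suc)
  moreover have "(\<Sum>i<n. length (tails b xs i)) \<le> length xs + (\<Sum>i<n. length (tails b xs (Suc i)))"
  proof (cases n)
    case (Suc k)
    have "(\<Sum>i<Suc k. length (tails b xs i)) = length (tails b xs 0) + (\<Sum>i<k. length (tails b xs (Suc i)))"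
      by (rule sum.lessThan_Suc_shift)
    then show ?thesis unfolding Suc by simp
  qed simp
  ultimately show ?thesis using level_sums[OF assms(1-3)] assms(4,5) by linarith
qed

section \<open>The complete preprocessing for large \<open>m\<close>\<close>

definition large_prep :: "nat \<Rightarrow> prog" where
  "large_prep D =
     block [Const 4 1, Const 6 D, Binop Mul 6 6 0, Binop Add 7 0 3, Binop Add 8 7 6, Binop Add 8 8 3,
       Binop Add 9 8 6, Binop Add 9 9 3, Binop Add 17 9 6, Binop Add 17 17 3] ;;
     tables_prog ;;
     block [Binop Add 20 8 0, Load 5 20, Binop Sub 5 5 3, Binop Add 20 8 6, Load 11 20, Binop Add 11 11 5,
       Binop Add 11 11 3, Copy 18 11, Copy 16 1, Copy 10 17] ;;
     build col0_prog ;;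
     block [Copy 12 5, Const 13 1] ;;
     levels_prog ;;
     filter_prog ;;
     block [Copy 14 17, Binop Add 18 6 3, Binop Add 18 18 3] ;;
     build colh_prog ;;
     block [Copy 15 17, Copy 18 5] ;;
     build coll_prog"

text \<open>Both constants are generous. The estimates below put the end of the last table at no
  more than \<open>68 * Y\<close>; 128 is a power of two above this.\<close>

lemma large_prep:
  assumes regs: "regs s 0 = m" "regs s 1 = length xs" "regs s 3 = 1"
    and input: "\<And>i. i < length xs \<Longrightarrow> mem s (Suc i) = xs ! i"
    and len: "length xs \<le> m" and D: "0 < D" "Y = D * m" and room: "128 * Y \<le> 2 ^ w"
    and b: "bitlen m = b + 1" "0 < b" "b < w" "bitlen Y \<le> 2 * b"
    and S: "sum_list xs \<le> Y * b"
  shows "runs w (large_prep D) s (2000 * Y) (ready w b Y xs)"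
proof -
  have mY: "m \<le> Y" using D by (cases D) auto
  have pow_b: "2 ^ b \<le> m" using b(1) bitlen_gt_iff[of b m] by simp
  have bm: "b < m" using pow_b less_exp[of b] by linarith
  have DY: "D \<le> Y" using D bm by (cases m) auto
  have w1: "0 < w" using b by simp
  \<comment> \<open>Memory layout above the array: population counts at \<open>u\<close>, bit
    lengths at \<open>v\<close> and addresses of the scale tables at \<open>lb\<close>, with
    \<open>Y + 1\<close> cells each, then the rank tables from \<open>f0\<close> on.\<close>
  define u where "u = m + 1"
  define v where "v = m + Y + 2"
  define lb where "lb = m + 2 * Y + 3"
  define f0 where "f0 = m + 3 * Y + 4"
  note addr = u_def v_def lb_def f0_def
  define C where "C = b + bitlen Y + 1"
  define G0 where "G0 = (length xs div b + 2) * C"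
  define f where "f = f0 + 2 * G0"
  \<comment> \<open>The number of scales. Minimality gives \<open>t < 2 Y\<close> up to the trivial
    case \<open>n = 0\<close>, the choice itself \<open>Y \<le> t\<close>.\<close>
  define n where "n = (LEAST n. Y \<le> b * 2 ^ n)"
  define t where "t = b * 2 ^ n"
  define ys where "ys = tails b xs (Suc n)"
  define fn where "fn = level_start f b xs n"
  define Gh where "Gh = (length ys div b + 2) * (Y + 2)"
  define fm where "fm = fn + 2 * Gh"
  define Gl where "Gl = (length ys div b + 2) * b"

  have n_ex: "Y \<le> b * 2 ^ Y"
    using mult_le_mono[of 1 b Y "2 ^ Y"] less_exp[of Y] b by simp
  have n: "Y \<le> t" unfolding t_def n_def by (rule LeastI[where P = "\<lambda>n. Y \<le> b * 2 ^ n", OF n_ex])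
  have n_min: "b * 2 ^ i < Y" if "i < n" for i
    using not_less_Least[of i "\<lambda>n. Y \<le> b * 2 ^ n"] that unfolding n_def by simp
  have nY: "n \<le> Y" unfolding n_def by (rule Least_le[of "\<lambda>n. Y \<le> b * 2 ^ n", OF n_ex])
  have t2: "0 < n \<Longrightarrow> b * 2 ^ n \<le> 2 * Y"
    using n_min[of "n - 1"] by (cases n) auto
  have tY: "t \<le> 2 * Y"
    using t2 bm mY unfolding t_def by (cases "n = 0") auto
  have nbl: "n \<le> bitlen Y"
  proof (cases n)
    case (Suc k)
    have "1 * 2 ^ k \<le> b * 2 ^ k" using b by (intro mult_right_mono) auto
    then have "2 ^ k \<le> Y" using n_min[of k] Suc by linarith
    then show ?thesis using bitlen_gt_iff[of k Y] Suc by simp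
  qed simp
  have digits: "a div b \<le> Y" if "a \<in> set xs" for a
  proof -
    have "a \<le> Y * b" using member_le_sum_list[OF that] S by linarith
    then have "a div b \<le> Y * b div b" by (rule div_le_mono)
    then show ?thesis using b by simp
  qed
  \<comment> \<open>Every remaining entry is at least \<open>t \<ge> Y\<close>, and all entries
    together sum to at most \<open>Y * b\<close>.\<close>
  have ys_len: "length ys \<le> b"
  proof -
    have "length ys * t \<le> sum_list xs" unfolding ys_def t_def by (induction xs) (auto split: if_splits)
    also note S
    also have "Y * b \<le> b * t" using mult_le_mono2[OF n, of b] by (simp only: mult.commute)
    finally have "length ys * t \<le> b * t" .
    moreover have "0 < t" using n mY bm by linarith
    ultimately show ?thesis by simp
  qed
  have C_le: "C \<le> 4 * b" using b unfolding C_def by linarith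
  \<comment> \<open>About \<open>m / b\<close> blocks times at most \<open>4 * b\<close> columns;
    \<open>b < m\<close> absorbs the two additional rows.\<close>
  have G0_le: "G0 \<le> 12 * m"
  proof -
    have "G0 \<le> (m div b + 2) * (4 * b)" unfolding G0_def using C_le len
      by (intro mult_le_mono add_le_mono div_le_mono) auto
    also have "\<dots> = 4 * (m div b * b) + 8 * b" by (simp add: algebra_simps)
    also have "\<dots> \<le> 12 * m" using bm div_times_less_eq_dividend[of m b] by linarith
    finally show ?thesis .
  qed
  have "length ys div b \<le> 1" using ys_len div_le_mono[OF ys_len, of b] b by simp
  then have Gh_le: "Gh \<le> 9 * Y" and Gl_le: "Gl \<le> 3 * Y"
  proof -
    assume "length ys div b \<le> 1"
    then have "length ys div b + 2 \<le> 3" by simp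
    then have "Gh \<le> 3 * (Y + 2)" "Gl \<le> 3 * b" unfolding Gh_def Gl_def by (rule mult_le_mono1)+
    then show "Gh \<le> 9 * Y" "Gl \<le> 3 * Y" using bm mY b(2) by simp_all
  qed
  have fn_le: "fn \<le> f + 12 * Y"
    using level_sums(2)[OF b(2) S t2] unfolding fn_def level_start_def by linarith
  have f_fn: "f \<le> fn" using level_start_mono[of 0 n f b xs] unfolding fn_def by simp
  have f_le: "f \<le> 32 * Y" using G0_le mY bm b unfolding f_def f0_def by linarith
  have end_le: "fm + 2 * Gl < 2 ^ w"
    using fn_le f_le Gh_le Gl_le room mY bm unfolding fm_def by linarith
  have fm_lt: "fm < 2 ^ w" "fn < 2 ^ w" "f < 2 ^ w" "f0 < 2 ^ w" "lb + n + 1 < 2 ^ w" "2 * t < 2 ^ w" "2 * Y < 2 ^ w"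
     "lb < 2 ^ w" "v < 2 ^ w" "u < 2 ^ w" "C < 2 ^ w" "D < 2 ^ w" "b < 2 ^ w" "Y + 2 < 2 ^ w" "bitlen Y + b < 2 ^ w"
     "length xs < 2 ^ w" "m < 2 ^ w"
    using end_le f_fn room mY nY tY bm C_le DY len b unfolding fm_def f_def addr by linarith+

  define s1 where "s1 = fold (instr_val w) [Const 4 1, Const 6 D, Binop Mul 6 6 0, Binop Add 7 0 3, Binop Add 8 7 6,
      Binop Add 8 8 3, Binop Add 9 8 6, Binop Add 9 9 3, Binop Add 17 9 6, Binop Add 17 17 3] s"
  have s1: "regs s1 0 = m" "regs s1 1 = length xs" "regs s1 3 = 1" "regs s1 4 = 1" "regs s1 6 = Y"
    "regs s1 7 = u" "regs s1 8 = v" "regs s1 9 = lb" "regs s1 17 = f0" "mem s1 = mem s"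
  proof -
    have a: "m + 1 < 2 ^ w" "m + 1 + Y < 2 ^ w" "m + 1 + Y + 1 < 2 ^ w" "m + 1 + Y + 1 + Y < 2 ^ w"
      "m + 1 + Y + 1 + Y + 1 < 2 ^ w" "m + 1 + Y + 1 + Y + 1 + Y < 2 ^ w" "m + 1 + Y + 1 + Y + 1 + Y + 1 < 2 ^ w"
      using fm_lt(4) unfolding f0_def by linarith+
    define s' where "s' = fold (instr_val w) [Const 4 1, Const 6 D, Binop Mul 6 6 0, Binop Add 7 0 3] s"
    have s': "regs s' 0 = m" "regs s' 1 = length xs" "regs s' 3 = 1" "regs s' 4 = 1" "regs s' 6 = Y"
      "regs s' 7 = u" "mem s' = mem s"
      using regs fm_lt(12) fm_lt(7) a w1 D by (simp_all add: s'_def u_def)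
    have "s1 = fold (instr_val w) [Binop Add 8 7 6, Binop Add 8 8 3, Binop Add 9 8 6, Binop Add 9 9 3,
      Binop Add 17 9 6, Binop Add 17 17 3] s'" unfolding s1_def s'_def by (simp del: instr_val.simps)
    then show "regs s1 0 = m" "regs s1 1 = length xs" "regs s1 3 = 1" "regs s1 4 = 1" "regs s1 6 = Y"
      "regs s1 7 = u" "regs s1 8 = v" "regs s1 9 = lb" "regs s1 17 = f0" "mem s1 = mem s"
      using s' a by (simp_all add: addr)
  qed
  define R2 where "R2 = (\<lambda>s' :: ram_state. (\<forall>r<20. regs s' r = regs s1 r) \<and>
     (\<forall>x\<le>Y. mem s' (u + x) = popcount x) \<and> (\<forall>x\<le>Y. mem s' (v + x) = bitlen x) \<and>
     (\<forall>a. a < u \<longrightarrow> mem s' a = mem s1 a))"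
  have 2: "runs w tables_prog s1 (10 + 15 * Y) R2"
    unfolding R2_def by (rule tables_prog) (use s1 fm_lt(8) in \<open>auto simp: addr\<close>)

  define st3 where "st3 = fold (instr_val w) [Binop Add 20 8 0, Load 5 20, Binop Sub 5 5 3, Binop Add 20 8 6, Load 11 20,
      Binop Add 11 11 5, Binop Add 11 11 3, Copy 18 11, Copy 16 1, Copy 10 17]"
  \<comment> \<open>\<open>base\<close>, \<open>P0\<close> and \<open>P1\<close> accumulate what is
    finished: the word tables and global registers, then the table of \<open>A\<close>, then the
    scales.\<close>
  define base where "base = (\<lambda>s' :: ram_state. regs s' 3 = 1 \<and> regs s' 4 = 1 \<and> regs s' 5 = b \<and> regs s' 6 = Y \<and>
     regs s' 7 = u \<and> regs s' 8 = v \<and> regs s' 9 = lb \<and> regs s' 10 = f0 \<and> regs s' 11 = C \<and>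
     (\<forall>x\<le>Y. mem s' (u + x) = popcount x) \<and> (\<forall>x\<le>Y. mem s' (v + x) = bitlen x))"
  have base_tables: "tables_ready w b Y s'" if "base s'" for s'
  proof -
    have "x \<le> Y" if "x < 2 ^ b" for x using that pow_b mY by linarith
    moreover have "u + 2 ^ b \<le> 2 ^ w" using pow_b mY fm_lt(9) unfolding u_def v_def by linarith
    moreover have "v + Y < 2 ^ w" using fm_lt(8) unfolding addr by linarith
    ultimately show ?thesis using that b unfolding base_def tables_ready_def by auto
  qed
  have base_cong: "base s''" if "base s'" "\<And>r. 2 < r \<Longrightarrow> r < 12 \<Longrightarrow> regs s'' r = regs s' r"
    "\<And>a. u \<le> a \<Longrightarrow> a < lb \<Longrightarrow> mem s'' a = mem s' a" for s' s''
  proof -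
    have "mem s'' (u + x) = mem s' (u + x)" "mem s'' (v + x) = mem s' (v + x)" if "x \<le> Y" for x
      by (rule \<open>\<And>a. u \<le> a \<Longrightarrow> a < lb \<Longrightarrow> mem s'' a = mem s' a\<close>; use that in \<open>simp add: addr\<close>)+
    then show ?thesis using that(1,2) unfolding base_def by simp
  qed
  have pc_of_base: "mem s' (regs s' 7 + x) = popcount x" "regs s' 7 + 2 ^ b \<le> lb" "length xs < regs s' 7"
    if "base s'" "x < 2 ^ b" for s' x
    using that pow_b mY len unfolding base_def u_def lb_def by auto

  have s3: "base (st3 s2)" "regs (st3 s2) 16 = length xs" "regs (st3 s2) 17 = f0" "regs (st3 s2) 18 = C"
    "\<And>i. i < length xs \<Longrightarrow> mem (st3 s2) (Suc i) = xs ! i" if "R2 s2" for s2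
  proof -
    have r: "regs s2 0 = m" "regs s2 1 = length xs" "regs s2 3 = 1" "regs s2 4 = 1" "regs s2 6 = Y"
      "regs s2 7 = u" "regs s2 8 = v" "regs s2 9 = lb" "regs s2 17 = f0"
      using that s1 unfolding R2_def by simp_all
    \<comment> \<open>The machine obtains \<open>b\<close> from the bit length table, whose range
      \<open>0..Y\<close> contains \<open>m\<close>.\<close>
    have m: "mem s2 (v + m) = b + 1" "mem s2 (v + Y) = bitlen Y"
      using that mY b(1) unfolding R2_def by auto
    have a: "v + m < 2 ^ w" "v + Y < 2 ^ w" using fm_lt(8) mY unfolding addr by linarith+
    have e: "(Suc b + 2 ^ w - Suc 0) mod 2 ^ w = b" using sub_word[of 1 "Suc b" w] fm_lt(13) bm fm_lt(17) by simp
    have c: "bitlen Y + b < 2 ^ w" "Suc (bitlen Y + b) < 2 ^ w" "Suc (bitlen Y + b) = C"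
      using fm_lt(11) unfolding C_def by linarith+
    have st: "regs (st3 s2) 5 = b" "regs (st3 s2) 11 = C" "regs (st3 s2) 18 = C" "regs (st3 s2) 16 = length xs"
      "regs (st3 s2) 10 = f0" "mem (st3 s2) = mem s2"
      "\<And>r. r < 20 \<Longrightarrow> r \<notin> {5, 10, 11, 16, 18} \<Longrightarrow> regs (st3 s2) r = regs s2 r"
      unfolding st3_def using r m a e c by simp_all
    show "base (st3 s2)" using st(1,2,5,6) st(7)[of 3] st(7)[of 4] st(7)[of 6] st(7)[of 7] st(7)[of 8] st(7)[of 9] r that
      unfolding base_def R2_def by simp
    show "regs (st3 s2) 16 = length xs" "regs (st3 s2) 17 = f0" "regs (st3 s2) 18 = C" using st r by simp_all
    show "mem (st3 s2) (Suc i) = xs ! i" if "i < length xs" for i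
      using \<open>R2 s2\<close> that st(6) s1(10) input len unfolding R2_def u_def by simp
  qed

  define P0 where "P0 = (\<lambda>s' :: ram_state. base s' \<and> rank_table (mem s') f0 b C (map (col0 b C) xs))"
  define R4 where "R4 = (\<lambda>s' :: ram_state. P0 s' \<and> regs s' 17 = f \<and> regs s' 16 = length xs \<and>
     (\<forall>i<length xs. mem s' (Suc i) = xs ! i))"
  have 4: "runs w (build col0_prog) (st3 s2) (30 + length xs * 26 + 32 * G0) R4" if R2: "R2 s2" for s2
  proof -
    define s3 where "s3 = st3 s2"
    note s3 = s3[OF R2, folded s3_def]
    have r: "regs s3 3 = 1" "regs s3 5 = b" "regs s3 11 = C" using s3(1) unfolding base_def by simp_all
    show ?thesis unfolding s3_def[symmetric]
    proof (rule runs_mono[OF build[where b = b and xs = xs and fr = f0 and C = C and Tc = 10 and f = "col0 b C"]])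
      show "f0 + 2 * ((length xs div b + 2) * C) < 2 ^ w" using fm_lt(3) unfolding f_def G0_def .
      show "length xs < f0" using len unfolding f0_def by simp
      show "mem s3 (regs s3 7 + x) = popcount x" if "x < 2 ^ b" for x using pc_of_base(1)[OF s3(1) that] .
      show "regs s3 7 + 2 ^ b \<le> f0" using pc_of_base(2)[OF s3(1), of 0] b unfolding lb_def f0_def by simp
      show "col0 b C (xs ! i) < C" if "i < length xs" for i
        unfolding col0_def using b by (auto simp: C_def)
      show "runs w col0_prog s' 10 (\<lambda>s''. regs s'' 24 = col0 b C (xs ! i) \<and> mem s'' = mem s' \<and>
         (\<forall>r<30. r \<noteq> 24 \<longrightarrow> regs s'' r = regs s' r))"
        if "i < length xs" "\<forall>r<20. regs s' r = regs s3 r" "\<forall>a<f0. mem s' a = mem s3 a" "regs s' 24 = xs ! i" for s' i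
      proof (rule col0_prog)
        have "base s'" by (rule base_cong[OF s3(1)]) (use that in \<open>auto simp: addr\<close>)
        then show "tables_ready w b Y s'" by (rule base_tables)
      qed (use that r digits fm_lt(11) in \<open>auto simp: C_def\<close>)
      show "R4 s'" if s': "regs s' 17 = f0 + 2 * ((length xs div b + 2) * C) \<and>
       (\<forall>r<20. r \<noteq> 17 \<longrightarrow> regs s' r = regs s3 r) \<and>
       (\<forall>a. a < f0 \<or> f0 + 2 * ((length xs div b + 2) * C) \<le> a \<longrightarrow> mem s' a = mem s3 a) \<and>
       rank_table (mem s') f0 b C (map (col0 b C) xs)" for s'
      proof -
        have "base s'" by (rule base_cong[OF s3(1)]) (use s' in \<open>auto simp: addr\<close>)
        moreover have "mem s' (Suc i) = xs ! i" if "i < length xs" for i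
          using s' s3(5)[OF that] that len unfolding f0_def by simp
        ultimately show ?thesis unfolding R4_def P0_def f_def G0_def using s' s3(2) by simp
      qed
    qed (use r s3 b in \<open>auto simp: G0_def C_def\<close>)
  qed

  define st5 where "st5 = fold (instr_val w) [Copy 12 5, Const 13 1]"
  have s5: "P0 (st5 s4)" "regs (st5 s4) 12 = b" "regs (st5 s4) 13 = 1" "regs (st5 s4) 16 = length xs" "regs (st5 s4) 17 = f"
    "mem (st5 s4) = mem s4" "\<And>i. i < length xs \<Longrightarrow> mem (st5 s4) (Suc i) = xs ! i" if "R4 s4" for s4
  proof -
    have st: "mem (st5 s4) = mem s4" "\<And>r. r < 12 \<Longrightarrow> regs (st5 s4) r = regs s4 r"
      "regs (st5 s4) 16 = regs s4 16" "regs (st5 s4) 17 = regs s4 17" "regs (st5 s4) 13 = 1" "regs (st5 s4) 12 = regs s4 5"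
      using w1 by (simp_all add: st5_def)
    have "base (st5 s4)" by (rule base_cong[of s4]) (use that st in \<open>auto simp: R4_def P0_def\<close>)
    then show "P0 (st5 s4)" "regs (st5 s4) 12 = b" using that st unfolding R4_def P0_def by (simp_all add: base_def)
  qed (use that w1 in \<open>auto simp: st5_def R4_def\<close>)

  define P1 where "P1 = (\<lambda>s' :: ram_state. P0 s' \<and> regs s' 12 = t \<and> regs s' 13 = Suc n \<and>
     (\<forall>k<n. mem s' (lb + Suc k) = level_start f b xs k \<and> level_table (mem s') b xs (level_start f b xs k) k))"
  \<comment> \<open>All scale tables end before \<open>fn\<close>, and the array below
    \<open>u\<close> no longer matters, so later phases may overwrite the array and build from
    \<open>fn\<close> on.\<close>
  have P1_cong: "P1 s''" if "P1 s'" "\<And>r. 2 < r \<Longrightarrow> r < 14 \<Longrightarrow> regs s'' r = regs s' r"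
    "\<And>a. u \<le> a \<Longrightarrow> a < fn \<Longrightarrow> mem s'' a = mem s' a" for s' s''
  proof -
    have "base s''" by (rule base_cong[of s']) (use that f_fn in \<open>auto simp: P1_def P0_def f_def addr\<close>)
    moreover have "rank_table (mem s'') f0 b C (map (col0 b C) xs)"
    proof (rule rank_table_cong[of "mem s'"])
      show "rank_table (mem s') f0 b C (map (col0 b C) xs)" using that(1) unfolding P1_def P0_def by simp
      fix a assume "f0 \<le> a" "a < f0 + 2 * ((length (map (col0 b C) xs) div b + 1) * C)"
      moreover have "(length (map (col0 b C) xs) div b + 1) * C \<le> G0" unfolding G0_def length_map by (rule mult_right_mono) auto
      ultimately show "mem s'' a = mem s' a" using f_fn unfolding f_def addr by (intro that(3)) (auto simp: addr)
    qed
    moreover have "mem s'' (lb + Suc k) = level_start f b xs k \<and> level_table (mem s'') b xs (level_start f b xs k) k"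
      if "k < n" for k
    proof -
      have lt: "lb + Suc k < f0" using that nY unfolding addr by linarith
      have "mem s'' (lb + Suc k) = mem s' (lb + Suc k)"
        by (rule \<open>\<And>a. u \<le> a \<Longrightarrow> a < fn \<Longrightarrow> mem s'' a = mem s' a\<close>) (use lt f_fn in \<open>auto simp: addr f_def\<close>)
      moreover have "level_table (mem s'') b xs (level_start f b xs k) k"
      proof (rule level_table_cong[of "mem s'"])
        show "level_table (mem s') b xs (level_start f b xs k) k" using \<open>P1 s'\<close> that unfolding P1_def by simp
        fix a assume a: "level_start f b xs k \<le> a" "a < level_start f b xs k + 2 * level_size b xs k"
        have "level_start f b xs (Suc k) \<le> fn" unfolding fn_def using that by (intro level_start_mono) simp
        moreover have "f \<le> a" using a(1) level_start_mono[of 0 k f b xs] by simp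
        ultimately show "mem s'' a = mem s' a"
          using a by (intro \<open>\<And>a. u \<le> a \<Longrightarrow> a < fn \<Longrightarrow> mem s'' a = mem s' a\<close>) (auto simp: addr f_def)
      qed
      ultimately show ?thesis using \<open>P1 s'\<close> that unfolding P1_def by simp
    qed
    ultimately show ?thesis using that(1,2) unfolding P1_def P0_def by simp
  qed

  define R6 where "R6 = (\<lambda>s' :: ram_state. P1 s' \<and> regs s' 17 = fn \<and> regs s' 16 = length (tails b xs n) \<and>
     (\<forall>i<length (tails b xs n). mem s' (Suc i) = tails b xs n ! i))"
  have 6: "runs w levels_prog (st5 s4) (1 + 330 * Y) R6" if R4: "R4 s4" for s4
  proof -
    define s5 where "s5 = st5 s4"
    note s5 = s5[OF R4, folded s5_def]
    have bs: "base s5" using s5(1) unfolding P0_def by simp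
    have r: "regs s5 3 = 1" "regs s5 5 = b" "regs s5 6 = Y" "regs s5 9 = lb" using bs unfolding base_def by simp_all
    show ?thesis unfolding s5_def[symmetric]
    proof (rule runs_mono[OF levels_prog[where n = n and b = b and Y = Y and xs = xs and lb = lb and f = f]])
      show "mem s5 (regs s5 7 + x) = popcount x" if "x < 2 ^ b" for x using pc_of_base(1)[OF bs that] .
      show "regs s5 7 + 2 ^ b \<le> lb" "length xs < regs s5 7" using pc_of_base(2,3)[OF bs, of 0] b by simp_all
      show "level_start f b xs n < 2 ^ w" using fm_lt(2) unfolding fn_def .
      show "length xs < lb" "lb + n < f" using len nY unfolding f_def addr by simp_all
      show "1 + (\<Sum>i<n. Suc (level_time b xs i)) \<le> 1 + 330 * Y"
        using level_time_sum[OF b(2) S t2 nY] len mY by simp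
      show "R6 s'" if inv: "level_inv b xs lb f s5 n s'" for s'
      proof -
        have keep: "mem s' a = mem s5 a" if "length xs < a" "a < f" "a \<notin> {lb + 1..lb + n}" for a
          using inv that unfolding level_inv_def by blast
        have rr: "regs s' r = regs s5 r" if "r < 12" for r using inv that unfolding level_inv_def by auto
        have "base s'" by (rule base_cong[OF bs]) (use rr keep len in \<open>auto simp: addr f_def\<close>)
        moreover have "rank_table (mem s') f0 b C (map (col0 b C) xs)"
        proof (rule rank_table_cong[of "mem s5"])
          show "rank_table (mem s5) f0 b C (map (col0 b C) xs)" using s5(1) unfolding P0_def by simp
          fix a assume "f0 \<le> a" "a < f0 + 2 * ((length (map (col0 b C) xs) div b + 1) * C)"
          moreover have "(length (map (col0 b C) xs) div b + 1) * C \<le> G0" unfolding G0_def length_map by (rule mult_right_mono) auto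
          ultimately show "mem s' a = mem s5 a" using len nY by (intro keep) (auto simp: f_def addr)
        qed
        ultimately show ?thesis using inv unfolding R6_def P1_def P0_def level_inv_def t_def fn_def by auto
      qed
    qed (use n_min n r s5 fm_lt b in \<open>auto simp: t_def\<close>)
  qed

  define R7 where "R7 = (\<lambda>s' :: ram_state. P1 s' \<and> regs s' 17 = fn \<and> regs s' 16 = length ys \<and>
     (\<forall>i<length ys. mem s' (Suc i) = ys ! i))"
  have tl: "length (tails b xs n) \<le> length xs" by (cases n) (auto simp: tails_def)
  have ysl: "length ys \<le> length xs" by (simp add: ys_def)
  have 7: "runs w filter_prog s6 (10 + 11 * Y) R7" if R6: "R6 s6" for s6
  proof (rule runs_mono[OF filter_prog[where t = t and xs = "tails b xs n"]])
    have bs: "base s6" using R6 unfolding R6_def P1_def P0_def by simp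
    show "regs s6 3 = 1" "regs s6 12 = t" "regs s6 16 = length (tails b xs n)"
      using bs R6 unfolding base_def R6_def P1_def by simp_all
    show "length (tails b xs n) < 2 ^ w" using tl fm_lt(16) by linarith
    show "mem s6 (Suc i) = tails b xs n ! i" if "i < length (tails b xs n)" for i
      using R6 that unfolding R6_def by simp
    show "10 + 11 * length (tails b xs n) \<le> 10 + 11 * Y" using tl len mY by linarith
    show "R7 s'" if "let zs = filter (\<lambda>a. t \<le> a) (tails b xs n) in
     (\<forall>r<20. r \<noteq> 16 \<longrightarrow> regs s' r = regs s6 r) \<and> regs s' 16 = length zs \<and>
     (\<forall>i<length zs. mem s' (Suc i) = zs ! i) \<and> (\<forall>a>length (tails b xs n). mem s' a = mem s6 a)" for s'
    proof -
      note s' = that[unfolded t_def filter_tails Let_def, folded ys_def]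
      have "P1 s'" by (rule P1_cong[of s6]) (use R6 s' tl len in \<open>auto simp: R6_def u_def\<close>)
      then show ?thesis using s' R6 unfolding R7_def R6_def by simp
    qed
  qed

  define st8 where "st8 = fold (instr_val w) [Copy 14 17, Binop Add 18 6 3, Binop Add 18 18 3]"
  define R9 where "R9 = (\<lambda>s' :: ram_state. P1 s' \<and> regs s' 14 = fn \<and> regs s' 17 = fm \<and> regs s' 16 = length ys \<and>
     (\<forall>i<length ys. mem s' (Suc i) = ys ! i) \<and> rank_table (mem s') fn b (Y + 2) (map (colh b Y) ys))"
  have len_fn: "length ys < fn" using ysl len f_fn unfolding f_def f0_def by linarith
  have pc_fn: "regs s' 7 + 2 ^ b \<le> fn" if "base s'" for s'
    using pc_of_base(2)[OF that, of 0] f_fn b unfolding f_def addr by simp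
  have ysd: "(ys ! i) div b \<le> Y" if "i < length ys" for i
    using nth_mem[OF that] digits unfolding ys_def by simp
  have 9: "runs w (build colh_prog) (st8 s7) (30 + 26 * Y + 288 * Y) R9" if R7: "R7 s7" for s7
  proof -
    have bs7: "base s7" using R7 unfolding R7_def P1_def P0_def by simp
    define s8 where "s8 = st8 s7"
    have a: "Suc Y < 2 ^ w" "Suc (Suc Y) < 2 ^ w" using fm_lt(14) by linarith+
    have s8: "mem s8 = mem s7" "regs s8 14 = fn" "regs s8 18 = Y + 2" "regs s8 17 = fn" "regs s8 16 = length ys"
      "\<And>r. r < 14 \<Longrightarrow> regs s8 r = regs s7 r"
      using R7 bs7 a unfolding R7_def base_def by (simp_all add: s8_def st8_def)
    have P1: "P1 s8" by (rule P1_cong[of s7]) (use R7 s8 in \<open>auto simp: R7_def\<close>)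
    have bs: "base s8" using P1 unfolding P1_def P0_def by simp
    have r: "regs s8 3 = 1" "regs s8 5 = b" "regs s8 6 = Y" using bs unfolding base_def by simp_all
    show ?thesis unfolding s8_def[symmetric]
    proof (rule runs_mono[OF build[where b = b and xs = ys and fr = fn and C = "Y + 2" and Tc = 10 and f = "colh b Y"]])
      show "fn + 2 * ((length ys div b + 2) * (Y + 2)) < 2 ^ w" using fm_lt(1) unfolding fm_def Gh_def .
      show "mem s8 (Suc i) = ys ! i" if "i < length ys" for i using R7 that s8(1) unfolding R7_def by simp
      show "mem s8 (regs s8 7 + x) = popcount x" if "x < 2 ^ b" for x using pc_of_base(1)[OF bs that] .
      show "runs w colh_prog s' 10 (\<lambda>s''. regs s'' 24 = colh b Y (ys ! i) \<and> mem s'' = mem s' \<and>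
         (\<forall>r<30. r \<noteq> 24 \<longrightarrow> regs s'' r = regs s' r))"
        if "i < length ys" "\<forall>r<20. regs s' r = regs s8 r" "\<forall>a<fn. mem s' a = mem s8 a" "regs s' 24 = ys ! i" for s' i
        by (rule colh_prog) (use that r ysd fm_lt(14) in auto)
      show "30 + length ys * (10 + 16) + 32 * ((length ys div b + 2) * (Y + 2)) \<le> 30 + 26 * Y + 288 * Y"
        unfolding Gh_def[symmetric] using Gh_le ysl len mY by simp
      show "R9 s'" if s': "regs s' 17 = fn + 2 * ((length ys div b + 2) * (Y + 2)) \<and>
       (\<forall>r<20. r \<noteq> 17 \<longrightarrow> regs s' r = regs s8 r) \<and>
       (\<forall>a. a < fn \<or> fn + 2 * ((length ys div b + 2) * (Y + 2)) \<le> a \<longrightarrow> mem s' a = mem s8 a) \<and>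
       rank_table (mem s') fn b (Y + 2) (map (colh b Y) ys)" for s'
      proof -
        have "P1 s'" by (rule P1_cong[OF P1]) (use s' in auto)
        moreover have "mem s' (Suc i) = ys ! i" if "i < length ys" for i
          using s' that len_fn R7 s8(1) unfolding R7_def by simp
        ultimately show ?thesis unfolding R9_def fm_def Gh_def using s' s8 by simp
      qed
    qed (use r s8 b len_fn pc_fn[OF bs] in \<open>auto simp: colh_def\<close>)
  qed

  define st10 where "st10 = fold (instr_val w) [Copy 15 17, Copy 18 5]"
  have 11: "runs w (build coll_prog) (st10 s9) (30 + 26 * Y + 96 * Y) (ready w b Y xs)" if R9: "R9 s9" for s9
  proof -
    have bs9: "base s9" using R9 unfolding R9_def P1_def P0_def by simp
    define s10 where "s10 = st10 s9"
    have s10: "mem s10 = mem s9" "regs s10 14 = fn" "regs s10 15 = fm" "regs s10 18 = b" "regs s10 17 = fm"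
      "regs s10 16 = length ys" "\<And>r. r < 14 \<Longrightarrow> regs s10 r = regs s9 r"
      using R9 bs9 unfolding R9_def base_def by (simp_all add: s10_def st10_def)
    have P1: "P1 s10" by (rule P1_cong[of s9]) (use R9 s10 in \<open>auto simp: R9_def\<close>)
    have bs: "base s10" using P1 unfolding P1_def P0_def by simp
    have r: "regs s10 3 = 1" "regs s10 5 = b" using bs unfolding base_def by simp_all
    have fnm: "fn \<le> fm" unfolding fm_def by simp
    show ?thesis unfolding s10_def[symmetric]
    proof (rule runs_mono[OF build[where b = b and xs = ys and fr = fm and C = b and Tc = 10 and f = "coll b"]])
      show "fm + 2 * ((length ys div b + 2) * b) < 2 ^ w" using end_le unfolding Gl_def .
      show "mem s10 (Suc i) = ys ! i" if "i < length ys" for i using R9 that s10(1) unfolding R9_def by simp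
      show "mem s10 (regs s10 7 + x) = popcount x" if "x < 2 ^ b" for x using pc_of_base(1)[OF bs that] .
      show "regs s10 7 + 2 ^ b \<le> fm" using pc_fn[OF bs] fnm by simp
      show "coll b (ys ! i) < b" for i using b unfolding coll_def by simp
      show "runs w coll_prog s' 10 (\<lambda>s''. regs s'' 24 = coll b (ys ! i) \<and> mem s'' = mem s' \<and>
         (\<forall>r<30. r \<noteq> 24 \<longrightarrow> regs s'' r = regs s' r))"
        if "i < length ys" "\<forall>r<20. regs s' r = regs s10 r" "\<forall>a<fm. mem s' a = mem s10 a" "regs s' 24 = ys ! i" for s' i
        by (rule coll_prog) (use that r b fm_lt(13) in auto)
      show "30 + length ys * (10 + 16) + 32 * ((length ys div b + 2) * b) \<le> 30 + 26 * Y + 96 * Y"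
        unfolding Gl_def[symmetric] using Gl_le ysl len mY by simp
      show "ready w b Y xs s'" if s': "regs s' 17 = fm + 2 * ((length ys div b + 2) * b) \<and>
       (\<forall>r<20. r \<noteq> 17 \<longrightarrow> regs s' r = regs s10 r) \<and>
       (\<forall>a. a < fm \<or> fm + 2 * ((length ys div b + 2) * b) \<le> a \<longrightarrow> mem s' a = mem s10 a) \<and>
       rank_table (mem s') fm b b (map (coll b) ys)" for s'
      proof -
        have P1': "P1 s'" by (rule P1_cong[OF P1]) (use s' fnm in auto)
        have bs': "base s'" and t0: "rank_table (mem s') f0 b C (map (col0 b C) xs)"
          using P1' unfolding P1_def P0_def by auto
        have r': "regs s' 4 = 1" "regs s' 9 = lb" "regs s' 10 = f0" "regs s' 11 = C" "regs s' 12 = t" "regs s' 13 = Suc n"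
          "regs s' 14 = fn" "regs s' 15 = fm"
          using bs' P1' s' s10 unfolding base_def P1_def by auto
        have th: "rank_table (mem s') fn b (Y + 2) (map (colh b Y) ys)"
        proof (rule rank_table_cong[of "mem s10"])
          show "rank_table (mem s10) fn b (Y + 2) (map (colh b Y) ys)" using R9 s10(1) unfolding R9_def by simp
          fix a assume "fn \<le> a" "a < fn + 2 * ((length (map (colh b Y) ys) div b + 1) * (Y + 2))"
          moreover have "(length (map (colh b Y) ys) div b + 1) * (Y + 2) \<le> Gh"
            unfolding Gh_def length_map by (rule mult_right_mono) auto
          ultimately have "a < fm" unfolding fm_def by linarith
          then show "mem s' a = mem s10 a" using s' by simp
        qed
        have lev: "level_ready w b xs s' k" if k: "0 < k" "k < Suc n" for k
        proof -
          obtain i where i: "k = Suc i" "i < n" using k by (cases k) auto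
          have sz: "(length (tails b xs (Suc i)) div b + 1) * (b * 2 ^ i) \<le> level_size b xs i"
            unfolding level_size_def by (rule mult_right_mono) auto
          have "level_start f b xs (Suc i) \<le> fn" unfolding fn_def using i by (intro level_start_mono) simp
          then have "level_start f b xs i + 2 * ((length (tails b xs (Suc i)) div b + 1) * (b * 2 ^ i)) < 2 ^ w"
            using sz fm_lt(2) unfolding level_start_Suc by linarith
          moreover have "2 * (b * 2 ^ i) < 2 ^ w" using n_min[OF i(2)] fm_lt(7) by linarith
          ultimately show ?thesis using P1' i r'(2) unfolding level_ready_def P1_def level_table_def Let_def
            by simp
        qed
        have "(length xs div b + 1) * C \<le> G0" unfolding G0_def by (rule mult_right_mono) auto
        then have room0: "f0 + 2 * ((length xs div b + 1) * C) < 2 ^ w" using fm_lt(3) unfolding f_def by linarith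
        have roomh: "fn + 2 * (Y + 2) < 2 ^ w" "fm + 2 * b < 2 ^ w"
        proof -
          have "1 * (Y + 2) \<le> Gh" "1 * b \<le> Gl" unfolding Gh_def Gl_def by (rule mult_right_mono; simp)+
          then show "fn + 2 * (Y + 2) < 2 ^ w" "fm + 2 * b < 2 ^ w" using fm_lt(1) end_le unfolding fm_def by linarith+
        qed
        have yst: "filter (\<lambda>a. t \<le> a) xs = ys" unfolding ys_def t_def by simp
        show ?thesis unfolding ready_def r' Let_def yst
        proof (intro conjI)
          show "tables_ready w b Y s'" using bs' by (rule base_tables)
          show "rank_table (mem s') fm b b (map (coll b) ys)" using s' by blast
        qed (use t0 th lev room0 roomh fm_lt digits ys_len nbl in \<open>auto simp: C_def t_def\<close>)
      qed
    qed (use r s10 b len_fn fnm in auto)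
  qed

  show ?thesis unfolding large_prep_def
    by (rule runs_block_Seq, fold s1_def, rule runs_Seq[OF 2], rule runs_block_Seq, fold st3_def, erule runs_Seq[OF 4],
        rule runs_block_Seq, fold st5_def, erule runs_Seq[OF 6], erule runs_Seq[OF 7],
        rule runs_block_Seq, fold st8_def, erule runs_Seq[OF 9], rule runs_block_Seq, fold st10_def, erule 11,
        rule lessI, rule order_refl, rule lessI, rule order_refl, rule order_refl, rule lessI, rule order_refl,
        rule lessI, rule order_refl)
      (use G0_le len mY bm b in simp)
qed

section \<open>Scanning for small \<open>m\<close>, and the choice between the two methods\<close>

definition scan_query :: prog where
  "scan_query = block [Const 20 0, Const 21 0] ;;
     While (Less 20 0)
       (block [Load 22 0, Binop Sub 0 0 3] ;;
        Cond (Less 22 1) (block []) (block [Binop Add 21 21 3])) ;;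
     block [Copy 0 21]"

text \<open>Counting down lets register 0 serve as loop counter and as address, since entry
  \<open>i\<close> is in cell \<open>i\<close>. The linear time is a constant where this is used, as
  the array is then shorter than \<open>2 ^ (7 + D)\<close>.\<close>

lemma scan_query:
  assumes regs: "regs s 0 = j" "regs s 1 = v" "regs s 3 = 1" and j: "j \<le> length xs" "length xs < 2 ^ w"
    and input: "\<And>i. i < length xs \<Longrightarrow> mem s (Suc i) = xs ! i"
  shows "runs w scan_query s (10 + 8 * j) (\<lambda>s'. regs s' 0 = length (filter (\<lambda>a. v \<le> a) (take j xs)) \<and>
     mem s' = mem s \<and> (\<forall>r. 2 < r \<longrightarrow> r < 19 \<longrightarrow> regs s' r = regs s r))"
proof -
  define L where "L = (\<lambda>i. length (filter (\<lambda>a. v \<le> a) (take i xs)))"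
  define s0 where "s0 = fold (instr_val w) [Const 20 0, Const 21 0] s"
  let ?I = "\<lambda>i (s' :: ram_state). regs s' 0 = j - i \<and> regs s' 1 = v \<and> regs s' 20 = 0 \<and>
     regs s' 21 + L (j - i) = L j \<and> mem s' = mem s \<and> (\<forall>r. 2 < r \<longrightarrow> r < 19 \<longrightarrow> regs s' r = regs s r)"
  let ?body = "block [Load 22 0, Binop Sub 0 0 3] ;;
        Cond (Less 22 1) (block []) (block [Binop Add 21 21 3])"
  have L_lt: "L j < 2 ^ w" unfolding L_def using j by (intro le_less_trans[OF length_filter_le]) simp
  have loop: "runs w (While (Less 20 0) ?body) s0 (1 + j * 8) (?I j)"
  proof (rule runs_While_uniform[where T = 7 and I = ?I and n = j])
    show "?I 0 s0" using regs by (simp add: s0_def)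
    show "\<not> test_val (Less 20 0) s'" if "?I j s'" for s' using that by simp
    fix i and s' :: ram_state assume i: "i < j" and I: "?I i s'"
    define k where "k = j - Suc i"
    have k: "j - i = Suc k" "j - Suc i = k" "k < length xs" using i j by (auto simp: k_def)
    have Suc: "L (Suc k) = L k + (if v \<le> xs ! k then 1 else 0)"
      using k by (simp add: L_def take_Suc_conv_app_nth)
    have e: "(Suc k + 2 ^ w - Suc 0) mod 2 ^ w = k" using sub_word[of 1 "Suc k" w] k j by simp
    define s1 where "s1 = fold (instr_val w) [Load 22 0, Binop Sub 0 0 3] s'"
    have s1: "regs s1 22 = xs ! k" "regs s1 0 = k" "regs s1 1 = v" "regs s1 20 = 0" "regs s1 21 = regs s' 21"
      "mem s1 = mem s" "\<And>r. 2 < r \<Longrightarrow> r < 19 \<Longrightarrow> regs s1 r = regs s r"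
      using I k e regs(3) input by (simp_all add: s1_def)
    have r3: "regs s1 3 = 1" using s1(7)[of 3] regs by simp
    have sum: "regs s' 21 + L (Suc k) = L j" using I k by simp
    have "runs w (Cond (Less 22 1) (block []) (block [Binop Add 21 21 3])) s1 4 (?I (Suc i))"
    proof (rule runs_Cond[where T = 2])
      assume "test_val (Less 22 1) s1"
      then show "runs w (block []) s1 2 (?I (Suc i))"
        using s1 sum Suc k by (intro runs_block) auto
    next
      assume "\<not> test_val (Less 22 1) s1"
      then have S: "L (Suc k) = L k + 1" using s1 Suc by simp
      then have "Suc (regs s' 21) < 2 ^ w" using sum L_lt by linarith
      then show "runs w (block [Binop Add 21 21 3]) s1 2 (?I (Suc i))"
        using s1 sum S k r3 by (intro runs_block) auto
    qed simp
    then have "runs w ?body s' 7 (?I (Suc i))"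
      unfolding s1_def by (rule runs_block_Seq) simp
    then show "test_val (Less 20 0) s' \<and> runs w ?body s' 7 (?I (Suc i))" using I i by simp
  qed simp
  have "runs w (block [Copy 0 21]) s' 2 (\<lambda>s'. regs s' 0 = length (filter (\<lambda>a. v \<le> a) (take j xs)) \<and>
     mem s' = mem s \<and> (\<forall>r. 2 < r \<longrightarrow> r < 19 \<longrightarrow> regs s' r = regs s r))" if "?I j s'" for s'
    by (rule runs_block) (use that in \<open>auto simp: L_def\<close>)
  then show ?thesis unfolding scan_query_def
    by (intro runs_block_Seq[OF runs_Seq[OF loop[unfolded s0_def]]]) auto
qed

text \<open>
  If \<open>7 + D \<ge> w\<close> then the constant wraps around to 0 and the subtraction to \<open>2 ^ w - 1\<close>, so the test
  correctly reports a small \<open>m\<close>.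
\<close>

definition prep :: "nat \<Rightarrow> prog" where
  "prep D = block [Const 3 1, Const 20 (2 ^ (7 + D)), Binop Sub 20 20 3] ;;
     Cond (Less 20 0) (large_prep D) (block [Const 4 0])"

definition query :: prog where
  "query = Cond (Equal 4 3) large_query scan_query"

text \<open>Holds after preprocessing and after each query, whichever method is in use.
  \<open>T\<close> bounds the length of an array that is scanned and hence the query time.\<close>

definition query_ready :: "nat \<Rightarrow> nat \<Rightarrow> nat list \<Rightarrow> ram_state \<Rightarrow> bool" where
  "query_ready w T xs s \<longleftrightarrow> (\<exists>b Y. ready w b Y xs s) \<or>
     regs s 3 = 1 \<and> regs s 4 = 0 \<and> length xs \<le> T \<and> length xs < 2 ^ w \<and> (\<forall>i<length xs. mem s (Suc i) = xs ! i)"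

lemma query_ready_cong:
  assumes "query_ready w T xs s" "mem s' = mem s" "\<And>r. 2 < r \<Longrightarrow> r < 19 \<Longrightarrow> regs s' r = regs s r"
  shows "query_ready w T xs s'"
  using assms(1) unfolding query_ready_def
proof
  assume "\<exists>b Y. ready w b Y xs s"
  then show "(\<exists>b Y. ready w b Y xs s') \<or> regs s' 3 = 1 \<and> regs s' 4 = 0 \<and> length xs \<le> T \<and>
      length xs < 2 ^ w \<and> (\<forall>i<length xs. mem s' (Suc i) = xs ! i)"
    using ready_cong[OF _ assms(2,3)] by blast
qed (use assms(2,3) in simp)

lemma query:
  assumes "query_ready w T xs s" "regs s 0 = j" "j \<le> length xs" "regs s 1 = v" "v < 2 ^ w"
  shows "runs w query s (80 + 8 * T)
     (\<lambda>s'. regs s' 0 = length (filter (\<lambda>a. v \<le> a) (take j xs)) \<and> query_ready w T xs s')"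
  unfolding query_def
proof (rule runs_Cond[where T = "70 + 8 * T"])
  assume eq: "test_val (Equal 4 3) s"
  then obtain b Y where "ready w b Y xs s" using assms(1) unfolding query_ready_def by auto
  from large_query[OF this assms(2-5)] show "runs w large_query s (70 + 8 * T)
     (\<lambda>s'. regs s' 0 = length (filter (\<lambda>a. v \<le> a) (take j xs)) \<and> query_ready w T xs s')"
    by (rule runs_mono) (auto simp: query_ready_def)
next
  assume "\<not> test_val (Equal 4 3) s"
  then have s: "regs s 3 = 1" "regs s 4 = 0" "length xs \<le> T" "length xs < 2 ^ w"
      "\<And>i. i < length xs \<Longrightarrow> mem s (Suc i) = xs ! i"
    using assms(1) unfolding query_ready_def ready_def tables_ready_def by auto
  show "runs w scan_query s (70 + 8 * T)
     (\<lambda>s'. regs s' 0 = length (filter (\<lambda>a. v \<le> a) (take j xs)) \<and> query_ready w T xs s')"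
    by (rule runs_mono[OF scan_query[OF assms(2,4) s(1) assms(3) s(4,5)]])
      (use s assms(3) in \<open>auto simp: query_ready_def\<close>)
qed simp

text \<open>The sum is compared with \<open>bitlen m - 1\<close>, the rounded logarithm, so that no
  reals occur; \<open>m * m \<le> 2 ^ w\<close> is the form in which the word size hypothesis
  enters.\<close>

lemma prep:
  assumes regs: "regs s 0 = m" "regs s 1 = length xs"
    and input: "\<And>i. i < length xs \<Longrightarrow> mem s (Suc i) = xs ! i"
    and len: "length xs \<le> m" and D: "0 < D" and m: "2 \<le> m" "m * m \<le> 2 ^ w"
    and S: "sum_list xs \<le> D * m * (bitlen m - 1)"
  shows "runs w (prep D) s ((2000 * D + 20) * m) (query_ready w (2 ^ (7 + D)) xs)"
proof -
  define c where "c = 7 + D"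
  have "2 * m \<le> m * m" using m by simp
  then have m_lt: "m < 2 ^ w" using m by linarith
  then have w: "0 < w" using m by (cases w) auto
  define s1 where "s1 = fold (instr_val w) [Const 3 1, Const 20 (2 ^ (7 + D)), Binop Sub 20 20 3] s"
  have s1: "regs s1 0 = m" "regs s1 1 = length xs" "regs s1 3 = 1" "mem s1 = mem s"
    "regs s1 20 = (2 ^ c mod 2 ^ w + 2 ^ w - 1) mod 2 ^ w"
    using regs w by (simp_all add: s1_def c_def)
  have test: "regs s1 20 < m \<longleftrightarrow> 2 ^ c \<le> m"
  proof (cases "c < w")
    case True
    then have p: "(2::nat) ^ c < 2 ^ w" by simp
    then have "regs s1 20 = 2 ^ c - 1" unfolding s1(5) using sub_word[of 1 "2 ^ c" w] by simp
    then show ?thesis using m by (auto simp: Suc_le_eq[symmetric])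
  next
    case False
    then have "(2::nat) ^ w dvd 2 ^ c" by (intro le_imp_power_dvd) simp
    then have "(2::nat) ^ c mod 2 ^ w = 0" by (rule dvd_imp_mod_0)
    then have "regs s1 20 = 2 ^ w - 1" unfolding s1(5) by simp
    moreover have "(2::nat) ^ w \<le> 2 ^ c" using False by (intro power_increasing) auto
    ultimately show ?thesis using m_lt by linarith
  qed
  have large: "runs w (large_prep D) s1 (2000 * (D * m)) (query_ready w (2 ^ c) xs)" if big: "2 ^ c \<le> m"
  proof -
    define b where "b = bitlen m - 1"
    have cb: "c < bitlen m" using big by (simp add: bitlen_gt_iff)
    then have b: "bitlen m = b + 1" "0 < b" "c \<le> b" by (auto simp: b_def c_def)
    have m_b: "2 ^ b \<le> m" "m < 2 ^ (b + 1)" using bitlen_bounds[of m] b by auto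
    have "(2::nat) ^ b < 2 ^ w" using m_b(1) m_lt by linarith
    then have bw: "b < w" by simp
    have D_pow: "D < 2 ^ D" by (rule less_exp)
    \<comment> \<open>From \<open>7 + D \<le> b\<close> one gets
      \<open>D + (b + 1) \<le> 2 * b\<close>.\<close>
    have "D * m < 2 ^ D * 2 ^ (b + 1)" using D_pow m_b(2) by (intro mult_strict_mono) auto
    also have "\<dots> \<le> 2 ^ (2 * b)" unfolding power_add[symmetric] using b(3) unfolding c_def
      by (intro power_increasing) auto
    finally have "bitlen (D * m) \<le> 2 * b" by (simp add: bitlen_le_iff)
    moreover have "128 * (D * m) \<le> 2 ^ w"
    proof -
      \<comment> \<open>One factor \<open>m\<close> of the \<open>m * m\<close> available cells pays
        for the constant \<open>128 * D\<close>.\<close>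
      have "128 * D \<le> 2 ^ c" using D_pow unfolding c_def power_add by simp
      then have "128 * D * m \<le> m * m" using big by (intro mult_right_mono) auto
      from order_trans[OF this m(2)] show ?thesis by (simp only: mult.assoc)
    qed
    moreover have "sum_list xs \<le> D * m * b" using S unfolding b_def .
    ultimately have "runs w (large_prep D) s1 (2000 * (D * m)) (ready w b (D * m) xs)"
      by (intro large_prep[where m = m and Y = "D * m"]) (use s1 input len D b bw in auto)
    then show ?thesis by (rule runs_mono) (auto simp: query_ready_def)
  qed
  have small: "runs w (block [Const 4 0]) s1 2 (query_ready w (2 ^ c) xs)" if "m < 2 ^ c"
    by (rule runs_block) (use that s1 len m_lt input in \<open>auto simp: query_ready_def\<close>)
  have t: "test_val (Less 20 0) s1 \<longleftrightarrow> 2 ^ c \<le> m" using test s1(1) by simp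
  have "runs w (Cond (Less 20 0) (large_prep D) (block [Const 4 0])) s1 (2000 * (D * m) + 3) (query_ready w (2 ^ c) xs)"
  proof (rule runs_Cond[where T = "2000 * (D * m) + 2"], unfold t)
    show "runs w (large_prep D) s1 (2000 * (D * m) + 2) (query_ready w (2 ^ c) xs)" if "2 ^ c \<le> m"
      by (rule runs_mono[OF large[OF that]]) auto
    show "runs w (block [Const 4 0]) s1 (2000 * (D * m) + 2) (query_ready w (2 ^ c) xs)" if "\<not> 2 ^ c \<le> m"
      by (rule runs_mono[OF small]) (use that in auto)
  qed simp
  then show ?thesis unfolding prep_def s1_def c_def
    by (rule runs_block_Seq) (use m in \<open>simp add: algebra_simps\<close>)
qed

text \<open>Induction over the queries, since each starts in the state left by its predecessor;
  \<open>query_ready\<close> is reestablished every time.\<close>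

lemma answers_queries_if_ready:
  assumes "query_ready w T (map A [1..<Suc m']) s" "set qs \<subseteq> {0..m'} \<times> {0..<2 ^ w}"
  shows "answers_queries w A query (80 + 8 * T) s qs"
  using assms
proof (induction qs arbitrary: s)
  case (Cons q qs)
  obtain j v where q: "q = (j, v)" by (cases q)
  let ?xs = "map A [1..<Suc m']"
  define s1 where "s1 = set_reg 1 v (set_reg 0 j s)"
  have jv: "j \<le> m'" "v < 2 ^ w" using Cons.prems(2) q by auto
  have "query_ready w T ?xs s1"
    by (rule query_ready_cong[OF Cons.prems(1)]) (simp_all add: s1_def)
  then have "runs w query s1 (80 + 8 * T)
     (\<lambda>s'. regs s' 0 = length (filter (\<lambda>a. v \<le> a) (take j ?xs)) \<and> query_ready w T ?xs s')"
    by (rule query) (use jv in \<open>auto simp: s1_def\<close>)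
  moreover have "length (filter (\<lambda>a. v \<le> a) (take j ?xs)) = range_count A j v"
  proof -
    have "take j ?xs = map A [1..<Suc j]" using jv by (simp add: take_map del: upt_Suc)
    then have "length (filter (\<lambda>a. v \<le> a) (take j ?xs)) = length (filter (\<lambda>i. v \<le> A i) [1..<Suc j])"
      by (simp add: filter_map o_def del: upt_Suc)
    also have "\<dots> = card (set (filter (\<lambda>i. v \<le> A i) [1..<Suc j]))"
      by (rule distinct_card[symmetric]) simp
    also have "set (filter (\<lambda>i. v \<le> A i) [1..<Suc j]) = {i \<in> {1..j}. v \<le> A i}" by auto
    finally show ?thesis unfolding range_count_def .
  qed
  ultimately obtain t s' where "exec w query s1 t s'" "t \<le> 80 + 8 * T" "regs s' 0 = range_count A j v"
    "query_ready w T ?xs s'" unfolding runs_def by auto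
  moreover from this have "answers_queries w A query (80 + 8 * T) s' qs"
    using Cons by auto
  ultimately show ?case unfolding q s1_def by auto
qed simp

theorem theorem4p2:
  fixes c\<^sub>0 :: real
  shows "\<exists>(P :: prog) (Q :: prog) (C\<^sub>1 :: nat) (C\<^sub>2 :: nat).
    \<forall>(m :: nat) (m' :: nat) (w :: nat) (A :: nat \<Rightarrow> nat) (s :: ram_state).
      2 \<le> m \<longrightarrow> real w \<ge> 2 * log 2 (real m) \<longrightarrow> m' \<le> m \<longrightarrow>
      (\<forall>i\<in>{1..m'}. 0 < A i) \<longrightarrow>
      real (\<Sum>i = 1..m'. A i) \<le> c\<^sub>0 * real m * log 2 (real m) \<longrightarrow>
      holds_input w m m' A s \<longrightarrow>
      (\<exists>t s'. exec w P s t s' \<and> t \<le> C\<^sub>1 * m \<and>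
        (\<forall>qs. set qs \<subseteq> {0..m'} \<times> {0..<2 ^ w} \<longrightarrow> answers_queries w A Q C\<^sub>2 s' qs))"
proof -
  \<comment> \<open>The factor 2 pays for replacing \<open>log m\<close> by its rounded value
    \<open>b\<close>; the maximum keeps \<open>D\<close> positive even if \<open>c\<^sub>0\<close>
    is not.\<close>
  define D where "D = 2 * nat \<lceil>max 1 c\<^sub>0\<rceil>"
  have D0: "0 < D" unfolding D_def by (simp add: less_max_iff_disj)
  have D: "2 * c\<^sub>0 \<le> real D" unfolding D_def by linarith
  show ?thesis
  proof (rule exI[of _ "prep D"], rule exI[of _ query], rule exI[of _ "2000 * D + 20"],
      rule exI[of _ "80 + 8 * 2 ^ (7 + D)"], intro allI impI)
    fix m m' w :: nat and A :: "nat \<Rightarrow> nat" and s :: ram_state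
    assume m: "2 \<le> m" and w: "real w \<ge> 2 * log 2 (real m)" and m': "m' \<le> m"
      and S: "real (\<Sum>i = 1..m'. A i) \<le> c\<^sub>0 * real m * log 2 (real m)"
      and s: "holds_input w m m' A s"
    let ?xs = "map A [1..<Suc m']"
    have nth: "?xs ! i = A (Suc i)" if "i < m'" for i
      using that by (simp del: upt_Suc)
    have mm: "m * m \<le> 2 ^ w"
    proof -
      have "real m * real m = (2 powr log 2 (real m)) powr 2" using m by (simp add: power2_eq_square)
      also have "\<dots> \<le> 2 powr real w" unfolding powr_powr using w by (intro powr_mono) (auto simp: mult.commute)
      finally have "real (m * m) \<le> real (2 ^ w)" by (simp add: powr_realpow)
      then show ?thesis by (simp only: of_nat_le_iff)
    qed
    define b where "b = bitlen m - 1"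
    have b0: "1 < bitlen m" using m by (simp add: bitlen_gt_iff)
    then have m_b: "m < 2 ^ (b + 1)" "1 \<le> b" using bitlen_bounds[of m] by (auto simp: b_def)
    \<comment> \<open>\<open>log m < b + 1\<close>, and \<open>b \<ge> 1\<close> because
      \<open>m \<ge> 2\<close>.\<close>
    have log_b: "log 2 (real m) \<le> 2 * real b"
    proof -
      have "real m < real (2 ^ (b + 1))" using m_b(1) by (simp only: of_nat_less_iff)
      then have "real m < 2 powr real (b + 1)" by (subst powr_realpow) simp_all
      then have "log 2 (real m) < real (b + 1)" using m by (simp add: log_less_iff)
      then show ?thesis using m_b(2) by linarith
    qed
    have "c\<^sub>0 * real m * log 2 (real m) \<le> real (D * m * b)"
    proof -
      have "c\<^sub>0 * (real m * log 2 (real m)) \<le> real D / 2 * (real m * log 2 (real m))"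
        using D m by (intro mult_right_mono) auto
      also have "\<dots> \<le> real D / 2 * (real m * (2 * real b))"
        using log_b by (intro mult_left_mono) auto
      finally show ?thesis by (simp add: mult.assoc)
    qed
    then have "real (\<Sum>i = 1..m'. A i) \<le> real (D * m * b)" using S by linarith
    then have "(\<Sum>i = 1..m'. A i) \<le> D * m * b" by (simp only: of_nat_le_iff)
    moreover have "sum_list ?xs = (\<Sum>i = 1..m'. A i)"
      by (simp add: interv_sum_list_conv_sum_set_nat atLeastLessThanSuc_atLeastAtMost del: upt_Suc)
    ultimately have S': "sum_list ?xs \<le> D * m * (bitlen m - 1)" by (simp add: b_def)
    have "runs w (prep D) s ((2000 * D + 20) * m) (query_ready w (2 ^ (7 + D)) ?xs)"
      by (rule prep) (use s m m' mm S' D0 nth in \<open>auto simp: holds_input_def simp del: upt_Suc\<close>)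
    then show "\<exists>t s'. exec w (prep D) s t s' \<and> t \<le> (2000 * D + 20) * m \<and>
        (\<forall>qs. set qs \<subseteq> {0..m'} \<times> {0..<2 ^ w} \<longrightarrow> answers_queries w A query (80 + 8 * 2 ^ (7 + D)) s' qs)"
      unfolding runs_def using answers_queries_if_ready by blast
  qed
qed

end
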